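(* Let $q:\mathbb{R}^n\to\overline{\mathbb{R}}$ be a function and $\bar x\in\mathbb{R}^n$ with $0\in\partial q(\bar x)$, such that $q$ is both prox-regular and subdifferentially continuous at $\bar x$ for $\bar x^*=0$. Then the following statements are equivalent: (i) $\bar x$ is a tilt-stable local minimizer of $q$. (ii) $\partial q$ is SCD regular around $(\bar x,0)$ and $C_L$ is positive semidefinite (i.e. $\langle C_Lp,p\rangle\ge0$ for all $p\in\mathbb{R}^n$) for every $L\in\mathcal{S}\partial q(\bar x,0)$. Further, if $\bar x$ is a tilt-stable local minimizer of $q$, then $\mathrm{tilt}(q,\bar x)=\mathrm{scd\,reg}\,\partial q(\bar x,0)$.
   Context: Norms are Euclidean; $\mathcal{B}_\gamma(\bar x)$ is the closed ball; $\overline{\mathbb{R}}=\mathbb{R}\cup\{\pm\infty\}$. For a set $A$ and $\bar z\in A$, the tangent cone $T_A(\bar z)$ is the set of all $w$ for which there are $t_k\downarrow0$, $w_k\to w$ with $\bar z+t_kw_k\in A$ for all $k$; $\widehat N_A(\bar z)$ is its (negative) polar cone, and $N_A(\bar z)$ (limiting normal cone) is the set of limits of sequences $z_k^*\in\widehat N_A(z_k)$ with $z_k\to\bar z$, $z_k\in A$. Functions. For $q$ finite at $x$, $\partial q(x)=\{x^*\mid(x^*,-1)\in N_{\mathrm{epi}\,q}(x,q(x))\}$ (limiting subdifferential), $\mathrm{epi}\,q=\{(x,\alpha)\in\mathbb{R}^n\times\mathbb{R}\mid\alpha\ge q(x)\}$. $q$ is prox-regular at $\bar x$ for $\bar x^*\in\partial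 q(\bar x)$ if $q$ is locally lower semicontinuous around $\bar x$ and there are $\epsilon>0$, $\rho\ge0$ such that for all $x',x\in\mathcal{B}_\epsilon(\bar x)$ with $|q(x)-q(\bar x)|\le\epsilon$ one has $q(x')\ge q(x)+\langle x^*,x'-x\rangle-\frac\rho2\|x'-x\|^2$ whenever $x^*\in\partial q(x)\cap\mathcal{B}_\epsilon(\bar x^* )$. $q$ is subdifferentially continuous at $\bar x$ for $\bar x^*\in\partial q(\bar x)$ if $q(x_k)\to q(\bar x)$ for every sequence $(x_k,x_k^* )\to(\bar x,\bar x^* )$ in $\mathrm{gph}\,\partial q$. Tilt stability. $\bar x$ with $q(\bar x)<\infty$ is a tilt-stable local minimizer of $q$ if there is $\gamma>0$ such that $M_\gamma(x^* ):=\mathrm{arg\,min}\{q(x)-\langle x^*,x\rangle\mid x\in\mathcal{B}_\gamma(\bar x)\}$ is single-valued and Lipschitz continuous in some neighborhood of $0\in\mathbb{R}^n$ with $M_\gamma(0)=\{\bar x\}$. With such $\gamma$, $\mathrm{tilt}(q,\bar x):=\limsup_{v^*,w^*\to0,\ v^*\ne w^*}\|M_\gamma(v^* )-M_\gamma(w^* )\|/\|v^*-w^*\|$. Subspaces. $\mathcal{Z}_n$ is the set of $n$-dimensional linear subspaces of $\mathbb{R}^{2n}=\mathbb{R}^n\times\mathbb{R}^n$ with metric $d_{\mathcal{Z}}(L_1,L_2)=\|P_1-P_2\|$, $P_i$ the orthogonal projection onto $L_i$. $L^*:=\{(-v^*,u^* )\mid(u^*,v^* )\in L^\perp\}$. $\mathcal{Z}_n^{\rm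 reg}$ is the set of all $L\in\mathcal{Z}_n$ such that $(y^*,0)\in L\Rightarrow y^*=0$. Each $L\in\mathcal{Z}_n^{\rm reg}$ can be written as $L=\{(C_Lp,p)\mid p\in\mathbb{R}^n\}$ with a unique $n\times n$ matrix $C_L$; moreover $L\in\mathcal{Z}_n^{\rm reg}$ iff $L^*\in\mathcal{Z}_n^{\rm reg}$. SCD notions for $F:\mathbb{R}^n\rightrightarrows\mathbb{R}^n$ (applied to $F=\partial q$). $\mathcal{O}_F$ is the set of $(x,y)\in\mathrm{gph}\,F$ with $T_{\mathrm{gph}\,F}(x,y)\in\mathcal{Z}_n$. For $(x,y)\in\mathrm{gph}\,F$, $\mathcal{S}F(x,y)$ (resp. $\mathcal{S}^*F(x,y)$) is the set of all $L\in\mathcal{Z}_n$ for which there is a sequence $(x_k,y_k)\to(x,y)$ in $\mathcal{O}_F$ with $d_{\mathcal{Z}}(L,T_{\mathrm{gph}\,F}(x_k,y_k))\to0$ (resp. $d_{\mathcal{Z}}(L,T_{\mathrm{gph}\,F}(x_k,y_k)^* )\to0$); thus $\mathcal{S}^*F(x,y)=\{L^*\mid L\in\mathcal{S}F(x,y)\}$. $F$ has the SCD property at $(x,y)$ if $\mathcal{S}^*F(x,y)\neq\emptyset$, and around $(x,y)$ if it has it at all points of $\mathrm{gph}\,F$ in some neighborhood of $(x,y)$. $F$ is SCD regular around $(x,y)$ if it has the SCD property around $(x,y)$ and $\mathcal{S}^*F(x,y)\subseteq\mathcal{Z}_n^{\rm reg}$; $\mathrm{scd\,reg}\,F(x,y):=\sup\{\|y^*\|\mid(y^*,x^*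 )\in L\text{ for some }L\in\mathcal{S}^*F(x,y),\ \|x^*\|\le1\}$. *)

theory Defs
  imports "HOL-Analysis.Analysis"
begin

definition tangent_cone :: "'a::real_normed_vector set \<Rightarrow> 'a \<Rightarrow> 'a set" where
  "tangent_cone A z =
     {w. \<exists>t W. (\<forall>k. t k > (0::real)) \<and> t \<longlonglongrightarrow> 0 \<and> W \<longlonglongrightarrow> w \<and>
               (\<forall>k::nat. z + t k *\<^sub>R W k \<in> A)}"

definition regular_normal_cone :: "'a::real_inner set \<Rightarrow> 'a \<Rightarrow> 'a set" where
  "regular_normal_cone A z = {zs. \<forall>w \<in> tangent_cone A z. zs \<bullet> w \<le> 0}"

definition limiting_normal_cone :: "'a::real_inner set \<Rightarrow> 'a \<Rightarrow> 'a set" where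
  "limiting_normal_cone A z =
     {zs. \<exists>Z Zs. Z \<longlonglongrightarrow> z \<and> (\<forall>k::nat. Z k \<in> A) \<and>
                 (\<forall>k. Zs k \<in> regular_normal_cone A (Z k)) \<and> Zs \<longlonglongrightarrow> zs}"

definition epi :: "('a \<Rightarrow> ereal) \<Rightarrow> ('a \<times> real) set" where
  "epi q = {(x, \<alpha>). q x \<le> ereal \<alpha>}"

text \<open>The limiting subdifferential is only considered where \<open>q\<close> is finite; elsewhere it
  is empty by convention.\<close>

definition subdiff :: "('a::real_inner \<Rightarrow> ereal) \<Rightarrow> 'a \<Rightarrow> 'a set" where
  "subdiff q x =
     (if \<bar>q x\<bar> = \<infinity> then {}
      else {xs. (xs, - 1) \<in> limiting_normal_cone (epi q) (x, real_of_ereal (q x))})"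

definition gph :: "('a \<Rightarrow> 'b set) \<Rightarrow> ('a \<times> 'b) set" where
  "gph F = {(x, y). y \<in> F x}"

definition lsc_at :: "('a::topological_space \<Rightarrow> ereal) \<Rightarrow> 'a \<Rightarrow> bool" where
  "lsc_at q x \<longleftrightarrow> q x \<le> Liminf (nhds x) q"

definition locally_lsc_around :: "('a::topological_space \<Rightarrow> ereal) \<Rightarrow> 'a \<Rightarrow> bool" where
  "locally_lsc_around q x \<longleftrightarrow> (\<forall>\<^sub>F y in nhds x. lsc_at q y)"

definition prox_regular :: "('a::real_inner \<Rightarrow> ereal) \<Rightarrow> 'a \<Rightarrow> 'a \<Rightarrow> bool" where
  "prox_regular q xbar xbars \<longleftrightarrow>
     xbars \<in> subdiff q xbar \<and> locally_lsc_around q xbar \<and>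
     (\<exists>\<epsilon> > 0. \<exists>\<rho> \<ge> 0. \<forall>x' \<in> cball xbar \<epsilon>. \<forall>x \<in> cball xbar \<epsilon>.
        \<bar>q x - q xbar\<bar> \<le> ereal \<epsilon> \<longrightarrow>
        (\<forall>xs \<in> subdiff q x \<inter> cball xbars \<epsilon>.
           q x' \<ge> q x + ereal (xs \<bullet> (x' - x) - \<rho> / 2 * (norm (x' - x))\<^sup>2)))"

definition subdiff_continuous :: "('a::real_inner \<Rightarrow> ereal) \<Rightarrow> 'a \<Rightarrow> 'a \<Rightarrow> bool" where
  "subdiff_continuous q xbar xbars \<longleftrightarrow>
     xbars \<in> subdiff q xbar \<and>
     (\<forall>X Xs. (\<forall>k::nat. (X k, Xs k) \<in> gph (subdiff q)) \<and> X \<longlonglongrightarrow> xbar \<and> Xs \<longlonglongrightarrow> xbars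
        \<longrightarrow> (\<lambda>k. q (X k)) \<longlonglongrightarrow> q xbar)"

definition tilt_argmin :: "('a::real_inner \<Rightarrow> ereal) \<Rightarrow> 'a \<Rightarrow> real \<Rightarrow> 'a \<Rightarrow> 'a set" where
  "tilt_argmin q xbar \<gamma> xs =
     {x. is_arg_min (\<lambda>x. q x - ereal (xs \<bullet> x)) (\<lambda>x. x \<in> cball xbar \<gamma>) x}"

text \<open>\<open>tilt_radius q xbar \<gamma>\<close>: the radius \<open>\<gamma>\<close> is a witness for tilt stability at \<open>xbar\<close>.
  The function \<open>the_elem \<circ> tilt_argmin q xbar \<gamma>\<close> is only meaningful where \<open>tilt_argmin\<close> is
  single-valued.\<close>

definition tilt_radius :: "('a::real_inner \<Rightarrow> ereal) \<Rightarrow> 'a \<Rightarrow> real \<Rightarrow> bool" where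
  "tilt_radius q xbar \<gamma> \<longleftrightarrow>
     \<gamma> > 0 \<and> tilt_argmin q xbar \<gamma> 0 = {xbar} \<and>
     (\<exists>\<delta> > 0. (\<forall>xs \<in> ball 0 \<delta>. is_singleton (tilt_argmin q xbar \<gamma> xs)) \<and>
              (\<exists>K. K-lipschitz_on (ball 0 \<delta>) (\<lambda>xs. the_elem (tilt_argmin q xbar \<gamma> xs))))"

definition tilt_stable_local_min :: "('a::real_inner \<Rightarrow> ereal) \<Rightarrow> 'a \<Rightarrow> bool" where
  "tilt_stable_local_min q xbar \<longleftrightarrow> q xbar < \<infinity> \<and> (\<exists>\<gamma>. tilt_radius q xbar \<gamma>)"

text \<open>The modulus is defined through a radius \<open>\<gamma>\<close> with \<open>tilt_radius q xbar \<gamma>\<close>, which is kept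
  as a parameter.\<close>

definition tilt_modulus :: "('a::real_inner \<Rightarrow> ereal) \<Rightarrow> 'a \<Rightarrow> real \<Rightarrow> ereal" where
  "tilt_modulus q xbar \<gamma> =
     Limsup (at (0, 0) within {(vs, ws). vs \<noteq> ws})
       (\<lambda>(vs, ws). ereal (norm (the_elem (tilt_argmin q xbar \<gamma> vs)
                                - the_elem (tilt_argmin q xbar \<gamma> ws)) / norm (vs - ws)))"

definition orth_proj :: "'a::euclidean_space set \<Rightarrow> 'a \<Rightarrow> 'a" where
  "orth_proj L z = (THE p. p \<in> L \<and> z - p \<in> L\<^sup>\<bottom>)"

definition subspace_dist :: "'a::euclidean_space set \<Rightarrow> 'a set \<Rightarrow> real" where
  "subspace_dist L1 L2 = onorm (\<lambda>z. orth_proj L1 z - orth_proj L2 z)"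

definition Zn :: "((real^'n) \<times> (real^'n)) set set" where
  "Zn = {L. subspace L \<and> dim L = CARD('n)}"

definition adj_subspace :: "((real^'n) \<times> (real^'n)) set \<Rightarrow> ((real^'n) \<times> (real^'n)) set" where
  "adj_subspace L = {(- vs, us) | us vs. (us, vs) \<in> L\<^sup>\<bottom>}"

definition Zn_reg :: "((real^'n) \<times> (real^'n)) set set" where
  "Zn_reg = {L \<in> Zn. \<forall>ys. (ys, 0) \<in> L \<longrightarrow> ys = 0}"

text \<open>Meaningful for \<open>L \<in> Zn_reg\<close> only, where the matrix exists and is unique.\<close>

definition C_mat :: "((real^'n) \<times> (real^'n)) set \<Rightarrow> real^'n^'n" where
  "C_mat L = (THE C. L = range (\<lambda>p. (C *v p, p)))"

definition O_set :: "(real^'n \<Rightarrow> (real^'n) set) \<Rightarrow> ((real^'n) \<times> (real^'n)) set" where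
  "O_set F = {z \<in> gph F. tangent_cone (gph F) z \<in> Zn}"

definition SCD :: "(real^'n \<Rightarrow> (real^'n) set) \<Rightarrow> (real^'n) \<times> (real^'n)
    \<Rightarrow> ((real^'n) \<times> (real^'n)) set set" where
  "SCD F z = {L \<in> Zn. \<exists>Z. (\<forall>k::nat. Z k \<in> O_set F) \<and> Z \<longlonglongrightarrow> z \<and>
     (\<lambda>k. subspace_dist L (tangent_cone (gph F) (Z k))) \<longlonglongrightarrow> 0}"

definition SCD_adj :: "(real^'n \<Rightarrow> (real^'n) set) \<Rightarrow> (real^'n) \<times> (real^'n)
    \<Rightarrow> ((real^'n) \<times> (real^'n)) set set" where
  "SCD_adj F z = {L \<in> Zn. \<exists>Z. (\<forall>k::nat. Z k \<in> O_set F) \<and> Z \<longlonglongrightarrow> z \<and>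
     (\<lambda>k. subspace_dist L (adj_subspace (tangent_cone (gph F) (Z k)))) \<longlonglongrightarrow> 0}"

definition SCD_property_around :: "(real^'n \<Rightarrow> (real^'n) set) \<Rightarrow> (real^'n) \<times> (real^'n) \<Rightarrow> bool" where
  "SCD_property_around F z \<longleftrightarrow> (\<forall>\<^sub>F z' in nhds z. z' \<in> gph F \<longrightarrow> SCD_adj F z' \<noteq> {})"

definition SCD_regular_around :: "(real^'n \<Rightarrow> (real^'n) set) \<Rightarrow> (real^'n) \<times> (real^'n) \<Rightarrow> bool" where
  "SCD_regular_around F z \<longleftrightarrow> SCD_property_around F z \<and> SCD_adj F z \<subseteq> Zn_reg"

definition scd_reg :: "(real^'n \<Rightarrow> (real^'n) set) \<Rightarrow> (real^'n) \<times> (real^'n) \<Rightarrow> ereal" where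
  "scd_reg F z =
     Sup {ereal (norm ys) | ys xs L. L \<in> SCD_adj F z \<and> (ys, xs) \<in> L \<and> norm xs \<le> 1}"

end

theory Submission
  imports Defs
begin

text \<open>
  Fix \<open>r > \<rho>\<close>. Prox-regularity makes \<open>P(u) = argmin (q + r/2 |\<cdot>|\<^sup>2 - \<langle>u,\<cdot>\<rangle>)\<close> single-valued and
  Lipschitz near \<open>r xbar\<close>, and near \<open>(xbar, 0)\<close> the graph of the subdifferential is the set of all
  \<open>(P(u), u - r P(u))\<close>. By Rademacher's theorem \<open>P\<close> is differentiable almost everywhere; at such
  points the tangent cone of the graph is the subspace of all \<open>(DP(u)h, h - r DP(u)h)\<close>, and limits
  of \<open>DP(u)\<close> yield elements of the SCD derivative.

  Regularity together with positive semidefiniteness says, after a compactness argument, that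
  \<open>\<langle>h - r DP(u)h, h\<rangle> \<ge> c |h|\<^sup>2\<close> for \<open>u\<close> near \<open>r xbar\<close>. A mean value inequality for almost everywhere
  derivatives turns this into strong monotonicity of \<open>Q(u) = u - r P(u)\<close>, so that \<open>Q\<close> has a
  Lipschitz inverse and \<open>M = P \<circ> Q\<^sup>-\<^sup>1\<close> inverts the subdifferential. If \<open>e(u)\<close> is minus the minimal
  value in the definition of \<open>P(u)\<close>, then \<open>P\<close> selects subgradients of \<open>e\<close>, hence
  \<open>\<phi>(u) = |u|\<^sup>2/2 - r e(u)\<close> satisfies the gradient inequality with gradient \<open>Q\<close>. Evaluated at
  \<open>u = r x + v\<close> it says that \<open>M(v)\<close> minimizes \<open>q - \<langle>v,\<cdot>\<rangle>\<close> locally.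

  Conversely, if \<open>xbar\<close> is tilt-stable with argmin map \<open>M\<close>, then Brouwer's theorem solves
  \<open>v + r M(v) = x\<^sup>* + r x\<close>, and prox-regularity forces \<open>x = M(x\<^sup>*)\<close>; thus the graph is locally the set of
  all \<open>(M(v), v)\<close>. Monotonicity and the Lipschitz bound of \<open>M\<close> pass to tangent cones and their
  limits. By the mean value inequality the Lipschitz modulus of \<open>M\<close> at \<open>0\<close> is the largest norm
  of a limit of derivatives of \<open>M\<close>, and transposition does not change norms.
\<close>

text \<open>The SCD derivative sees only graph points whose tangent cone is a subspace, so it says
  nothing directly about increments between arbitrary points. This is why every local statement
  about the graph passes through a Lipschitz parametrisation: its derivatives exist off a null set,
  they cluster to SCD elements, and derivative bounds near the base point can be integrated. In (ii)
  => (i) the inverse of the subdifferential is not known to be single-valued, so it cannot be the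
  parametrisation; the proximal map is Lipschitz for free, at the price of sheared tangent spaces.
  Under tilt stability the argmin map is Lipschitz by definition. One locale covers both situations,
  with \<open>r = \<rho> + 1\<close> and with \<open>r = 0\<close>; in the second case tangent
  spaces at differentiability points are plain graphs of the derivative and the adjoint is
  transposition. Rademacher's theorem is reached through monotone functions of one variable, Fubini
  along lines, and a weak form of additivity of directional derivatives tested against indicators of
  compact sets.\<close>

section \<open>Lipschitz functions of one real variable\<close>

text \<open>Vitali covering: every point of \<open>E\<close> is an endpoint of arbitrarily short
  intervals whose image is shorter than \<open>p\<close> times the interval. Disjoint ones cover
  \<open>E\<close> up to a null set, whose image is null by the Lipschitz bound, and a neighbourhood
  \<open>U\<close> of almost the same measure controls their total length.\<close>

lemma emeasure_image_le_of_small_slopes: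
  fixes f :: "real \<Rightarrow> real"
  assumes lip: "L-lipschitz_on UNIV f" and mono: "strict_mono f" and p: "p > 0"
    and E: "E \<in> sets borel" "f ` E \<in> sets borel"
    and slope: "\<And>x d. x \<in> E \<Longrightarrow> d > 0 \<Longrightarrow> \<exists>h. h \<noteq> 0 \<and> \<bar>h\<bar> < d \<and> (f (x + h) - f x) / h < p"
  shows "emeasure lborel (f ` E) \<le> ennreal p * emeasure lborel E"
proof -
  note le_iff = strict_mono_less_eq[OF mono]
  have contf: "continuous_on S f" for S
    using lipschitz_on_continuous_on[OF lip] continuous_on_subset by blast
  have step: "emeasure lborel (f ` E) \<le> ennreal p * (emeasure lborel E + ennreal e)" if e: "e > 0" for e :: real
  proof -
    have "E \<in> sets lebesgue" using E by auto
    then obtain U where U: "open U" "E \<subseteq> U" "emeasure lebesgue (U - E) < ennreal e"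
      by (rule sets_lebesgue_outer_open[OF _ e])
    \<comment> \<open>Balls instead of intervals \<open>[x, x + h]\<close>: since \<open>h\<close>
      may have either sign, the interval is recorded by its centre \<open>x + h/2\<close> and radius
      \<open>\<bar>h\<bar>/2\<close>.\<close>
    define K where "K = {(a, r). 0 < r \<and> cball a r \<subseteq> U \<and> f (a + r) - f (a - r) < p * (2 * r)}"
    have cov: "\<exists>i. i \<in> K \<and> x \<in> cball (fst i) (snd i) \<and> snd i < d" if xE: "x \<in> E" and d0: "0 < d" for x d
    proof -
      have "x \<in> U" using U(2) xE by blast
      then have "\<exists>d'>0. cball x d' \<subseteq> U" using U(1) open_contains_cball by blast
      then obtain d' where d': "d' > 0" "cball x d' \<subseteq> U" by blast
      have "min d d' > 0" using d0 d'(1) by simp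
      then obtain h where h: "h \<noteq> 0" "\<bar>h\<bar> < min d d'" "(f (x + h) - f x) / h < p"
        using slope[OF xE] by blast
      have "cball (x + h/2) (\<bar>h\<bar>/2) \<subseteq> cball x d'"
      proof
        fix y assume "y \<in> cball (x + h/2) (\<bar>h\<bar>/2)"
        then show "y \<in> cball x d'" using h(2) by (auto simp: dist_real_def abs_if split: if_splits)
      qed
      moreover have "f (x + h/2 + \<bar>h\<bar>/2) - f (x + h/2 - \<bar>h\<bar>/2) < p * \<bar>h\<bar>"
      proof (cases "h > 0")
        case True
        then show ?thesis using h(3) by (simp add: pos_divide_less_eq add.commute)
      next
        case False
        then have "h < 0" using h by auto
        then show ?thesis using h(3) by (simp add: neg_divide_less_eq add.commute)
      qed
      ultimately have "(x + h/2, \<bar>h\<bar>/2) \<in> K"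
        using h d' by (auto simp: K_def)
      moreover have "x \<in> cball (x + h/2) (\<bar>h\<bar>/2)" by (auto simp: dist_real_def)
      ultimately show ?thesis using h by (intro exI[of _ "(x + h/2, \<bar>h\<bar>/2)"]) auto
    qed
    have Kpos: "0 < snd i" if "i \<in> K" for i using that by (auto simp: K_def)
    obtain C where C: "countable C" "C \<subseteq> K"
      "pairwise (\<lambda>i j. disjnt (cball (fst i) (snd i)) (cball (fst j) (snd j))) C"
      "negligible (E - (\<Union>i\<in>C. cball (fst i) (snd i)))"
      by (rule Vitali_covering_theorem_cballs[where a=fst and r=snd and K=K and S=E, OF Kpos cov])
    define N where "N = E - (\<Union>i\<in>C. cball (fst i) (snd i))"
    define I where "I i = cball (fst i) (snd i)" for i :: "real \<times> real"
    have Ieq: "I i = {fst i - snd i .. fst i + snd i}" for i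
      by (simp add: I_def cball_eq_atLeastAtMost)
    have IS: "I i \<in> sets borel" for i by (simp add: Ieq)
    have IU: "I i \<subseteq> U" if "i \<in> C" for i
      using subsetD[OF C(2) that] by (cases i) (auto simp: K_def I_def)
    have disj: "disjoint_family_on I C"
      using C(3) by (auto simp: disjoint_family_on_def pairwise_def disjnt_def I_def)
    have fI: "f ` I i = {f (fst i - snd i) .. f (fst i + snd i)}" if "i \<in> C" for i
    proof -
      have le: "fst i - snd i \<le> fst i + snd i" using Kpos[of i] C(2) that by auto
      have "{f (fst i - snd i) .. f (fst i + snd i)} \<subseteq> f ` {fst i - snd i .. fst i + snd i}"
      proof
        fix y assume y: "y \<in> {f (fst i - snd i) .. f (fst i + snd i)}"
        show "y \<in> f ` {fst i - snd i .. fst i + snd i}"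
          using IVT'[of f "fst i - snd i" y "fst i + snd i"] y le contf by (auto simp: image_iff)
      qed
      then show ?thesis by (auto simp: Ieq le_iff)
    qed
    have disjf: "disjoint_family_on (\<lambda>i. f ` I i) C"
      using disj strict_mono_imp_inj_on[OF mono] unfolding disjoint_family_on_def
      by (metis image_Int image_empty)
    have "negligible (f ` N)"
    proof (rule negligible_locally_Lipschitz_image)
      show "\<exists>T B. open T \<and> x \<in> T \<and> (\<forall>y\<in>N \<inter> T. norm (f y - f x) \<le> B * norm (y - x))" for x
        using lip by (intro exI[of _ UNIV] exI[of _ L]) (auto simp: lipschitz_on_def dist_norm)
    qed (use C N_def in auto)
    then have N0: "emeasure lebesgue (f ` N) = 0" "f ` N \<in> sets lebesgue"
      by (auto simp: negligible_iff_null_sets null_sets_def)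
    have bor: "f ` I i \<in> sets borel" if "i \<in> C" for i using fI[OF that] by simp
    have Ub: "(\<Union>i\<in>C. f ` I i) \<in> sets borel" using C(1) bor by auto
    have "emeasure lborel (f ` E) \<le> emeasure lebesgue (f ` N \<union> (\<Union>i\<in>C. f ` I i))"
    proof -
      have "emeasure lborel (f ` E) = emeasure lebesgue (f ` E)"
        using E by (simp add: emeasure_completion main_part_sets)
      also have "\<dots> \<le> emeasure lebesgue (f ` N \<union> (\<Union>i\<in>C. f ` I i))"
        using N0 Ub by (intro emeasure_mono) (auto simp: N_def I_def)
      finally show ?thesis .
    qed
    also have "\<dots> \<le> emeasure lebesgue (f ` N) + emeasure lebesgue (\<Union>i\<in>C. f ` I i)"
      using N0 Ub by (intro emeasure_subadditive) auto
    also have "\<dots> = emeasure lborel (\<Union>i\<in>C. f ` I i)"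
      using N0 Ub by (simp add: emeasure_completion main_part_sets)
    also have "\<dots> = (\<integral>\<^sup>+i. emeasure lborel (f ` I i) \<partial>count_space C)"
      using bor C(1) disjf by (intro emeasure_UN_countable) auto
    also have "\<dots> \<le> (\<integral>\<^sup>+i. ennreal p * emeasure lborel (I i) \<partial>count_space C)"
    proof (intro nn_integral_mono)
      fix i assume "i \<in> space (count_space C)"
      then have i: "i \<in> C" by simp
      then have k: "0 < snd i" "f (fst i + snd i) - f (fst i - snd i) < p * (2 * snd i)"
        using C by (auto simp: K_def)
      have "f (fst i - snd i) \<le> f (fst i + snd i)" using k by (simp add: le_iff)
      then show "emeasure lborel (f ` I i) \<le> ennreal p * emeasure lborel (I i)"
        unfolding fI[OF i] unfolding Ieq using k p by (simp add: ennreal_mult[symmetric] ennreal_leI)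
    qed
    also have "\<dots> = ennreal p * (\<integral>\<^sup>+i. emeasure lborel (I i) \<partial>count_space C)"
      by (intro nn_integral_cmult) auto
    also have "(\<integral>\<^sup>+i. emeasure lborel (I i) \<partial>count_space C) = emeasure lborel (\<Union>i\<in>C. I i)"
      using C(1) disj IS by (intro emeasure_UN_countable[symmetric]) auto
    also have "emeasure lborel (\<Union>i\<in>C. I i) \<le> emeasure lborel U"
      using IU U(1) by (intro emeasure_mono) auto
    also have "emeasure lborel U \<le> emeasure lborel E + ennreal e"
    proof -
      have "emeasure lborel U \<le> emeasure lborel (E \<union> (U - E))"
        using E U by (intro emeasure_mono) auto
      also have "\<dots> \<le> emeasure lborel E + emeasure lborel (U - E)"
        using E U by (intro emeasure_subadditive) auto
      also have "emeasure lborel (U - E) = emeasure lebesgue (U - E)"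
        using E U by (simp add: emeasure_completion main_part_sets)
      finally show ?thesis using U(3) by (metis add_left_mono order.trans order.strict_implies_order)
    qed
    finally show ?thesis by (simp add: mult_left_mono)
  qed
  show ?thesis
  proof (rule ennreal_le_epsilon)
    fix e :: real assume e: "e > 0"
    have "emeasure lborel (f ` E) \<le> ennreal p * (emeasure lborel E + ennreal (e / p))"
      using step[of "e / p"] e p by simp
    also have "\<dots> = ennreal p * emeasure lborel E + ennreal e"
      using p e by (simp add: distrib_left ennreal_mult[symmetric])
    finally show "emeasure lborel (f ` E) \<le> ennreal p * emeasure lborel E + ennreal e" .
  qed
qed

text \<open>A lower limit strictly below the upper limit would leave room for two rationals between
  them, and either alternative of \<open>gap\<close> is then violated. The bounds keep both limits
  finite.\<close>

lemma Liminf_ereal_eq_Limsup_imp_convergent: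
  fixes g :: "'a \<Rightarrow> real"
  assumes nt: "F \<noteq> bot" and bd: "\<forall>\<^sub>F h in F. a \<le> g h \<and> g h \<le> b"
    and gap: "\<And>p r :: rat. p < r \<Longrightarrow> (\<forall>\<^sub>F h in F. real_of_rat p \<le> g h) \<or> (\<forall>\<^sub>F h in F. g h \<le> real_of_rat r)"
  shows "\<exists>l. (g \<longlongrightarrow> l) F"
proof -
  let ?g = "\<lambda>h. ereal (g h)"
  have 1: "ereal a \<le> Liminf F ?g"
    by (rule Liminf_bounded) (use bd in \<open>auto elim: eventually_mono\<close>)
  have 2: "Limsup F ?g \<le> ereal b"
    by (rule Limsup_bounded) (use bd in \<open>auto elim: eventually_mono\<close>)
  have 3: "Liminf F ?g \<le> Limsup F ?g" by (rule Liminf_le_Limsup[OF nt])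
  obtain l where l: "Liminf F ?g = ereal l" using 1 2 3 by (cases "Liminf F ?g") auto
  obtain u where u: "Limsup F ?g = ereal u" using 1 2 3 by (cases "Limsup F ?g") auto
  have "\<not> l < u"
  proof
    assume "l < u"
    then obtain p where p: "l < real_of_rat p" "real_of_rat p < u" using of_rat_dense by blast
    then obtain r where r: "real_of_rat p < real_of_rat r" "real_of_rat r < u" using of_rat_dense by blast
    have "p < r" using r(1) by (simp add: of_rat_less)
    from gap[OF this] show False
    proof
      assume "\<forall>\<^sub>F h in F. real_of_rat p \<le> g h"
      then have "ereal (real_of_rat p) \<le> Liminf F ?g" by (intro Liminf_bounded) (auto elim: eventually_mono)
      then show False using p l by simp
    next
      assume "\<forall>\<^sub>F h in F. g h \<le> real_of_rat r"
      then have "Limsup F ?g \<le> ereal (real_of_rat r)" by (intro Limsup_bounded) (auto elim: eventually_mono)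
      then show False using r u by simp
    qed
  qed
  then have "l = u" using 3 l u by simp
  then have "(?g \<longlongrightarrow> ereal l) F" using l u tendsto_iff_Liminf_eq_Limsup[OF nt] by metis
  then show ?thesis by auto
qed

text \<open>The radii \<open>1 / Suc n\<close> make this a countable intersection; the inner union
  over uncountably many \<open>h\<close> is harmless because it is a union of open sets when
  \<open>Q h\<close> is continuous and \<open>S\<close> open.\<close>

definition frequent_set :: "(real \<Rightarrow> 'a \<Rightarrow> real) \<Rightarrow> real set \<Rightarrow> 'a set" where
  "frequent_set Q S = (\<Inter>n::nat. \<Union>h\<in>{h. h \<noteq> 0 \<and> \<bar>h\<bar> < 1 / Suc n}. {x. Q h x \<in> S})"

lemma frequent_set_borel:
  fixes Q :: "real \<Rightarrow> 'a::topological_space \<Rightarrow> real"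
  assumes cont: "\<And>h. continuous_on UNIV (Q h)" and S: "open S"
  shows "frequent_set Q S \<in> sets borel"
proof -
  have "open {x. Q h x \<in> S}" for h
    using continuous_on_open_vimage[OF open_UNIV, THEN iffD1, OF cont[of h]] S by (simp add: vimage_def)
  then show ?thesis
    unfolding frequent_set_def by (intro sets.countable_INT'' borel_open open_UN ballI; simp)
qed

lemma frequent_setD:
  assumes x: "x \<in> frequent_set Q S" and d: "d > 0"
  shows "\<exists>h. h \<noteq> 0 \<and> \<bar>h\<bar> < d \<and> Q h x \<in> S"
proof -
  obtain n where n: "1 / real (Suc n) < d" using d reals_Archimedean by (metis inverse_eq_divide)
  from x have "x \<in> (\<Union>h\<in>{h. h \<noteq> 0 \<and> \<bar>h\<bar> < 1 / Suc n}. {x. Q h x \<in> S})" unfolding frequent_set_def by blast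
  then show ?thesis using n by (auto intro: less_trans)
qed

lemma mem_frequent_set_iff: "x \<in> frequent_set Q S \<longleftrightarrow> (\<exists>\<^sub>F h in at 0. Q h x \<in> S)"
proof
  assume "x \<in> frequent_set Q S"
  from frequent_setD[OF this] show "\<exists>\<^sub>F h in at 0. Q h x \<in> S" by (auto simp: frequently_at dist_real_def)
next
  assume freq: "\<exists>\<^sub>F h in at 0. Q h x \<in> S"
  have "\<exists>h. h \<noteq> 0 \<and> \<bar>h\<bar> < 1 / Suc n \<and> Q h x \<in> S" for n
  proof -
    have "1 / real (Suc n) > 0" by simp
    with freq show ?thesis unfolding frequently_at dist_real_def by (metis UNIV_I diff_zero)
  qed
  then show "x \<in> frequent_set Q S" unfolding frequent_set_def by blast
qed

text \<open>Divergence of bounded quotients is witnessed by a pair of rationals. There are countably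
  many pairs, which gives measurability and lets the null set be estimated one pair at a
  time.\<close>

lemma convergent_at_0_iff:
  assumes bd: "\<And>h. h \<noteq> 0 \<Longrightarrow> a \<le> Q h x \<and> Q h x \<le> b"
  shows "(\<exists>l. ((\<lambda>h. Q h x) \<longlongrightarrow> l) (at 0)) \<longleftrightarrow> (\<forall>p r :: rat. p < r \<longrightarrow>
    x \<notin> frequent_set Q {..<real_of_rat p} \<inter> frequent_set Q {real_of_rat r<..})"
proof
  assume "\<exists>l. ((\<lambda>h. Q h x) \<longlongrightarrow> l) (at 0)"
  then obtain l where l: "((\<lambda>h. Q h x) \<longlongrightarrow> l) (at 0)" ..
  have "x \<notin> frequent_set Q {..<real_of_rat p} \<or> x \<notin> frequent_set Q {real_of_rat r<..}" if "p < r" for p r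
  proof -
    have "real_of_rat p < real_of_rat r" using that by (simp add: of_rat_less)
    then have "real_of_rat p < l \<or> l < real_of_rat r" by linarith
    then show ?thesis
    proof
      assume "real_of_rat p < l"
      from order_tendstoD(1)[OF l this] show ?thesis
        by (auto simp: mem_frequent_set_iff not_frequently elim!: eventually_mono)
    next
      assume "l < real_of_rat r"
      from order_tendstoD(2)[OF l this] have "\<forall>\<^sub>F h in at 0. Q h x \<notin> {real_of_rat r<..}"
        by (rule eventually_mono) simp
      then show ?thesis by (simp add: mem_frequent_set_iff not_frequently)
    qed
  qed
  then show "\<forall>p r :: rat. p < r \<longrightarrow>
    x \<notin> frequent_set Q {..<real_of_rat p} \<inter> frequent_set Q {real_of_rat r<..}" by blast
next
  assume R: "\<forall>p r :: rat. p < r \<longrightarrow>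
    x \<notin> frequent_set Q {..<real_of_rat p} \<inter> frequent_set Q {real_of_rat r<..}"
  show "\<exists>l. ((\<lambda>h. Q h x) \<longlongrightarrow> l) (at 0)"
  proof (rule Liminf_ereal_eq_Limsup_imp_convergent)
    show "\<forall>\<^sub>F h in at 0. a \<le> Q h x \<and> Q h x \<le> b"
      using bd by (auto simp: eventually_at intro!: exI[of _ 1])
    show "(\<forall>\<^sub>F h in at 0. real_of_rat p \<le> Q h x) \<or> (\<forall>\<^sub>F h in at 0. Q h x \<le> real_of_rat r)" if "p < r" for p r
      using R[rule_format, OF that] by (auto simp: mem_frequent_set_iff not_frequently not_less)
  qed simp
qed

lemma borel_convergent_at_0:
  fixes Q :: "real \<Rightarrow> 'a::topological_space \<Rightarrow> real"
  assumes cont: "\<And>h. continuous_on UNIV (Q h)" and bd: "\<And>h x. h \<noteq> 0 \<Longrightarrow> a \<le> Q h x \<and> Q h x \<le> b"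
  shows "{x. \<exists>l. ((\<lambda>h. Q h x) \<longlongrightarrow> l) (at 0)} \<in> sets borel"
proof -
  let ?A = "\<lambda>p r. frequent_set Q {..<real_of_rat p} \<inter> frequent_set Q {real_of_rat r<..}"
  have "{x. \<exists>l. ((\<lambda>h. Q h x) \<longlongrightarrow> l) (at 0)} = (\<Inter>p. \<Inter>r. {x. p < r \<longrightarrow> x \<notin> ?A p r})"
    using convergent_at_0_iff[where Q = Q and a = a and b = b] bd by auto
  also have "\<dots> \<in> sets borel"
  proof (intro sets.countable_INT'')
    fix p r
    have "{x. p < r \<longrightarrow> x \<notin> ?A p r} = (if p < r then - ?A p r else UNIV)" by auto
    then show "{x. p < r \<longrightarrow> x \<notin> ?A p r} \<in> sets borel" using frequent_set_borel[OF cont] by simp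
  qed auto
  finally show ?thesis .
qed

text \<open>The lower slope bound makes \<open>f\<close> a bijection of the line with a 1-Lipschitz
  inverse. Large slopes of \<open>f\<close> are small slopes of the inverse, so the one covering
  estimate controls both kinds of oscillation.\<close>

lemma AE_differentiable_of_slopes:
  fixes f :: "real \<Rightarrow> real"
  assumes lip: "L-lipschitz_on UNIV f" and slope: "\<And>x y. x < y \<Longrightarrow> y - x \<le> f y - f x"
  shows "AE x in lborel. f differentiable (at x)"
proof -
  define Q where "Q h x = (f (x + h) - f x) / h" for h x
  have mono: "strict_mono f"
    by (rule strict_monoI) (use slope in force)
  have contf: "continuous_on S f" for S
    using lipschitz_on_continuous_on[OF lip] continuous_on_subset by blast
  have Qlow: "1 \<le> Q h x" if "h \<noteq> 0" for x h
    using slope[of x "x + h"] slope[of "x + h" x] that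
    by (cases "h > 0") (auto simp: Q_def pos_le_divide_eq neg_le_divide_eq)
  have Qup: "Q h x \<le> L" if "h \<noteq> 0" for x h
    using lipschitz_onD[OF lip, of "x + h" x] that unfolding Q_def dist_real_def
    by (cases "h > 0") (auto simp: pos_divide_le_eq neg_divide_le_eq abs_if split: if_splits)
  have surj: "surj f"
    unfolding surj_def
  proof
    fix y
    have "f (- \<bar>y - f 0\<bar> - 1) \<le> y" "y \<le> f (\<bar>y - f 0\<bar> + 1)"
      using slope[of "- \<bar>y - f 0\<bar> - 1" 0] slope[of 0 "\<bar>y - f 0\<bar> + 1"] by linarith+
    then show "\<exists>x. y = f x"
      using IVT'[of f "- \<bar>y - f 0\<bar> - 1" y "\<bar>y - f 0\<bar> + 1", OF _ _ _ contf] by force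
  qed
  define g where "g = inv f"
  have gf: "g (f x) = x" and fg: "f (g y) = y" for x y
    using strict_mono_imp_inj_on[OF mono] surj by (auto simp: g_def surj_f_inv_f)
  have gmono: "strict_mono g"
    by (rule strict_monoI) (metis fg mono strict_mono_less)
  have glip: "1-lipschitz_on UNIV g"
  proof (rule lipschitz_onI)
    fix x y :: real
    show "dist (g x) (g y) \<le> 1 * dist x y"
      using slope[of "g x" "g y"] slope[of "g y" "g x"] fg
      by (cases "g x" "g y" rule: linorder_cases) (auto simp: dist_real_def)
  qed simp
  have contg: "continuous_on S g" for S
    using lipschitz_on_continuous_on[OF glip] continuous_on_subset by blast
  have [measurable]: "f \<in> borel_measurable borel" "g \<in> borel_measurable borel"
    using contf contg by (auto intro: borel_measurable_continuous_onI)
  have fimg: "f ` E \<in> sets borel" if "E \<in> sets borel" for E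
  proof -
    have "f ` E = g -` E \<inter> space borel" using gf fg by (auto simp: image_iff) metis
    then show ?thesis using measurable_sets[of g borel borel E] that by simp
  qed
  have contQ: "continuous_on UNIV (Q h)" for h
    unfolding Q_def
    by (cases "h = 0") (auto intro!: continuous_intros continuous_on_compose2[OF contf[of UNIV]])
  text \<open>Comparing \<open>f\<close> and its inverse \<open>g\<close> on the set \<open>E\<close> gives \<open>r |E| \<le> |f E| \<le> p |E|\<close> with \<open>p < r\<close>.\<close>
  have null: "emeasure lborel (frequent_set Q {..<p} \<inter> frequent_set Q {r<..} \<inter> {-m..m}) = 0" if pr: "p < r" for p r m
  proof -
    define E where "E = frequent_set Q {..<p} \<inter> frequent_set Q {r<..} \<inter> {-m..m}"
    have E: "E \<in> sets borel" using frequent_set_borel[OF contQ] by (auto simp: E_def)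
    have gE: "g ` (f ` E) = E" by (auto simp: image_iff gf)
    show ?thesis
    proof (cases "p \<le> 1")
      case True
      have "E = {}"
        using frequent_setD[of _ Q "{..<p}" 1] Qlow True by (auto simp: E_def) (meson less_le_not_le order_trans zero_less_one)
      then show ?thesis by (simp add: E_def)
    next
      case False
      then have p1: "p > 0" "r > 0" using pr by auto
      have 1: "emeasure lborel (f ` E) \<le> ennreal p * emeasure lborel E"
        by (rule emeasure_image_le_of_small_slopes[OF lip mono p1(1) E fimg[OF E]])
           (use frequent_setD[of _ Q "{..<p}"] in \<open>auto simp: E_def Q_def\<close>)
      have 2: "emeasure lborel (g ` f ` E) \<le> ennreal (1 / r) * emeasure lborel (f ` E)"
      proof (rule emeasure_image_le_of_small_slopes[OF glip gmono _ fimg[OF E]])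
        show "g ` f ` E \<in> sets borel" "0 < 1 / r" using E gE p1 by auto
        fix y d :: real assume y: "y \<in> f ` E" and d: "d > 0"
        then obtain x where x: "x \<in> E" "y = f x" by auto
        have Lp: "L > 0" using Qlow[of 1 0] Qup[of 1 0] by simp
        have "x \<in> frequent_set Q {r<..}" using x by (simp add: E_def)
        \<comment> \<open>With \<open>\<bar>h\<bar> < d / L\<close> the corresponding step
          \<open>k\<close> in the image is shorter than \<open>d\<close>.\<close>
        then obtain h where h: "h \<noteq> 0" "\<bar>h\<bar> < d / L" "Q h x > r"
          using frequent_setD[of x Q "{r<..}" "d / L"] d Lp by auto
        define k where "k = f (x + h) - f x"
        have "k \<noteq> 0" using h(1) mono by (auto simp: k_def strict_mono_eq)
        moreover have "\<bar>k\<bar> < d"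
        proof -
          have "\<bar>k\<bar> \<le> L * \<bar>h\<bar>" using lipschitz_onD[OF lip, of "x + h" x] by (simp add: k_def dist_real_def)
          also have "\<dots> < d" using h(2) Lp by (simp add: field_simps)
          finally show ?thesis .
        qed
        moreover have "(g (y + k) - g y) / k < 1 / r"
        proof -
          have "(g (y + k) - g y) / k = 1 / Q h x" by (simp add: x k_def gf Q_def)
          also have "\<dots> < 1 / r" using h(3) p1 by (simp add: frac_less2)
          finally show ?thesis .
        qed
        ultimately show "\<exists>h. h \<noteq> 0 \<and> \<bar>h\<bar> < d \<and> (g (y + h) - g y) / h < 1 / r" by blast
      qed
      have "emeasure lborel E \<le> emeasure lborel {-m..m}"
        by (intro emeasure_mono) (auto simp: E_def)
      then have fin: "emeasure lborel E < \<infinity>"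
        by (rule le_less_trans) (simp add: emeasure_lborel_Icc_eq)
      then obtain a where a: "emeasure lborel E = ennreal a" "a \<ge> 0" by (cases "emeasure lborel E") auto
      have "ennreal a \<le> ennreal (1 / r) * (ennreal p * ennreal a)"
        using 2 mult_left_mono[OF 1, of "ennreal (1/r)"] unfolding gE a(1) by simp
      then have "a \<le> 1 / r * (p * a)"
        using p1 a(2) by (simp add: ennreal_mult[symmetric])
      then have "(r - p) * a \<le> 0" using p1 by (simp add: field_simps)
      then have "a = 0" using pr a(2) by (simp add: mult_le_0_iff)
      then show ?thesis using a by (simp add: E_def)
    qed
  qed
  have ae: "AE x in lborel. \<forall>p r :: rat. \<forall>m::nat. p < r \<longrightarrow>
      x \<notin> frequent_set Q {..<real_of_rat p} \<inter> frequent_set Q {real_of_rat r<..} \<inter> {-real m..real m}"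
    unfolding AE_all_countable
  proof (intro allI)
    fix p r :: rat and m :: nat
    show "AE x in lborel. p < r \<longrightarrow> x \<notin> frequent_set Q {..<real_of_rat p} \<inter> frequent_set Q {real_of_rat r<..} \<inter> {-real m..real m}"
    proof (cases "p < r")
      case True
      then have "frequent_set Q {..<real_of_rat p} \<inter> frequent_set Q {real_of_rat r<..} \<inter> {-real m..real m} \<in> null_sets lborel"
        using null[of "real_of_rat p" "real_of_rat r" "real m"] frequent_set_borel[OF contQ] by (auto simp: of_rat_less)
      from AE_not_in[OF this] show ?thesis by auto
    qed simp
  qed
  show ?thesis
    using ae
  proof eventually_elim
    case (elim x)
    obtain m :: nat where "\<bar>x\<bar> \<le> real m" using real_arch_simple by blast
    then have m: "x \<in> {-real m..real m}" by auto
    have "\<exists>l. ((\<lambda>h. Q h x) \<longlongrightarrow> l) (at 0)"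
      using convergent_at_0_iff[where Q = Q and x = x and a = 1 and b = L] Qlow Qup elim m by blast
    then show "f differentiable at x" by (auto simp: real_differentiable_def DERIV_def Q_def)
  qed
qed

text \<open>Adding \<open>(L + 1) * x\<close> raises all slopes to at least 1 and does not affect
  differentiability.\<close>

lemma lipschitz_real_AE_differentiable:
  fixes f :: "real \<Rightarrow> real"
  assumes lip: "L-lipschitz_on UNIV f"
  shows "AE x in lborel. f differentiable (at x)"
proof -
  define F where "F x = f x + (L + 1) * x" for x
  have L0: "L \<ge> 0" using lip by (auto simp: lipschitz_on_def)
  have "(2 * L + 1)-lipschitz_on UNIV F"
  proof (rule lipschitz_onI)
    fix x y
    have "\<bar>F x - F y\<bar> \<le> \<bar>f x - f y\<bar> + \<bar>(L + 1) * (x - y)\<bar>"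
      by (simp add: F_def algebra_simps)
    also have "\<dots> \<le> L * \<bar>x - y\<bar> + (L + 1) * \<bar>x - y\<bar>"
      using lipschitz_onD[OF lip, of x y] L0 by (simp add: dist_real_def abs_mult)
    finally show "dist (F x) (F y) \<le> (2 * L + 1) * dist x y"
      by (simp add: dist_real_def algebra_simps)
  qed (use L0 in simp)
  moreover have "y - x \<le> F y - F x" if "x < y" for x y
    using lipschitz_onD[OF lip, of x y] that by (auto simp: F_def dist_real_def algebra_simps)
  ultimately have "AE x in lborel. F differentiable (at x)" by (rule AE_differentiable_of_slopes)
  then show ?thesis
  proof eventually_elim
    case (elim x)
    have "(\<lambda>x. F x - (L + 1) * x) differentiable (at x)"
      by (intro differentiable_diff elim) (auto intro!: derivative_intros)
    then show ?case by (simp add: F_def)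
  qed
qed

section \<open>Rademacher's theorem\<close>

lemma AE_lborel_translate:
  fixes c :: "'a::euclidean_space"
  assumes "{x. P x} \<in> sets borel"
  shows "(AE x in lborel. P (x + c)) \<longleftrightarrow> (AE x in lborel. P x)"
proof -
  have "(AE x in distr lborel borel ((+) c). P x) \<longleftrightarrow> (AE x in lborel. P (c + x))"
    by (rule AE_distr_iff) (use assms in auto)
  then show ?thesis unfolding lborel_distr_plus by (simp add: add.commute)
qed

lemma integral_lborel_translate:
  fixes f :: "'a::euclidean_space \<Rightarrow> real"
  assumes "f \<in> borel_measurable borel"
  shows "(\<integral>x. f (x + c) \<partial>lborel) = (\<integral>x. f x \<partial>lborel)"
proof -
  have "integral\<^sup>L (distr lborel borel ((+) c)) f = (\<integral>x. f (c + x) \<partial>lborel)"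
    by (rule integral_distr) (use assms in auto)
  then show ?thesis by (simp add: lborel_distr_plus add.commute)
qed

lemma integrable_lborel_translate:
  fixes f :: "'a::euclidean_space \<Rightarrow> real"
  assumes f: "integrable lborel f"
  shows "integrable lborel (\<lambda>x. f (x + c))"
proof -
  have "integrable (distr lborel borel ((+) c)) f" unfolding lborel_distr_plus by (rule f)
  then have "integrable lborel (\<lambda>x. f (c + x))"
    by (subst (asm) integrable_distr_eq) (use borel_measurable_integrable[OF f] in auto)
  then show ?thesis by (simp add: add.commute)
qed

lemma AE_lipschitz_directional_derivative:
  fixes f :: "'a::euclidean_space \<Rightarrow> real"
  assumes lip: "L-lipschitz_on UNIV f"
  shows "AE x in lborel. \<exists>d. ((\<lambda>t. f (x + t *\<^sub>R v)) has_real_derivative d) (at 0)"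
proof -
  have contf: "continuous_on S f" for S
    using lipschitz_on_continuous_on[OF lip] continuous_on_subset by blast
  define q where "q t x = (f (x + t *\<^sub>R v) - f x) / t" for t x
  define G where "G = {x. \<exists>l. ((\<lambda>t. q t x) \<longlongrightarrow> l) (at 0)}"
  have contq: "continuous_on UNIV (q t)" for t
    unfolding q_def
    by (cases "t = 0") (auto intro!: continuous_intros continuous_on_compose2[OF contf[of UNIV]])
  have "- (L * norm v) \<le> q t x \<and> q t x \<le> L * norm v" if "t \<noteq> 0" for x t
  proof -
    have "\<bar>q t x\<bar> \<le> L * norm v"
      using lipschitz_onD[OF lip, of "x + t *\<^sub>R v" x] that
      by (simp add: q_def dist_norm abs_divide pos_divide_le_eq mult_ac)
    then show ?thesis by linarith
  qed
  \<comment> \<open>Measurability of \<open>G\<close> is what permits exchanging the two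
    almost-everywhere quantifiers and translating the result back.\<close>
  then have G: "G \<in> sets borel" unfolding G_def by (intro borel_convergent_at_0[OF contq])
  have Gd: "x \<in> G \<longleftrightarrow> (\<exists>d. ((\<lambda>t. f (x + t *\<^sub>R v)) has_real_derivative d) (at 0))" for x
    by (auto simp: G_def DERIV_def q_def)
  text \<open>Almost every point of each line in direction \<open>v\<close> lies in \<open>G\<close>; by Fubini some translate of \<open>G\<close>
    along \<open>v\<close> has full measure.\<close>
  have line: "AE t in lborel. x + t *\<^sub>R v \<in> G" for x
  proof -
    have "(L * norm v)-lipschitz_on UNIV (\<lambda>t. f (x + t *\<^sub>R v))"
    proof (rule lipschitz_onI)
      show "0 \<le> L * norm v" using lip by (simp add: lipschitz_on_def)
      show "dist (f (x + s *\<^sub>R v)) (f (x + t *\<^sub>R v)) \<le> L * norm v * dist s t" for s t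
        using lipschitz_onD[OF lip, of "x + s *\<^sub>R v" "x + t *\<^sub>R v"]
        by (simp add: dist_norm scaleR_diff_left[symmetric] mult_ac)
    qed
    from lipschitz_real_AE_differentiable[OF this] show ?thesis
    proof eventually_elim
      case (elim t)
      then obtain d where "((\<lambda>t. f (x + t *\<^sub>R v)) has_real_derivative d) (at (0 + t))"
        by (auto simp: real_differentiable_def)
      then have "((\<lambda>s. f (x + (s + t) *\<^sub>R v)) has_real_derivative d) (at 0)" by (subst (asm) DERIV_shift)
      then show ?case unfolding Gd by (auto simp: algebra_simps)
    qed
  qed
  have "{z \<in> space (lborel \<Otimes>\<^sub>M lborel). fst z + snd z *\<^sub>R v \<in> G} \<in> sets (lborel \<Otimes>\<^sub>M (lborel :: real measure))"
    using G by measurable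
  from lborel_pair.AE_commute[OF this] line
  have "AE t in lborel. AE x in lborel. x + (t::real) *\<^sub>R v \<in> G" by auto
  then have "\<exists>t. AE x in lborel. x + (t::real) *\<^sub>R v \<in> G"
    by (rule eventually_happens'[rotated]) (simp add: ae_filter_eq_bot_iff)
  then obtain t :: real where "AE x in lborel. x + t *\<^sub>R v \<in> G" by blast
  then have "AE x in lborel. x \<in> G"
    using AE_lborel_translate[of "\<lambda>x. x \<in> G" "t *\<^sub>R v"] G by simp
  then show ?thesis by (simp add: Gd)
qed

text \<open>\<open>K\<close> and its translate have equal measure, so the integral is twice the
  measure of the part of the translate outside \<open>K\<close>. A point outside the closed set
  \<open>K\<close> eventually leaves the translates, and dominated convergence applies.\<close>

lemma integral_abs_indicator_translate_tendsto_0: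
  fixes K :: "'a::euclidean_space set"
  assumes K: "compact K" and c: "c \<longlonglongrightarrow> 0"
  shows "(\<lambda>n. \<integral>x. \<bar>indicat_real K (x - c n) - indicat_real K x\<bar> \<partial>lborel) \<longlonglongrightarrow> 0"
proof -
  let ?b = "indicat_real K" and ?a = "\<lambda>n x. indicat_real K (x - c n)"
  have Kb: "K \<in> sets borel" using K by (simp add: borel_compact)
  then have [measurable]: "?b \<in> borel_measurable borel" by simp
  obtain B1 where B1: "\<And>x. x \<in> K \<Longrightarrow> norm x \<le> B1" using compact_imp_bounded[OF K] by (auto simp: bounded_iff)
  obtain B2 where B2: "\<And>n. norm (c n) \<le> B2"
    using c convergent_imp_Bseq[of c] by (auto simp: Bseq_def convergent_def)
  let ?w = "indicat_real (cball 0 (B1 + B2) :: 'a set)"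
  have wi: "integrable lborel ?w"
    by (intro integrable_real_indicator emeasure_bounded_finite) auto
  have inb: "x \<in> cball 0 (B1 + B2)" if "x - c n \<in> K" for x n
    using B1[OF that] B2[of n] norm_triangle_ineq[of "x - c n" "c n"] by simp
  have inb': "x \<in> cball 0 (B1 + B2)" if "x \<in> K" for x
    using B1[OF that] B2[of 0] norm_ge_zero[of "c 0"] by (simp del: norm_ge_zero)
  have ai: "integrable lborel (?a n)" for n
    by (rule Bochner_Integration.integrable_bound[OF wi], measurable) (use inb in \<open>auto simp: indicator_def\<close>)
  have bi: "integrable lborel ?b"
    by (rule Bochner_Integration.integrable_bound[OF wi], measurable) (use inb' in \<open>auto simp: indicator_def\<close>)
  have abi: "integrable lborel (\<lambda>x. ?a n x * (1 - ?b x))" for n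
    by (rule Bochner_Integration.integrable_bound[OF wi], measurable) (use inb in \<open>auto simp: indicator_def\<close>)
  have eq: "(\<integral>x. \<bar>?a n x - ?b x\<bar> \<partial>lborel) = 2 * (\<integral>x. ?a n x * (1 - ?b x) \<partial>lborel)" for n
  proof -
    have "(\<integral>x. \<bar>?a n x - ?b x\<bar> \<partial>lborel) = (\<integral>x. 2 * (?a n x * (1 - ?b x)) + (?b x - ?a n x) \<partial>lborel)"
      by (intro Bochner_Integration.integral_cong) (auto simp: indicator_def)
    also have "\<dots> = 2 * (\<integral>x. ?a n x * (1 - ?b x) \<partial>lborel) + ((\<integral>x. ?b x \<partial>lborel) - (\<integral>x. ?a n x \<partial>lborel))"
      using ai[of n] bi abi[of n] by simp
    also have "(\<integral>x. ?a n x \<partial>lborel) = (\<integral>x. ?b x \<partial>lborel)"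
      using integral_lborel_translate[of ?b "- c n"] by simp
    finally show ?thesis by simp
  qed
  have "(\<lambda>n. \<integral>x. ?a n x * (1 - ?b x) \<partial>lborel) \<longlonglongrightarrow> (\<integral>x. 0 \<partial>(lborel :: 'a measure))"
  proof (rule integral_dominated_convergence[OF _ _ wi])
    show "AE x in lborel. (\<lambda>n. ?a n x * (1 - ?b x)) \<longlonglongrightarrow> 0"
    proof (rule AE_I2)
      fix x
      show "(\<lambda>n. ?a n x * (1 - ?b x)) \<longlonglongrightarrow> 0"
      proof (cases "x \<in> K")
        case False
        have "(\<lambda>n. x - c n) \<longlonglongrightarrow> x - 0" by (intro tendsto_intros c)
        then have "\<forall>\<^sub>F n in sequentially. x - c n \<in> - K"
          by (rule topological_tendstoD) (use False K in \<open>auto simp: compact_imp_closed open_Compl\<close>)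
        then have "\<forall>\<^sub>F n in sequentially. ?a n x * (1 - ?b x) = 0" by eventually_elim auto
        then show ?thesis by (rule tendsto_eventually)
      qed simp
    qed
    show "AE x in lborel. norm (?a n x * (1 - ?b x)) \<le> ?w x" for n
      using inb by (auto simp: indicator_def)
  qed auto
  from tendsto_mult[OF tendsto_const[of 2] this] show ?thesis unfolding eq by simp
qed

text \<open>On \<open>1 / Suc n \<le> h x\<close> every compact subset is null because its integral
  vanishes. Closed subsets are countable unions of compact ones, and inner regularity then gives the
  whole level set.\<close>

lemma AE_nonpos_if_compact_integrals_zero:
  fixes h :: "'a::euclidean_space \<Rightarrow> real"
  assumes h[measurable]: "h \<in> borel_measurable borel" and bd: "\<And>x. \<bar>h x\<bar> \<le> C"
    and zero: "\<And>K. compact K \<Longrightarrow> (\<integral>x. indicator K x * h x \<partial>lborel) = 0"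
  shows "AE x in lborel. h x \<le> 0"
proof -
  have null: "emeasure lborel {x. 1 / Suc n \<le> h x} = 0" for n :: nat
  proof -
    define S where "S = {x. 1 / Suc n \<le> h x}"
    have S[measurable]: "S \<in> sets borel" unfolding S_def by simp
    have K0: "emeasure lborel K = 0" if K: "compact K" "K \<subseteq> S" for K
    proof -
      have Kb[measurable]: "K \<in> sets borel" using K by (simp add: borel_compact)
      have fin: "emeasure lborel K < \<infinity>" by (rule emeasure_bounded_finite[OF compact_imp_bounded[OF K(1)]])
      have "(\<integral>x. indicat_real K x * (1 / Suc n) \<partial>lborel) \<le> (\<integral>x. indicator K x * h x \<partial>lborel)"
      proof (rule integral_mono)
        show "integrable lborel (\<lambda>x. indicat_real K x * (1 / Suc n))"
          using fin by (intro integrable_mult_left integrable_real_indicator) auto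
        show "integrable lborel (\<lambda>x. indicat_real K x * h x)"
          using integrableI_bounded_set_indicator[of K lborel h C] fin bd by simp
        show "indicat_real K x * (1 / Suc n) \<le> indicat_real K x * h x" for x
          using K(2) by (auto simp: indicator_def S_def)
      qed
      then have "measure lborel K * (1 / Suc n) \<le> 0" using zero[OF K(1)] fin by simp
      then have "measure lborel K = 0"
        by (metis divide_pos_pos measure_nonneg mult_le_0_iff of_nat_0_less_iff zero_less_Suc zero_less_one not_le order_antisym)
      then show ?thesis using fin by (simp add: emeasure_eq_ennreal_measure less_top)
    qed
    have T0: "emeasure lborel T = 0" if T: "closed T" "T \<subseteq> S" for T
    proof -
      have "T = (\<Union>m::nat. T \<inter> cball 0 (real m))" by (auto simp: real_arch_simple)
      moreover have "(\<Union>m::nat. T \<inter> cball 0 (real m)) \<in> null_sets lborel"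
        using K0[of "T \<inter> cball 0 (real _)"] T
        by (intro null_sets_UN) (auto simp: null_sets_def closed_Int_compact)
      ultimately show ?thesis by (simp add: null_sets_def)
    qed
    have "emeasure lborel S \<le> 0"
    proof (rule ennreal_le_epsilon)
      fix e :: real assume e: "e > 0"
      have "S \<in> sets lebesgue" by simp
      then obtain T where T: "closed T" "T \<subseteq> S" "emeasure lebesgue (S - T) < ennreal e"
        by (rule sets_lebesgue_inner_closed[OF _ e])
      have [measurable]: "T \<in> sets borel" using T by simp
      have "emeasure lborel S \<le> emeasure lborel T + emeasure lborel (S - T)"
        using T emeasure_subadditive[of T lborel "S - T"] by (simp add: Un_absorb1)
      also have "\<dots> \<le> 0 + ennreal e"
        using T by (simp add: T0 emeasure_completion main_part_sets less_imp_le)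
      finally show "emeasure lborel S \<le> 0 + ennreal e" .
    qed
    then show ?thesis by (simp add: S_def)
  qed
  have "AE x in lborel. \<forall>n::nat. \<not> (1 / Suc n \<le> h x)"
    unfolding AE_all_countable
  proof
    fix n :: nat
    have "{x. 1 / Suc n \<le> h x} \<in> null_sets lborel" using null[of n] by (simp add: null_sets_def)
    from AE_not_in[OF this] show "AE x in lborel. \<not> (1 / Suc n \<le> h x)" by simp
  qed
  then show ?thesis
  proof eventually_elim
    case (elim x)
    show ?case
    proof (rule ccontr)
      assume "\<not> h x \<le> 0"
      then obtain n where "1 / real (Suc n) < h x" using reals_Archimedean by (metis inverse_eq_divide not_le)
      then show False using elim less_imp_le by blast
    qed
  qed
qed

lemma AE_eq_0_if_compact_integrals_zero:
  fixes h :: "'a::euclidean_space \<Rightarrow> real"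
  assumes h[measurable]: "h \<in> borel_measurable borel" and bd: "\<And>x. \<bar>h x\<bar> \<le> C"
    and zero: "\<And>K. compact K \<Longrightarrow> (\<integral>x. indicator K x * h x \<partial>lborel) = 0"
  shows "AE x in lborel. h x = 0"
proof -
  have "AE x in lborel. h x \<le> 0" by (rule AE_nonpos_if_compact_integrals_zero[OF assms])
  moreover have "AE x in lborel. - h x \<le> 0"
    by (rule AE_nonpos_if_compact_integrals_zero[where C = C]) (use bd zero in auto)
  ultimately show ?thesis by eventually_elim auto
qed

lemma abs_difference_quotient_le:
  fixes f :: "'a::real_normed_vector \<Rightarrow> real"
  assumes lip: "L-lipschitz_on UNIV f"
  shows "\<bar>real (Suc n) * (f (x + (1 / Suc n) *\<^sub>R u) - f x)\<bar> \<le> L * norm u"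
proof -
  have "\<bar>f (x + (1 / Suc n) *\<^sub>R u) - f x\<bar> \<le> L * norm u / real (Suc n)"
    using lipschitz_onD[OF lip, of "x + (1 / Suc n) *\<^sub>R u" x] by (simp add: dist_norm)
  then show ?thesis unfolding abs_mult by (simp add: field_simps del: of_nat_Suc)
qed

text \<open>The defect of additivity, at the level of difference quotients, is the increment of a
  single bounded quotient under a small translation. Integrated over a compact set, the translation
  moves onto the indicator and the integral tends to 0; hence the limit defect has zero integral
  over every compact set.\<close>

lemma AE_directional_derivative_add:
  fixes f :: "'a::euclidean_space \<Rightarrow> real"
  assumes lip: "L-lipschitz_on UNIV f"
  shows "AE x in lborel. \<forall>d e r. ((\<lambda>t. f (x + t *\<^sub>R v)) has_real_derivative d) (at 0) \<longrightarrow>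
    ((\<lambda>t. f (x + t *\<^sub>R w)) has_real_derivative e) (at 0) \<longrightarrow>
    ((\<lambda>t. f (x + t *\<^sub>R (v + w))) has_real_derivative r) (at 0) \<longrightarrow> r = d + e"
proof -
  have contf: "continuous_on S f" for S
    using lipschitz_on_continuous_on[OF lip] continuous_on_subset by blast
  have [measurable]: "f \<in> borel_measurable borel"
    using contf by (auto intro: borel_measurable_continuous_onI)
  define g where "g n u x = real (Suc n) * (f (x + (1 / Suc n) *\<^sub>R u) - f x)" for n u x
  have gm[measurable]: "g n u \<in> borel_measurable borel" for n u
    unfolding g_def[abs_def] by measurable
  have gb: "\<bar>g n u x\<bar> \<le> L * norm u" for n u x
    unfolding g_def by (rule abs_difference_quotient_le[OF lip])
  have glim: "(\<lambda>n. g n u x) \<longlonglongrightarrow> d" if d: "((\<lambda>t. f (x + t *\<^sub>R u)) has_real_derivative d) (at 0)" for u x d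
  proof -
    have "((\<lambda>h. (f (x + h *\<^sub>R u) - f x) / h) \<longlongrightarrow> d) (at 0)" using d by (simp add: DERIV_def)
    moreover have "filterlim (\<lambda>n. 1 / real (Suc n)) (at 0) sequentially"
      using LIMSEQ_inverse_real_of_nat by (simp add: filterlim_at inverse_eq_divide)
    ultimately have "(\<lambda>n. (f (x + (1 / real (Suc n)) *\<^sub>R u) - f x) / (1 / real (Suc n))) \<longlonglongrightarrow> d"
      by (rule filterlim_compose)
    then show ?thesis by (simp add: g_def mult.commute)
  qed
  define D where "D u x = lim (\<lambda>n. g n u x)" for u x
  have Dm[measurable]: "D u \<in> borel_measurable borel" for u
    unfolding D_def[abs_def] by measurable
  have aeD: "AE x in lborel. (\<lambda>n. g n u x) \<longlonglongrightarrow> D u x" for u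
    using AE_lipschitz_directional_derivative[OF lip, of u]
  proof eventually_elim
    case (elim x)
    then show ?case using glim unfolding D_def by (metis limI)
  qed
  let ?C = "L * norm (v + w) + L * norm v + L * norm w"
  \<comment> \<open>\<open>D\<close> is built from \<open>lim\<close> and is arbitrary where the
    quotients diverge. Clamping to \<open>?C\<close>, a bound that the quotients respect, makes
    \<open>h\<close> bounded everywhere and changes nothing almost everywhere.\<close>
  define h where "h x = max (- ?C) (min ?C (D (v + w) x - D v x - D w x))" for x
  have L0: "L \<ge> 0" using lip by (simp add: lipschitz_on_def)
  have C0: "?C \<ge> 0" using L0 by simp
  have hm[measurable]: "h \<in> borel_measurable borel" unfolding h_def[abs_def] by measurable
  define k where "k n x = g n (v + w) x - g n v x - g n w x" for n x
  have km[measurable]: "k n \<in> borel_measurable borel" for n unfolding k_def[abs_def] by measurable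
  have kb: "\<bar>k n x\<bar> \<le> ?C" for n x using gb[of n "v + w" x] gb[of n v x] gb[of n w x] by (simp add: k_def)
  have klim: "AE x in lborel. (\<lambda>n. k n x) \<longlonglongrightarrow> h x"
    using aeD[of v] aeD[of w] aeD[of "v + w"]
  proof eventually_elim
    case (elim x)
    then have l: "(\<lambda>n. k n x) \<longlonglongrightarrow> D (v + w) x - D v x - D w x" unfolding k_def by (intro tendsto_intros)
    have "(\<lambda>n. max (- ?C) (min ?C (k n x))) \<longlonglongrightarrow> h x" unfolding h_def by (intro tendsto_intros l)
    moreover have "max (- ?C) (min ?C (k n x)) = k n x" for n using kb[of n x] by linarith
    ultimately show ?case by simp
  qed
  have "AE x in lborel. h x = 0"
  proof (rule AE_eq_0_if_compact_integrals_zero[where C = ?C])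
    show "\<bar>h x\<bar> \<le> ?C" for x using C0 by (auto simp: h_def)
    fix K :: "'a set" assume K: "compact K"
    have Kb[measurable]: "K \<in> sets borel" using K by (simp add: borel_compact)
    have fin: "emeasure lborel K < \<infinity>" by (rule emeasure_bounded_finite[OF compact_imp_bounded[OF K]])
    have Ki: "integrable lborel (indicat_real K)" using fin by (intro integrable_real_indicator) auto
    define c where "c n = (1 / Suc n) *\<^sub>R w" for n
    have "(\<lambda>n. inverse (real (Suc n)) *\<^sub>R w) \<longlonglongrightarrow> 0 *\<^sub>R w"
      by (intro tendsto_intros LIMSEQ_inverse_real_of_nat)
    then have c: "c \<longlonglongrightarrow> 0" by (simp add: c_def[abs_def] inverse_eq_divide)
    have lim1: "(\<lambda>n. \<integral>x. indicator K x * k n x \<partial>lborel) \<longlonglongrightarrow> (\<integral>x. indicator K x * h x \<partial>lborel)"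
    proof (rule integral_dominated_convergence)
      show "integrable lborel (\<lambda>x. ?C * indicat_real K x)" using Ki by simp
      show "AE x in lborel. (\<lambda>n. indicat_real K x * k n x) \<longlonglongrightarrow> indicat_real K x * h x"
        using klim by eventually_elim (intro tendsto_intros)
      show "AE x in lborel. norm (indicat_real K x * k n x) \<le> ?C * indicat_real K x" for n
        using kb by (auto simp: indicator_def abs_mult)
    qed measurable
    have bnd: "norm (\<integral>x. indicator K x * k n x \<partial>lborel)
      \<le> L * norm v * (\<integral>x. \<bar>indicat_real K (x - c n) - indicat_real K x\<bar> \<partial>lborel)" for n
    proof -
      have int1: "integrable lborel (\<lambda>x. indicat_real K x * g n v x)"
        using integrableI_bounded_set_indicator[of K lborel "g n v" "L * norm v"] fin gb by simp
      have int2': "integrable lborel (\<lambda>x. indicat_real K x * g n v (x + c n))"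
        using integrableI_bounded_set_indicator[of K lborel "\<lambda>x. g n v (x + c n)" "L * norm v"] fin gb by simp
      have int2: "integrable lborel (\<lambda>x. indicat_real K (x - c n) * g n v x)"
        using integrable_lborel_translate[OF int2', of "- c n"] by simp
      have int0: "integrable lborel (\<lambda>x. indicat_real K (x - c n))"
        using integrable_lborel_translate[OF Ki, of "- c n"] by simp
      \<comment> \<open>Going to \<open>v + w\<close> by way of \<open>w\<close>: the increment
        along \<open>w\<close> cancels, and what remains is the quotient for \<open>v\<close> at the
        base points \<open>x + c n\<close> and \<open>x\<close>.\<close>
      have "k n x = g n v (x + c n) - g n v x" for x
        by (simp add: k_def g_def c_def algebra_simps)
      then have "(\<lambda>x. indicat_real K x * k n x)
          = (\<lambda>x. indicat_real K x * g n v (x + c n) - indicat_real K x * g n v x)"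
        by (simp add: fun_eq_iff right_diff_distrib)
      then have "(\<integral>x. indicator K x * k n x \<partial>lborel)
          = (\<integral>x. indicat_real K x * g n v (x + c n) - indicat_real K x * g n v x \<partial>lborel)"
        by simp
      also have "\<dots> = (\<integral>x. indicat_real K x * g n v (x + c n) \<partial>lborel) - (\<integral>x. indicat_real K x * g n v x \<partial>lborel)"
        by (rule Bochner_Integration.integral_diff[OF int2' int1])
      also have "(\<integral>x. indicat_real K x * g n v (x + c n) \<partial>lborel) = (\<integral>x. indicat_real K (x - c n) * g n v x \<partial>lborel)"
        using integral_lborel_translate[of "\<lambda>x. indicat_real K (x - c n) * g n v x" "c n"] by simp
      also have "\<dots> - (\<integral>x. indicat_real K x * g n v x \<partial>lborel)
          = (\<integral>x. indicat_real K (x - c n) * g n v x - indicat_real K x * g n v x \<partial>lborel)"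
        by (rule Bochner_Integration.integral_diff[OF int2 int1, symmetric])
      also have "\<dots> = (\<integral>x. (indicat_real K (x - c n) - indicat_real K x) * g n v x \<partial>lborel)"
        by (simp only: left_diff_distrib)
      also have "norm \<dots> \<le> (\<integral>x. (L * norm v) * \<bar>indicat_real K (x - c n) - indicat_real K x\<bar> \<partial>lborel)"
      proof (rule Bochner_Integration.integral_norm_bound_integral)
        show "integrable lborel (\<lambda>x. (indicat_real K (x - c n) - indicat_real K x) * g n v x)"
          using int1 int2 by (simp add: left_diff_distrib)
        show "integrable lborel (\<lambda>x. (L * norm v) * \<bar>indicat_real K (x - c n) - indicat_real K x\<bar>)"
          using int0 Ki by simp
        show "norm ((indicat_real K (x - c n) - indicat_real K x) * g n v x)
          \<le> (L * norm v) * \<bar>indicat_real K (x - c n) - indicat_real K x\<bar>" for x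
          using mult_left_mono[OF gb[of n v x], of "\<bar>indicat_real K (x - c n) - indicat_real K x\<bar>"]
          by (simp add: abs_mult mult.commute)
      qed
      finally show ?thesis by simp
    qed
    have "(\<lambda>n. \<integral>x. indicator K x * k n x \<partial>lborel) \<longlonglongrightarrow> 0"
    proof (rule Lim_null_comparison)
      show "(\<lambda>n. L * norm v * (\<integral>x. \<bar>indicat_real K (x - c n) - indicat_real K x\<bar> \<partial>lborel)) \<longlonglongrightarrow> 0"
        using tendsto_mult[OF tendsto_const integral_abs_indicator_translate_tendsto_0[OF K c]] by simp
    qed (use bnd in auto)
    with lim1 show "(\<integral>x. indicator K x * h x \<partial>lborel) = 0" using LIMSEQ_unique by blast
  qed measurable
  then show ?thesis using klim
  proof eventually_elim
    case (elim x)
    show ?case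
    proof (intro allI impI)
      fix d e r
      assume "((\<lambda>t. f (x + t *\<^sub>R v)) has_real_derivative d) (at 0)"
        "((\<lambda>t. f (x + t *\<^sub>R w)) has_real_derivative e) (at 0)"
        "((\<lambda>t. f (x + t *\<^sub>R (v + w))) has_real_derivative r) (at 0)"
      then have "(\<lambda>n. k n x) \<longlonglongrightarrow> r - d - e" unfolding k_def by (intro tendsto_intros glim)
      then have "r - d - e = 0" using elim LIMSEQ_unique by metis
      then show "r = d + e" by simp
    qed
  qed
qed

text \<open>Off one null set the derivatives in a countable dense set of directions are given by one
  vector \<open>A x\<close>. Finitely many of these directions approximate the whole unit sphere,
  and the Lipschitz bound transfers the estimate to every direction uniformly.\<close>

theorem lipschitz_AE_differentiable_real:
  fixes f :: "'a::euclidean_space \<Rightarrow> real"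
  assumes lip: "L-lipschitz_on UNIV f"
  shows "AE x in lborel. f differentiable (at x)"
proof -
  define Dd where "Dd x u d \<longleftrightarrow> ((\<lambda>t. f (x + t *\<^sub>R u)) has_real_derivative d) (at 0)" for x u d
  have L0: "L \<ge> 0" using lip by (simp add: lipschitz_on_def)
  define A where "A x = (\<Sum>b\<in>Basis. (THE d. Dd x b d) *\<^sub>R b)" for x
  have uniq: "d = e" if "Dd x u d" "Dd x u e" for x u d e
    using that DERIV_unique unfolding Dd_def by blast
  have exD: "AE x in lborel. \<exists>d. Dd x u d" for u
    using AE_lipschitz_directional_derivative[OF lip] by (simp add: Dd_def)
  have scale: "Dd x (c *\<^sub>R u) (c * d)" if "Dd x u d" for x u c d
  proof -
    have "((\<lambda>t. f (x + t *\<^sub>R u)) has_real_derivative d) (at (c * 0))" using that by (simp add: Dd_def)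
    moreover have "((\<lambda>t. c * t) has_real_derivative c) (at 0)" by (auto intro!: derivative_eq_intros)
    ultimately have "((\<lambda>t. f (x + (c * t) *\<^sub>R u)) has_real_derivative d * c) (at 0)" by (rule DERIV_chain2)
    then show ?thesis by (simp add: Dd_def mult.commute)
  qed
  have basis: "AE x in lborel. Dd x (c *\<^sub>R b) (A x \<bullet> (c *\<^sub>R b))" if b: "b \<in> Basis" for b c
    using exD[of b]
  proof eventually_elim
    case (elim x)
    then have "Dd x b (THE d. Dd x b d)" using uniq by (metis the_equality)
    moreover have "A x \<bullet> b = (THE d. Dd x b d)" using b by (simp add: A_def)
    ultimately show ?case using scale by (metis inner_scaleR_right)
  qed
  \<comment> \<open>Each fixed direction \<open>u\<close> costs finitely many null sets, one
    application of additivity per basis vector; only afterwards are countably many directions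
    combined.\<close>
  have lin: "AE x in lborel. Dd x (\<Sum>b\<in>B. (u \<bullet> b) *\<^sub>R b) (A x \<bullet> (\<Sum>b\<in>B. (u \<bullet> b) *\<^sub>R b))"
    if "B \<subseteq> Basis" for B and u :: 'a
    using finite_subset[OF that finite_Basis] that
  proof (induction B rule: finite_induct)
    case empty
    then show ?case by (simp add: Dd_def)
  next
    case (insert b B)
    let ?s = "\<Sum>b\<in>B. (u \<bullet> b) *\<^sub>R b" and ?t = "(u \<bullet> b) *\<^sub>R b"
    have 1: "AE x in lborel. Dd x ?s (A x \<bullet> ?s)" using insert by simp
    have 2: "AE x in lborel. Dd x ?t (A x \<bullet> ?t)" by (rule basis) (use insert in simp)
    have "AE x in lborel. Dd x (?t + ?s) (A x \<bullet> (?t + ?s))"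
      using 1 2 exD[of "?t + ?s"] AE_directional_derivative_add[OF lip, of ?t ?s]
    proof eventually_elim
      case (elim x)
      then obtain r where r: "Dd x (?t + ?s) r" by blast
      have "r = A x \<bullet> ?t + A x \<bullet> ?s" using elim r unfolding Dd_def by blast
      then show ?case using r by (simp add: inner_add_right)
    qed
    then show ?case using insert by simp
  qed
  obtain S :: "'a set" where S: "countable S" "\<And>U. open U \<Longrightarrow> U \<noteq> {} \<Longrightarrow> \<exists>s\<in>S. s \<in> U"
    using countable_dense_setE by metis
  have "AE x in lborel. \<forall>u\<in>S. Dd x u (A x \<bullet> u)"
    unfolding AE_ball_countable[OF S(1)]
  proof
    show "AE x in lborel. Dd x u (A x \<bullet> u)" for u
      using lin[OF subset_refl, of u] by (simp add: euclidean_representation)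
  qed
  then show ?thesis
  proof eventually_elim
    case (elim x)
    have "(f has_derivative (\<lambda>h. A x \<bullet> h)) (at x)"
      unfolding has_derivative_within_alt
    proof (intro conjI allI impI)
      show "bounded_linear ((\<bullet>) (A x))" by (rule bounded_linear_inner_right)
      fix e :: real assume e: "e > 0"
      \<comment> \<open>The three errors at distance \<open>t\<close> are
        \<open>L * \<eta> * t\<close> for replacing \<open>u\<close> by \<open>s\<close> in
        \<open>f\<close>, \<open>\<eta> * t\<close> for the derivative along \<open>s\<close>, and
        \<open>norm (A x) * \<eta> * t\<close> for going back from \<open>s\<close> to
        \<open>u\<close>; their sum is \<open>e * t\<close>.\<close>
      define \<eta> where "\<eta> = e / (L + norm (A x) + 1)"
      have \<eta>: "\<eta> > 0" using e L0 by (simp add: \<eta>_def add_nonneg_pos)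
      have "sphere (0::'a) 1 \<subseteq> (\<Union>s\<in>S. ball s \<eta>)"
      proof
        fix u :: 'a
        obtain s where "s \<in> S" "s \<in> ball u \<eta>" using S(2)[of "ball u \<eta>"] \<eta> by auto
        then show "u \<in> (\<Union>s\<in>S. ball s \<eta>)" by (auto simp: dist_commute)
      qed
      then obtain S' where S': "S' \<subseteq> S" "finite S'" "sphere (0::'a) 1 \<subseteq> (\<Union>s\<in>S'. ball s \<eta>)"
        using compactE_image[OF compact_sphere, of S "\<lambda>s. ball s \<eta>" 0 1] by auto
      have "\<exists>d>0. \<forall>t. \<bar>t\<bar> < d \<longrightarrow> \<bar>f (x + t *\<^sub>R s) - f x - t * (A x \<bullet> s)\<bar> \<le> \<eta> * \<bar>t\<bar>" if "s \<in> S'" for s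
      proof -
        have "Dd x s (A x \<bullet> s)" using elim that S' by blast
        then have "((\<lambda>t. f (x + t *\<^sub>R s)) has_derivative (\<lambda>t. (A x \<bullet> s) * t)) (at 0)"
          by (simp add: Dd_def has_field_derivative_def)
        then show ?thesis using \<eta> unfolding has_derivative_within_alt
          by (auto simp: mult.commute)
      qed
      then obtain d where d: "\<And>s. s \<in> S' \<Longrightarrow> d s > 0"
        "\<And>s t. s \<in> S' \<Longrightarrow> \<bar>t\<bar> < d s \<Longrightarrow> \<bar>f (x + t *\<^sub>R s) - f x - t * (A x \<bullet> s)\<bar> \<le> \<eta> * \<bar>t\<bar>"
        by metis
      define dd where "dd = Min (insert 1 (d ` S'))"
      have dd: "dd > 0" "\<And>s. s \<in> S' \<Longrightarrow> dd \<le> d s" using S' d by (auto simp: dd_def)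
      have "norm (f y - f x - A x \<bullet> (y - x)) \<le> e * norm (y - x)" if y: "norm (y - x) < dd" for y
      proof (cases "y = x")
        case False
        define t where "t = norm (y - x)"
        define u where "u = (1 / t) *\<^sub>R (y - x)"
        have t: "t > 0" using False by (simp add: t_def)
        have yx: "y = x + t *\<^sub>R u" using t by (simp add: u_def)
        have "u \<in> sphere 0 1" using t by (simp add: u_def t_def)
        then obtain s where s: "s \<in> S'" "dist s u < \<eta>" using S' by auto
        have su: "norm (u - s) \<le> \<eta>" using s(2) by (simp add: dist_norm norm_minus_commute)
        have 1: "\<bar>f (x + t *\<^sub>R u) - f (x + t *\<^sub>R s)\<bar> \<le> L * (t * \<eta>)"
        proof -
          have "\<bar>f (x + t *\<^sub>R u) - f (x + t *\<^sub>R s)\<bar> \<le> L * norm (t *\<^sub>R (u - s))"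
            using lipschitz_onD[OF lip, of "x + t *\<^sub>R u" "x + t *\<^sub>R s"]
            by (simp add: dist_norm scaleR_diff_right)
          also have "\<dots> \<le> L * (t * \<eta>)" using su t L0 by (intro mult_left_mono) auto
          finally show ?thesis .
        qed
        have 2: "\<bar>f (x + t *\<^sub>R s) - f x - t * (A x \<bullet> s)\<bar> \<le> \<eta> * t"
          using d(2)[OF s(1), of t] dd(2)[OF s(1)] y t by (simp add: t_def)
        have 3: "\<bar>t * (A x \<bullet> s) - t * (A x \<bullet> u)\<bar> \<le> t * (norm (A x) * \<eta>)"
        proof -
          have "\<bar>t * (A x \<bullet> s) - t * (A x \<bullet> u)\<bar> = t * \<bar>A x \<bullet> (u - s)\<bar>"
            using t by (simp add: abs_mult right_diff_distrib[symmetric] inner_diff_right abs_minus_commute)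
          also have "\<dots> \<le> t * (norm (A x) * norm (u - s))"
            using t by (intro mult_left_mono Cauchy_Schwarz_ineq2) auto
          also have "\<dots> \<le> t * (norm (A x) * \<eta>)" using t su by (intro mult_left_mono) auto
          finally show ?thesis .
        qed
        have "\<bar>f y - f x - A x \<bullet> (y - x)\<bar> \<le> L * (t * \<eta>) + \<eta> * t + t * (norm (A x) * \<eta>)"
          using 1 2 3 by (simp add: yx)
        also have "\<dots> = t * (\<eta> * (L + norm (A x) + 1))" by (simp add: algebra_simps)
        also have "\<eta> * (L + norm (A x) + 1) = e"
          using L0 norm_ge_zero[of "A x"] by (simp add: \<eta>_def del: norm_ge_zero)
        finally show ?thesis by (simp add: t_def mult.commute)
      qed simp
      then show "\<exists>d>0. \<forall>y\<in>UNIV. norm (y - x) < d \<longrightarrow> norm (f y - f x - A x \<bullet> (y - x)) \<le> e * norm (y - x)"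
        using dd(1) by blast
    qed
    then show ?case by (auto simp: differentiable_def)
  qed
qed

lemma lipschitz_on_inner_left:
  assumes lip: "L-lipschitz_on S f"
  shows "(L * norm w)-lipschitz_on S (\<lambda>z. f z \<bullet> w)"
proof (rule lipschitz_onI)
  fix a b assume ab: "a \<in> S" "b \<in> S"
  have "\<bar>(f a - f b) \<bullet> w\<bar> \<le> norm (f a - f b) * norm w" by (rule Cauchy_Schwarz_ineq2)
  also have "\<dots> \<le> (L * dist a b) * norm w"
    using lipschitz_onD[OF lip ab] by (intro mult_right_mono) (auto simp: dist_norm)
  finally show "dist (f a \<bullet> w) (f b \<bullet> w) \<le> L * norm w * dist a b"
    by (simp add: dist_norm inner_diff_left mult_ac)
qed (use lip in \<open>simp add: lipschitz_on_def\<close>)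

theorem lipschitz_AE_differentiable:
  fixes f :: "'a::euclidean_space \<Rightarrow> 'b::euclidean_space"
  assumes lip: "L-lipschitz_on UNIV f"
  shows "AE x in lborel. f differentiable (at x)"
proof -
  have "AE x in lborel. \<forall>b\<in>Basis. (\<lambda>x. f x \<bullet> b) differentiable (at x)"
    unfolding AE_ball_countable[OF countable_finite[OF finite_Basis]]
  proof
    fix b :: 'b assume b: "b \<in> Basis"
    have "L-lipschitz_on UNIV (\<lambda>x. f x \<bullet> b)"
      using lipschitz_on_inner_left[OF lip, of b] b by simp
    then show "AE x in lborel. (\<lambda>x. f x \<bullet> b) differentiable (at x)" by (rule lipschitz_AE_differentiable_real)
  qed
  then show ?thesis
    by eventually_elim (simp add: differentiable_componentwise_within[of f])
qed

section \<open>Mean value inequalities\<close>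

lemma AE_lborel_imp_ex_in_ball:
  fixes u :: "'a::euclidean_space"
  assumes "AE x in lborel. P x" "e > 0"
  shows "\<exists>x\<in>ball u e. P x"
proof (rule ccontr)
  assume "\<not> ?thesis"
  then have "AE x in lborel. x \<notin> ball u e" using assms(1) by (auto elim: eventually_mono)
  then have "emeasure lborel (ball u e) = 0"
    by (subst (asm) AE_iff_measurable[OF _ refl]) (auto simp: dist_commute ball_def)
  moreover have "measure lborel (ball u e) > 0" using assms(2) by (rule content_ball_pos)
  ultimately show False by (simp add: measure_def)
qed

text \<open>The direction is allowed to vary with \<open>k\<close>, exactly as in the definition of
  the tangent cone; a directional derivative alone would not suffice for this.\<close>

lemma derivative_quotient_tendsto:
  fixes P :: "'a::real_normed_vector \<Rightarrow> 'b::real_normed_vector"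
  assumes der: "(P has_derivative B) (at u)"
    and t: "\<And>k. t k > 0" "t \<longlonglongrightarrow> 0" and h: "hs \<longlonglongrightarrow> h"
  shows "(\<lambda>k::nat. (1 / t k) *\<^sub>R (P (u + t k *\<^sub>R hs k) - P u)) \<longlonglongrightarrow> B h"
proof -
  interpret B: bounded_linear B using der by (rule has_derivative_bounded_linear)
  obtain H where H: "\<And>k. norm (hs k) \<le> H" "H > 0"
    using convergent_imp_Bseq[of hs] h by (auto simp: Bseq_def convergent_def)
  have th: "(\<lambda>k. t k *\<^sub>R hs k) \<longlonglongrightarrow> 0" using tendsto_scaleR[OF t(2) h] by simp
  have "(\<lambda>k. (1 / t k) *\<^sub>R (P (u + t k *\<^sub>R hs k) - P u) - B (hs k)) \<longlonglongrightarrow> 0"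
  proof (rule tendstoI)
    fix e :: real assume e: "e > 0"
    define e' where "e' = e / (2 * H)"
    have e': "e' > 0" using e H by (simp add: e'_def)
    obtain d where d: "d > 0" "\<And>y. norm (y - u) < d \<Longrightarrow> norm (P y - P u - B (y - u)) \<le> e' * norm (y - u)"
      using der e' unfolding has_derivative_within_alt by auto
    have "\<forall>\<^sub>F k in sequentially. norm (t k *\<^sub>R hs k) < d"
      using tendstoD[OF th d(1)] by (simp add: dist_norm)
    then show "\<forall>\<^sub>F k in sequentially. dist ((1 / t k) *\<^sub>R (P (u + t k *\<^sub>R hs k) - P u) - B (hs k)) 0 < e"
    proof eventually_elim
      case (elim k)
      have "(1 / t k) *\<^sub>R (P (u + t k *\<^sub>R hs k) - P u) - B (hs k)
          = (1 / t k) *\<^sub>R (P (u + t k *\<^sub>R hs k) - P u - B (t k *\<^sub>R hs k))"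
        using t(1)[of k] by (simp add: B.scaleR scaleR_diff_right)
      also have "norm \<dots> = (1 / t k) * norm (P (u + t k *\<^sub>R hs k) - P u - B (t k *\<^sub>R hs k))"
        using t(1)[of k] by simp
      also have "\<dots> \<le> (1 / t k) * (e' * norm (t k *\<^sub>R hs k))"
        using d(2)[of "u + t k *\<^sub>R hs k"] elim t(1)[of k] by (intro mult_left_mono) auto
      also have "\<dots> = e' * norm (hs k)" using t(1)[of k] by simp
      also have "\<dots> \<le> e' * H" using H e' by (intro mult_left_mono) auto
      also have "\<dots> < e" using e H by (simp add: e'_def)
      finally show ?case by simp
    qed
  qed
  from tendsto_add[OF this B.tendsto[OF h]] show ?thesis by simp
qed

text \<open>Averaging over a small ball makes the exceptional null set harmless: telescoping along the
  segment bounds the averaged increment by integrals of positive parts of difference quotients,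
  which tend to zero by dominated convergence.\<close>

theorem lipschitz_increment_le_of_AE_derivative_le:
  fixes f :: "'a::euclidean_space \<Rightarrow> real"
  assumes lip: "L-lipschitz_on UNIV f"
    and der: "AE z in lborel. z \<in> ball x0 R \<longrightarrow> (\<exists>f'. (f has_derivative f') (at z) \<and> f' h \<le> c)"
    and x: "x \<in> ball x0 R" "x + h \<in> ball x0 R"
  shows "f (x + h) - f x \<le> c"
proof (rule ccontr)
  assume neg: "\<not> ?thesis"
  define \<eta> where "\<eta> = (f (x + h) - f x - c) / 2"
  have \<eta>: "\<eta> > 0" using neg by (simp add: \<eta>_def)
  have contf: "continuous_on S f" for S
    using lipschitz_on_continuous_on[OF lip] continuous_on_subset by blast
  have [measurable]: "f \<in> borel_measurable borel"
    using contf by (auto intro: borel_measurable_continuous_onI)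
  have L0: "L \<ge> 0" using lip by (simp add: lipschitz_on_def)
  \<comment> \<open>The violation at \<open>x\<close> exceeds \<open>c\<close> by twice the margin
    \<open>\<eta>\<close>, so it persists with margin \<open>\<eta>\<close> on an open set, which
    has positive measure.\<close>
  define U where "U = {y. f (y + h) - f y - c > \<eta>} \<inter> ball x0 R \<inter> {y. y + h \<in> ball x0 R}"
  have "open U"
  proof -
    have "open {y. f (y + h) - f y - c > \<eta>}"
      by (intro open_Collect_less continuous_intros continuous_on_compose2[OF contf[of UNIV]]) auto
    moreover have "open {y. dist x0 (y + h) < R}"
      by (intro open_Collect_less continuous_intros)
    ultimately show ?thesis by (auto simp: U_def)
  qed
  moreover have "x \<in> U" using x \<eta> by (auto simp: U_def \<eta>_def)
  ultimately obtain e where e: "e > 0" "ball x e \<subseteq> U" using open_contains_ball by blast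
  define B where "B = ball x e"
  define G where "G N z = real (Suc N) * (f (z + (1 / Suc N) *\<^sub>R h) - f z)" for N z
  define w where "w N z = indicator (ball x0 R) z * max 0 (G N z - c)" for N z
  have Gb: "\<bar>G N z\<bar> \<le> L * norm h" for N z
    unfolding G_def by (rule abs_difference_quotient_le[OF lip])
  have [measurable]: "ball x0 R \<in> sets borel" by simp
  have [measurable]: "w N \<in> borel_measurable borel" for N
    unfolding w_def[abs_def] G_def[abs_def] by measurable
  have w0: "w N z \<ge> 0" for N z by (simp add: w_def)
  have finR: "emeasure lborel (ball x0 R) < \<infinity>" by (rule emeasure_bounded_finite) simp
  let ?d = "\<lambda>z. (L * norm h + \<bar>c\<bar>) * indicat_real (ball x0 R) z"
  have di: "integrable lborel ?d"
    using finR by (intro integrable_mult_right integrable_real_indicator) auto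
  have wb: "norm (w N z) \<le> ?d z" for N z
  proof -
    have "max 0 (G N z - c) \<le> L * norm h + \<bar>c\<bar>"
      using Gb[of N z] L0 by (auto simp: max_def)
    then show ?thesis by (simp add: w_def indicator_def)
  qed
  have "norm (w N z) \<le> norm (?d z)" for N z
    using wb[of N z] by (rule order.trans) (simp only: real_norm_def abs_ge_self)
  then have wi: "integrable lborel (w N)" for N
    by (intro Bochner_Integration.integrable_bound[OF di] AE_I2) measurable
  have lim: "(\<lambda>N. \<integral>z. w N z \<partial>lborel) \<longlonglongrightarrow> (\<integral>z. 0 \<partial>(lborel :: 'a measure))"
  proof (rule integral_dominated_convergence[OF _ _ di])
    show "AE z in lborel. (\<lambda>N. w N z) \<longlonglongrightarrow> 0"
      using der
    proof eventually_elim
      case (elim z)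
      show ?case
      proof (cases "z \<in> ball x0 R")
        case True
        then obtain f' where f': "(f has_derivative f') (at z)" "f' h \<le> c" using elim by blast
        have "(\<lambda>n. (1 / (1 / real (Suc n))) *\<^sub>R (f (z + (1 / real (Suc n)) *\<^sub>R h) - f z)) \<longlonglongrightarrow> f' h"
          using LIMSEQ_inverse_real_of_nat
          by (intro derivative_quotient_tendsto[OF f'(1)]) (auto simp: inverse_eq_divide)
        then have "(\<lambda>n. G n z) \<longlonglongrightarrow> f' h" by (simp add: G_def)
        then have "(\<lambda>n. w n z) \<longlonglongrightarrow> indicator (ball x0 R) z * max 0 (f' h - c)"
          unfolding w_def by (intro tendsto_intros)
        moreover have "max 0 (f' h - c) = 0" using f'(2) by simp
        ultimately show ?thesis by simp
      qed (simp add: w_def)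
    qed
    show "AE z in lborel. norm (w N z) \<le> ?d z" for N using wb by simp
  qed auto
  have key: "\<eta> * measure lborel B \<le> (\<integral>z. w N z \<partial>lborel)" for N
  proof -
    let ?n = "Suc N"
    have trans: "integrable lborel (\<lambda>y. w N (y + (real k / ?n) *\<^sub>R h)) \<and>
        (\<integral>y. w N (y + (real k / ?n) *\<^sub>R h) \<partial>lborel) = (\<integral>z. w N z \<partial>lborel)" for k
      by (intro conjI integrable_lborel_translate[OF wi] integral_lborel_translate) measurable
    have pw: "indicator B y * \<eta> \<le> (1 / ?n) * (\<Sum>k<?n. w N (y + (real k / ?n) *\<^sub>R h))" for y
    proof (cases "y \<in> B")
      case True
      then have yU: "f (y + h) - f y - c > \<eta>" "y \<in> ball x0 R" "y + h \<in> ball x0 R"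
        using e(2) by (auto simp: B_def U_def)
      have "G N (y + (real k / ?n) *\<^sub>R h) - c \<le> w N (y + (real k / ?n) *\<^sub>R h)" if "k < ?n" for k
      proof -
        have "(1 - real k / ?n) *\<^sub>R y + (real k / ?n) *\<^sub>R (y + h) \<in> ball x0 R"
          by (rule convexD[OF convex_ball yU(2,3)]) (use that in auto)
        then have "y + (real k / ?n) *\<^sub>R h \<in> ball x0 R" by (simp add: algebra_simps)
        then show ?thesis by (simp add: w_def)
      qed
      then have "(\<Sum>k<?n. G N (y + (real k / ?n) *\<^sub>R h) - c) \<le> (\<Sum>k<?n. w N (y + (real k / ?n) *\<^sub>R h))"
        by (intro sum_mono) auto
      moreover have "(\<Sum>k<?n. G N (y + (real k / ?n) *\<^sub>R h) - c) = ?n * (f (y + h) - f y - c)"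
      proof -
        have "G N (y + (real k / ?n) *\<^sub>R h)
            = ?n * (f (y + (real (Suc k) / ?n) *\<^sub>R h) - f (y + (real k / ?n) *\<^sub>R h))" for k
          by (simp add: G_def add.assoc scaleR_add_left[symmetric] add_divide_distrib[symmetric] del: scaleR_add_left)
             (simp add: add.commute)
        then have "(\<Sum>k<?n. G N (y + (real k / ?n) *\<^sub>R h))
            = ?n * (\<Sum>k<?n. f (y + (real (Suc k) / ?n) *\<^sub>R h) - f (y + (real k / ?n) *\<^sub>R h))"
          by (simp only: sum_distrib_left)
        also have "(\<Sum>k<?n. f (y + (real (Suc k) / ?n) *\<^sub>R h) - f (y + (real k / ?n) *\<^sub>R h)) = f (y + h) - f y"
          by (subst sum_lessThan_telescope) simp
        finally show ?thesis by (simp only: sum_subtractf) (simp add: algebra_simps)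
      qed
      ultimately have "?n * \<eta> \<le> (\<Sum>k<?n. w N (y + (real k / ?n) *\<^sub>R h))"
        using yU(1) by (smt (verit) mult_left_mono of_nat_0_le_iff)
      then show ?thesis using True by (simp add: field_simps del: of_nat_Suc sum.lessThan_Suc)
    next
      case False
      then show ?thesis using w0 by (simp add: sum_nonneg del: sum.lessThan_Suc)
    qed
    have finB: "emeasure lborel B < \<infinity>" unfolding B_def by (rule emeasure_bounded_finite) simp
    have "(\<integral>y. indicator B y * \<eta> \<partial>lborel) \<le> (\<integral>y. (1 / ?n) * (\<Sum>k<?n. w N (y + (real k / ?n) *\<^sub>R h)) \<partial>lborel)"
    proof (rule integral_mono[OF _ _ pw])
      show "integrable lborel (\<lambda>y. indicat_real B y * \<eta>)"
        using finB by (intro integrable_mult_left integrable_real_indicator) (auto simp: B_def)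
      show "integrable lborel (\<lambda>y. (1 / ?n) * (\<Sum>k<?n. w N (y + (real k / ?n) *\<^sub>R h)))"
        using trans by (intro integrable_mult_right Bochner_Integration.integrable_sum) blast
    qed
    also have "\<dots> = (1 / ?n) * (\<Sum>k<?n. \<integral>y. w N (y + (real k / ?n) *\<^sub>R h) \<partial>lborel)"
      using trans by (simp del: sum.lessThan_Suc of_nat_Suc)
    also have "\<dots> = (\<integral>z. w N z \<partial>lborel)"
      using trans by (simp del: sum.lessThan_Suc of_nat_Suc)
    finally show ?thesis using finB by (simp add: mult.commute B_def)
  qed
  have "\<eta> * measure lborel B \<le> 0"
    using lim key by (intro LIMSEQ_le_const) auto
  moreover have "measure lborel B > 0" unfolding B_def using content_ball_pos[OF e(1)] by simp
  ultimately show False using \<eta> by (simp add: mult_le_0_iff)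
qed

text \<open>The scalar inequality is applied to the component along the increment
  \<open>w = f y - f x\<close> itself, which gives
  \<open>norm w * norm w \<le> c * norm h * norm w\<close>. The hypothesis speaks only of points
  where a derivative exists; Rademacher's theorem says that these are almost all.\<close>

lemma lipschitz_norm_diff_le_of_derivative:
  fixes f :: "'a::euclidean_space \<Rightarrow> 'b::euclidean_space"
  assumes lip: "L-lipschitz_on UNIV f"
    and der: "\<And>z f' h. z \<in> ball x0 R \<Longrightarrow> (f has_derivative f') (at z) \<Longrightarrow> norm (f' h) \<le> c * norm h"
    and c: "0 \<le> c" and xy: "x \<in> ball x0 R" "y \<in> ball x0 R"
  shows "norm (f y - f x) \<le> c * norm (y - x)"
proof -
  define w where "w = f y - f x"
  define h where "h = y - x"
  have "(L * norm w)-lipschitz_on UNIV (\<lambda>z. f z \<bullet> w)" by (rule lipschitz_on_inner_left[OF lip])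
  moreover have "AE z in lborel. z \<in> ball x0 R \<longrightarrow>
      (\<exists>f'. ((\<lambda>z. f z \<bullet> w) has_derivative f') (at z) \<and> f' h \<le> c * norm h * norm w)"
    using lipschitz_AE_differentiable[OF lip]
  proof eventually_elim
    case (elim z)
    then obtain f' where f': "(f has_derivative f') (at z)" by (auto simp: differentiable_def)
    show ?case
    proof
      assume z: "z \<in> ball x0 R"
      have "f' h \<bullet> w \<le> norm (f' h) * norm w" by (rule norm_cauchy_schwarz)
      also have "\<dots> \<le> c * norm h * norm w" using der[OF z f'] by (intro mult_right_mono) auto
      finally show "\<exists>f'. ((\<lambda>z. f z \<bullet> w) has_derivative f') (at z) \<and> f' h \<le> c * norm h * norm w"
        using has_derivative_inner_left[OF f', of w] by blast
    qed
  qed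
  ultimately have "f (x + h) \<bullet> w - f x \<bullet> w \<le> c * norm h * norm w"
    by (rule lipschitz_increment_le_of_AE_derivative_le) (use xy in \<open>auto simp: h_def\<close>)
  then have "norm w * norm w \<le> c * norm h * norm w"
    by (simp add: h_def w_def inner_diff_left[symmetric] power2_norm_eq_inner[symmetric] power2_eq_square[symmetric])
  then show ?thesis
    by (cases "w = 0") (use c in \<open>auto simp: w_def h_def\<close>)
qed

text \<open>The component along \<open>- h\<close> turns the required lower bound into the upper
  bound of the scalar inequality.\<close>

lemma lipschitz_strongly_monotone_of_derivative:
  fixes f :: "'a::euclidean_space \<Rightarrow> 'a"
  assumes lip: "L-lipschitz_on UNIV f"
    and der: "\<And>z f' h. z \<in> ball x0 R \<Longrightarrow> (f has_derivative f') (at z) \<Longrightarrow> f' h \<bullet> h \<ge> c * (norm h)\<^sup>2"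
    and xy: "x \<in> ball x0 R" "y \<in> ball x0 R"
  shows "(f y - f x) \<bullet> (y - x) \<ge> c * (norm (y - x))\<^sup>2"
proof -
  define h where "h = y - x"
  have "(L * norm (- h))-lipschitz_on UNIV (\<lambda>z. f z \<bullet> - h)" by (rule lipschitz_on_inner_left[OF lip])
  moreover have "AE z in lborel. z \<in> ball x0 R \<longrightarrow>
      (\<exists>f'. ((\<lambda>z. f z \<bullet> - h) has_derivative f') (at z) \<and> f' h \<le> - (c * (norm h)\<^sup>2))"
    using lipschitz_AE_differentiable[OF lip]
  proof eventually_elim
    case (elim z)
    then obtain f' where f': "(f has_derivative f') (at z)" by (auto simp: differentiable_def)
    show ?case using has_derivative_inner_left[OF f', of "- h"] der[OF _ f', of h] by force
  qed
  ultimately have "f (x + h) \<bullet> - h - f x \<bullet> - h \<le> - (c * (norm h)\<^sup>2)"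
    by (rule lipschitz_increment_le_of_AE_derivative_le) (use xy in \<open>auto simp: h_def\<close>)
  then show ?thesis by (simp add: h_def inner_diff_left inner_diff_right)
qed

section \<open>Subspaces\<close>

lemma orth_proj_eqI:
  assumes "subspace L" "p \<in> L" "z - p \<in> L\<^sup>\<bottom>"
  shows "orth_proj L z = p"
  unfolding orth_proj_def
proof (rule the_equality)
  fix p' assume p': "p' \<in> L \<and> z - p' \<in> L\<^sup>\<bottom>"
  have "p - p' \<in> L" using assms p' by (auto intro: subspace_diff)
  moreover have "p - p' \<in> L\<^sup>\<bottom>"
    using subspace_diff[OF subspace_orthogonal_comp, of "z - p'" L "z - p"] assms p' by simp
  ultimately show "p' = p" by (auto simp: orthogonal_comp_def orthogonal_def)
qed (use assms in simp)

lemma orth_proj: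
  assumes "subspace L"
  shows "orth_proj L z \<in> L" "z - orth_proj L z \<in> L\<^sup>\<bottom>"
proof -
  obtain y w where "y \<in> span L" "\<And>v. v \<in> span L \<Longrightarrow> orthogonal w v" "z = y + w"
    by (rule orthogonal_subspace_decomp_exists) blast
  then have "y \<in> L" "z - y \<in> L\<^sup>\<bottom>"
    using assms by (auto simp: orthogonal_comp_def orthogonal_commute span_eq_iff[THEN iffD2])
  with orth_proj_eqI[OF assms this] show "orth_proj L z \<in> L" "z - orth_proj L z \<in> L\<^sup>\<bottom>" by auto
qed

lemma orth_proj_id:
  assumes "subspace L" "z \<in> L"
  shows "orth_proj L z = z"
  using assms by (intro orth_proj_eqI) (auto simp: subspace_0[OF subspace_orthogonal_comp])

lemma linear_orth_proj:
  assumes L: "subspace L"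
  shows "linear (orth_proj L)"
proof (rule linearI)
  note S = subspace_orthogonal_comp[of L]
  show "orth_proj L (x + y) = orth_proj L x + orth_proj L y" for x y
    by (rule orth_proj_eqI[OF L])
       (use orth_proj[OF L] subspace_add[OF L] subspace_add[OF S, of "x - orth_proj L x" "y - orth_proj L y"]
         in \<open>auto simp: algebra_simps\<close>)
  show "orth_proj L (c *\<^sub>R x) = c *\<^sub>R orth_proj L x" for c x
    by (rule orth_proj_eqI[OF L])
       (use orth_proj[OF L] subspace_mul[OF L] subspace_mul[OF S, of "x - orth_proj L x" c]
         in \<open>auto simp: algebra_simps\<close>)
qed

lemma orth_proj_inner_diff:
  assumes "subspace L" "y \<in> L"
  shows "y \<bullet> (z - orth_proj L z) = 0"
  using orth_proj(2)[OF assms(1), of z] assms(2) unfolding orthogonal_comp_def orthogonal_def by blast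

lemma norm_orth_proj_le:
  assumes L: "subspace L"
  shows "norm (orth_proj L z) \<le> norm z" "norm (z - orth_proj L z) \<le> norm z"
proof -
  let ?p = "orth_proj L z"
  have "orthogonal ?p (z - ?p)"
    unfolding orthogonal_def by (rule orth_proj_inner_diff[OF L orth_proj(1)[OF L]])
  from norm_add_Pythagorean[OF this] have eq: "(norm z)\<^sup>2 = (norm ?p)\<^sup>2 + (norm (z - ?p))\<^sup>2" by simp
  show "norm ?p \<le> norm z" by (rule power2_le_imp_le) (use eq in auto)
  show "norm (z - ?p) \<le> norm z" by (rule power2_le_imp_le) (use eq in auto)
qed

lemma norm_diff_orth_proj_le:
  assumes L: "subspace L" and y: "y \<in> L"
  shows "norm (z - orth_proj L z) \<le> norm (z - y)"
proof -
  let ?p = "orth_proj L z"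
  have "?p - y \<in> L" using orth_proj(1)[OF L] y L by (auto intro: subspace_diff)
  then have "orthogonal (?p - y) (z - ?p)" unfolding orthogonal_def by (rule orth_proj_inner_diff[OF L])
  from norm_add_Pythagorean[OF this]
  have eq: "(norm (z - y))\<^sup>2 = (norm (?p - y))\<^sup>2 + (norm (z - ?p))\<^sup>2" by simp
  show ?thesis by (rule power2_le_imp_le) (use eq in auto)
qed

lemma bounded_linear_orth_proj_diff:
  fixes L1 L2 :: "'a::euclidean_space set"
  assumes "subspace L1" "subspace L2"
  shows "bounded_linear (\<lambda>z. orth_proj L1 z - orth_proj L2 z)"
  using linear_orth_proj assms by (auto simp: linear_conv_bounded_linear intro: bounded_linear_sub)

lemma norm_orth_proj_diff_le:
  assumes "subspace L1" "subspace L2"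
  shows "norm (orth_proj L1 z - orth_proj L2 z) \<le> subspace_dist L1 L2 * norm z"
  unfolding subspace_dist_def by (rule onorm[OF bounded_linear_orth_proj_diff[OF assms]])

lemma subspace_dist_nonneg:
  assumes "subspace L1" "subspace L2"
  shows "0 \<le> subspace_dist L1 L2"
  unfolding subspace_dist_def by (rule onorm_pos_le[OF bounded_linear_orth_proj_diff[OF assms]])

text \<open>With \<open>P1\<close>, \<open>P2\<close> the projections, \<open>P1 z - P2 z\<close>
  equals \<open>(I - P2) P1 z\<close> minus \<open>P2 (I - P1) z\<close>. The first term is bounded
  by the approximation of \<open>L1\<close> by \<open>L2\<close>; the second operator is the adjoint
  of \<open>(I - P1) P2\<close>, hence bounded by the approximation of \<open>L2\<close> by
  \<open>L1\<close>.\<close>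

lemma subspace_dist_le:
  fixes L1 L2 :: "'a::euclidean_space set"
  assumes L: "subspace L1" "subspace L2" and \<eta>: "0 \<le> \<eta>"
    and 12: "\<And>z. z \<in> L1 \<Longrightarrow> \<exists>y\<in>L2. norm (z - y) \<le> \<eta> * norm z"
    and 21: "\<And>z. z \<in> L2 \<Longrightarrow> \<exists>y\<in>L1. norm (z - y) \<le> \<eta> * norm z"
  shows "subspace_dist L1 L2 \<le> 2 * \<eta>"
  unfolding subspace_dist_def
proof (rule onorm_le)
  fix z
  let ?P1 = "orth_proj L1" and ?P2 = "orth_proj L2"
  define u where "u = z - ?P1 z"
  define v where "v = ?P2 u"
  have 1: "norm (?P1 z - ?P2 (?P1 z)) \<le> \<eta> * norm z"
  proof -
    obtain y where "y \<in> L2" "norm (?P1 z - y) \<le> \<eta> * norm (?P1 z)" using 12 orth_proj(1)[OF L(1)] by blast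
    then have "norm (?P1 z - ?P2 (?P1 z)) \<le> \<eta> * norm (?P1 z)"
      using norm_diff_orth_proj_le[OF L(2)] order_trans by blast
    also have "\<dots> \<le> \<eta> * norm z" using norm_orth_proj_le(1)[OF L(1)] \<eta> by (intro mult_left_mono) auto
    finally show ?thesis .
  qed
  have 2: "norm v \<le> \<eta> * norm z"
  proof -
    have vL: "v \<in> L2" unfolding v_def by (rule orth_proj(1)[OF L(2)])
    obtain y where "y \<in> L1" "norm (v - y) \<le> \<eta> * norm v" using 21 vL by blast
    then have vy: "norm (v - ?P1 v) \<le> \<eta> * norm v" using norm_diff_orth_proj_le[OF L(1)] order_trans by blast
    have "v \<bullet> (u - v) = 0" unfolding v_def by (rule orth_proj_inner_diff[OF L(2) orth_proj(1)[OF L(2)]])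
    moreover have "?P1 v \<bullet> u = 0" unfolding u_def by (rule orth_proj_inner_diff[OF L(1) orth_proj(1)[OF L(1)]])
    ultimately have "norm v * norm v = (v - ?P1 v) \<bullet> u"
      by (simp add: inner_diff_right inner_diff_left dot_square_norm power2_eq_square)
    also have "\<dots> \<le> norm (v - ?P1 v) * norm u" by (rule norm_cauchy_schwarz)
    also have "\<dots> \<le> (\<eta> * norm v) * norm z"
      using vy norm_orth_proj_le(2)[OF L(1), of z] \<eta> by (intro mult_mono) (auto simp: u_def)
    finally show ?thesis by (cases "v = 0") (use \<eta> in \<open>auto simp: mult_ac\<close>)
  qed
  have eq: "?P1 z - ?P2 z = (?P1 z - ?P2 (?P1 z)) - v"
    using linear_diff[OF linear_orth_proj[OF L(2)], of z "?P1 z"] by (simp add: v_def u_def)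
  show "norm (?P1 z - ?P2 z) \<le> 2 * \<eta> * norm z"
    unfolding eq using 1 2 norm_triangle_ineq4[of "?P1 z - ?P2 (?P1 z)" v] by simp
qed

text \<open>Supplies, for an element of the limit space, approximating elements of the spaces
  \<open>T k\<close>, so that closed conditions valid on \<open>T k\<close> pass to
  \<open>L\<close>.\<close>

lemma tendsto_orth_proj_of_subspace_dist:
  assumes L: "subspace L" "\<And>k. subspace (T k)" and w: "w \<in> L"
    and lim: "(\<lambda>k. subspace_dist L (T k)) \<longlonglongrightarrow> 0"
  shows "(\<lambda>k::nat. orth_proj (T k) w) \<longlonglongrightarrow> w"
proof -
  have "(\<lambda>k. orth_proj (T k) w - w) \<longlonglongrightarrow> 0"
  proof (rule Lim_null_comparison)
    show "(\<lambda>k. subspace_dist L (T k) * norm w) \<longlonglongrightarrow> 0" using tendsto_mult_right[OF lim, of "norm w"] by simp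
    show "\<forall>\<^sub>F k in sequentially. norm (orth_proj (T k) w - w) \<le> subspace_dist L (T k) * norm w"
      using norm_orth_proj_diff_le[OF L(1) L(2), of w] orth_proj_id[OF L(1) w]
      by (simp add: norm_minus_commute)
  qed
  then show ?thesis by (rule LIM_zero_cancel)
qed

section \<open>Adjoint subspaces and their matrices\<close>

lemma adj_subspace_altdef: "adj_subspace L = (\<lambda>(u, v). (- v, u)) ` (L\<^sup>\<bottom>)"
  by (auto simp: adj_subspace_def image_iff split: prod.splits)

lemma linear_rotate: "linear (\<lambda>(u, v). (- v :: 'a::real_vector, u :: 'b::real_vector))"
  by (rule linearI) auto

lemma inner_adj_subspace_zero:
  "(a, b) \<in> adj_subspace L \<Longrightarrow> (u, v) \<in> L \<Longrightarrow> u \<bullet> b = v \<bullet> a"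
  by (auto simp: adj_subspace_def orthogonal_comp_def orthogonal_def)

lemma subspace_adj_subspace: "subspace (adj_subspace L)"
  unfolding adj_subspace_altdef
  by (intro linear_subspace_image linear_rotate subspace_orthogonal_comp)

lemma adj_subspace_Zn:
  assumes "L \<in> Zn"
  shows "adj_subspace L \<in> Zn"
proof -
  have "dim (L\<^sup>\<bottom>) + dim L = 2 * CARD('a)"
    using dim_subspace_orthogonal_to_vectors[of L UNIV] assms by (simp add: Zn_def orthogonal_comp_def)
  then have "dim (L\<^sup>\<bottom>) = CARD('a)" using assms by (simp add: Zn_def)
  moreover have "dim (adj_subspace L) = dim (L\<^sup>\<bottom>)"
    unfolding adj_subspace_altdef by (rule dim_image_eq[OF linear_rotate]) (auto simp: inj_on_def)
  ultimately show ?thesis by (simp add: Zn_def subspace_adj_subspace)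
qed

text \<open>The adjoint is the image of the orthogonal complement under the isometry
  \<open>J\<close> sending \<open>(u, v)\<close> to \<open>(- v, u)\<close>. Its projection is
  therefore \<open>I - P\<close> conjugated by \<open>J\<close>, where \<open>P\<close> is
  \<open>orth_proj L\<close>, and the inverse of \<open>J\<close> sends \<open>(a, b)\<close> to
  \<open>(b, - a)\<close>.\<close>

lemma orth_proj_adj_subspace:
  assumes L: "subspace L"
  shows "orth_proj (adj_subspace L) (a, b)
    = (a, b) - (- snd (orth_proj L (b, - a)), fst (orth_proj L (b, - a)))"
proof (rule orth_proj_eqI[OF subspace_adj_subspace])
  let ?p = "orth_proj L (b, - a)"
  have "(b, - a) - ?p \<in> L\<^sup>\<bottom>" by (rule orth_proj(2)[OF L])
  then have "(\<lambda>(u, v). (- v, u)) ((b, - a) - ?p) \<in> adj_subspace L"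
    unfolding adj_subspace_altdef by (rule imageI)
  then show "(a, b) - (- snd ?p, fst ?p) \<in> adj_subspace L" by (cases ?p) (simp add: add.commute)
  have pL: "(fst ?p, snd ?p) \<in> L" using orth_proj(1)[OF L] by simp
  show "(a, b) - ((a, b) - (- snd ?p, fst ?p)) \<in> (adj_subspace L)\<^sup>\<bottom>"
    using inner_adj_subspace_zero[OF _ pL]
    by (auto simp: orthogonal_comp_def orthogonal_def inner_commute)
qed

lemma subspace_dist_adj_subspace_le:
  assumes L: "subspace L1" "subspace L2"
  shows "subspace_dist (adj_subspace L1) (adj_subspace L2) \<le> subspace_dist L1 L2"
  unfolding subspace_dist_def[of "adj_subspace L1"]
proof (rule onorm_le)
  fix z :: "(real, 'a) vec \<times> (real, 'a) vec"
  obtain a b where z: "z = (a, b)" by (cases z)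
  let ?d = "orth_proj L1 (b, - a) - orth_proj L2 (b, - a)"
  have "norm (orth_proj (adj_subspace L1) z - orth_proj (adj_subspace L2) z) = norm (snd ?d, - fst ?d)"
    unfolding z orth_proj_adj_subspace[OF L(1)] orth_proj_adj_subspace[OF L(2)] by (simp add: norm_prod_def norm_minus_commute)
  also have "\<dots> = norm ?d" by (simp add: norm_prod_def norm_minus_commute add.commute)
  also have "\<dots> \<le> subspace_dist L1 L2 * norm (b, - a)" by (rule norm_orth_proj_diff_le[OF L])
  also have "norm (b, - a) = norm z" by (simp add: z norm_prod_def add.commute)
  finally show "norm (orth_proj (adj_subspace L1) z - orth_proj (adj_subspace L2) z)
    \<le> subspace_dist L1 L2 * norm z" .
qed

text \<open>Regularity says that \<open>snd\<close> is injective on \<open>L\<close>, and the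
  dimension makes it onto. The matrix is \<open>fst\<close> composed with the inverse of
  \<open>snd\<close>.\<close>

lemma Zn_reg_C_mat:
  fixes L :: "((real^'n) \<times> (real^'n)) set"
  assumes L: "L \<in> Zn_reg"
  shows "L = range (\<lambda>p. (C_mat L *v p, p))"
proof -
  have sub: "subspace L" and dimL: "dim L = CARD('n)" and reg: "\<And>y. (y, 0) \<in> L \<Longrightarrow> y = 0"
    using L by (auto simp: Zn_reg_def Zn_def)
  have inj: "inj_on snd L"
  proof (rule inj_onI)
    fix z z' assume zz: "z \<in> L" "z' \<in> L" "snd z = snd z'"
    then have "(fst z - fst z', 0) \<in> L" using subspace_diff[OF sub zz(1,2)] by (simp add: minus_prod_def)
    from reg[OF this] show "z = z'" using zz(3) by (simp add: prod_eq_iff)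
  qed
  obtain g where g: "range g \<subseteq> L" "linear g" "\<And>v. v \<in> L \<Longrightarrow> g (snd v) = v"
    using linear_exists_left_inverse_on[OF linear_snd sub inj] by auto
  have "subspace (snd ` L)" by (rule linear_subspace_image[OF linear_snd sub])
  moreover have "dim (snd ` L) = dim L"
    by (rule dim_image_eq[OF linear_snd]) (use inj sub in \<open>simp add: span_eq_iff[THEN iffD2]\<close>)
  ultimately have surj: "snd ` L = UNIV" using dimL
    by (intro subspace_dim_equal) auto
  define C where "C = matrix (fst \<circ> g)"
  have "linear (fst \<circ> g)" by (rule linear_compose[OF g(2) linear_fst])
  then have Cg: "C *v p = fst (g p)" for p unfolding C_def by (simp add: matrix_works)
  have gp: "g p = (C *v p, p)" for p
  proof -
    obtain v where "v \<in> L" "snd v = p" using surj by (metis UNIV_I imageE)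
    then show ?thesis using g(3)[of v] Cg[of p] by (metis prod.collapse)
  qed
  have LC: "L = range (\<lambda>p. (C *v p, p))" using g(1,3) gp by (auto simp: image_iff)
  have "C_mat L = C" unfolding C_mat_def
  proof (rule the_equality)
    show "L = range (\<lambda>p. (C *v p, p))" by (rule LC)
    fix C' assume C': "L = range (\<lambda>p. (C' *v p, p))"
    have "C' *v p = C *v p" for p
    proof -
      have "(C' *v p, p) \<in> range (\<lambda>p. (C *v p, p))" using C' LC by auto
      then show ?thesis by auto
    qed
    then show "C' = C" by (simp add: matrix_eq)
  qed
  then show ?thesis using LC by simp
qed

text \<open>A regular adjoint contains an element with second component \<open>y\<close>; paired
  with \<open>(y, 0)\<close> from \<open>L\<close> it yields
  \<open>y \<bullet> y = 0\<close>.\<close>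

lemma Zn_reg_if_adj_Zn_reg:
  fixes L :: "((real^'n) \<times> (real^'n)) set"
  assumes L: "L \<in> Zn" and reg: "adj_subspace L \<in> Zn_reg"
  shows "L \<in> Zn_reg"
proof -
  have "y = 0" if y: "(y, 0) \<in> L" for y
  proof -
    have "(C_mat (adj_subspace L) *v y, y) \<in> adj_subspace L" using Zn_reg_C_mat[OF reg] by auto
    from inner_adj_subspace_zero[OF this y] show ?thesis by simp
  qed
  then show ?thesis using L by (auto simp: Zn_reg_def)
qed

lemma inner_matrix_vector_mult_transpose:
  fixes C :: "real^'n^'n"
  shows "(C *v p) \<bullet> u = p \<bullet> (transpose C *v u)"
  unfolding transpose_matrix_vector using dot_lmul_matrix[of u C p] inner_commute by metis

text \<open>The sign in \<open>adj_subspace\<close> is the one that turns passing to the adjoint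
  into transposition.\<close>

lemma adj_subspace_range_matrix:
  fixes C :: "real^'n^'n"
  shows "adj_subspace (range (\<lambda>p. (C *v p, p))) = range (\<lambda>p. (transpose C *v p, p))"
proof -
  have orth: "(u, v) \<in> (range (\<lambda>p. (C *v p, p)))\<^sup>\<bottom> \<longleftrightarrow> v = - (transpose C *v u)" for u v
  proof -
    have "(u, v) \<in> (range (\<lambda>p. (C *v p, p)))\<^sup>\<bottom> \<longleftrightarrow> (\<forall>p. p \<bullet> (transpose C *v u + v) = 0)"
      by (simp add: orthogonal_comp_def orthogonal_def inner_add_right inner_matrix_vector_mult_transpose)
    also have "\<dots> \<longleftrightarrow> transpose C *v u + v = 0"
      using inner_eq_zero_iff[of "transpose C *v u + v"] inner_zero_right by metis
    finally show ?thesis by (simp add: add_eq_0_iff)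
  qed
  show ?thesis unfolding adj_subspace_def by (auto simp: orth)
qed

section \<open>Locally Lipschitz graphs\<close>

lemma LIMSEQ_of_dist_less_inverse:
  assumes "\<And>k. dist l (X k) < inverse (real (Suc k))"
  shows "X \<longlonglongrightarrow> l"
proof (rule tendsto_dist_iff[THEN iffD2], rule Lim_null_comparison[OF _ LIMSEQ_inverse_real_of_nat])
  show "\<forall>\<^sub>F k in sequentially. norm (dist (X k) l) \<le> inverse (real (Suc k))"
    using less_imp_le[OF assms] by (intro always_eventually allI) (simp add: dist_commute del: of_nat_Suc)
qed

lemma lipschitz_norm_derivative_le:
  fixes P :: "'a::real_normed_vector \<Rightarrow> 'b::real_normed_vector"
  assumes lip: "K-lipschitz_on UNIV P" and der: "(P has_derivative B) (at u)"
  shows "norm (B h) \<le> K * norm h"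
proof -
  have "(\<lambda>k. (1 / (1 / real (Suc k))) *\<^sub>R (P (u + (1 / real (Suc k)) *\<^sub>R h) - P u)) \<longlonglongrightarrow> B h"
    using LIMSEQ_inverse_real_of_nat
    by (intro derivative_quotient_tendsto[OF der]) (auto simp: inverse_eq_divide)
  then have "(\<lambda>k. norm ((1 / (1 / real (Suc k))) *\<^sub>R (P (u + (1 / real (Suc k)) *\<^sub>R h) - P u))) \<longlonglongrightarrow> norm (B h)"
    by (rule tendsto_norm)
  then show ?thesis
  proof (rule LIMSEQ_le_const2, intro exI allI impI)
    fix k
    have "norm (P (u + (1 / real (Suc k)) *\<^sub>R h) - P u) \<le> K * norm h / real (Suc k)"
      using lipschitz_onD[OF lip, of "u + (1 / real (Suc k)) *\<^sub>R h" u] by (simp add: dist_norm)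
    then show "norm ((1 / (1 / real (Suc k))) *\<^sub>R (P (u + (1 / real (Suc k)) *\<^sub>R h) - P u)) \<le> K * norm h"
      by (simp add: pos_le_divide_eq mult.commute del: of_nat_Suc scaleR_diff_right)
  qed
qed

text \<open>The range of the derivative of the map \<open>u\<close> to
  \<open>(P u, u - r *\<^sub>R P u)\<close> when \<open>B\<close> is the derivative of
  \<open>P\<close>: a graph of \<open>B\<close> sheared by \<open>r\<close>.\<close>

definition shifted_graph :: "real \<Rightarrow> (real^'n \<Rightarrow> real^'n) \<Rightarrow> ((real^'n) \<times> (real^'n)) set" where
  "shifted_graph r B = range (\<lambda>h. (B h, h - r *\<^sub>R B h))"

lemma shifted_graph_in_Zn:
  fixes B :: "real^'n \<Rightarrow> real^'n"
  assumes B: "linear B"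
  shows "shifted_graph r B \<in> Zn"
proof -
  have lin: "linear (\<lambda>h. (B h, h - r *\<^sub>R B h))"
    using linear_add[OF B] linear_cmul[OF B] by (intro linearI) (auto simp: algebra_simps)
  have "inj (\<lambda>h. (B h, h - r *\<^sub>R B h))" by (auto simp: inj_on_def)
  then have "dim (shifted_graph r B) = dim (UNIV :: (real^'n) set)"
    unfolding shifted_graph_def using dim_image_eq[OF lin, of UNIV] by simp
  moreover have "subspace (shifted_graph r B)"
    unfolding shifted_graph_def by (rule linear_subspace_image[OF lin subspace_UNIV])
  ultimately show ?thesis by (simp add: Zn_def)
qed

text \<open>Recovering \<open>h\<close> as \<open>snd z + r *\<^sub>R fst z\<close> costs one factor
  \<open>1 + r\<close>. Replacing \<open>B h\<close> by \<open>B' h\<close> changes both components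
  and costs another. The factor 2 is that of \<open>subspace_dist_le\<close>.\<close>

lemma subspace_dist_shifted_graph_le:
  assumes B: "linear B" "linear B'" and r: "0 \<le> r"
    and diff: "\<And>h. norm (B h - B' h) \<le> b * norm h"
  shows "subspace_dist (shifted_graph r B) (shifted_graph r B') \<le> 2 * ((1 + r)\<^sup>2 * b)"
proof -
  have b: "0 \<le> b"
  proof -
    obtain h :: "real^'a" where "norm h = 1" by (metis norm_axis_1)
    then show ?thesis using order_trans[OF norm_ge_zero diff[of h]] by simp
  qed
  have approx: "\<exists>y\<in>shifted_graph r B2. norm (z - y) \<le> ((1 + r)\<^sup>2 * b) * norm z"
    if z: "z \<in> shifted_graph r B1" and d: "\<And>h. norm (B1 h - B2 h) \<le> b * norm h" for z B1 B2
  proof -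
    obtain h where h: "z = (B1 h, h - r *\<^sub>R B1 h)" using z by (auto simp: shifted_graph_def)
    have "h = snd z + r *\<^sub>R fst z" by (simp add: h)
    then have "norm h \<le> norm (snd z) + r * norm (fst z)"
      using norm_triangle_ineq[of "snd z" "r *\<^sub>R fst z"] r by simp
    also have "\<dots> \<le> norm z + r * norm z"
      using norm_fst_le[of "fst z" "snd z"] norm_snd_le[of "snd z" "fst z"] r
      by (intro add_mono mult_left_mono) auto
    finally have hz: "norm h \<le> (1 + r) * norm z" by (simp add: algebra_simps)
    have "z - (B2 h, h - r *\<^sub>R B2 h) = (B1 h - B2 h, - (r *\<^sub>R (B1 h - B2 h)))"
      by (simp add: h algebra_simps)
    then have "norm (z - (B2 h, h - r *\<^sub>R B2 h)) \<le> norm (B1 h - B2 h) + norm (r *\<^sub>R (B1 h - B2 h))"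
      using norm_Pair_le[of "B1 h - B2 h" "- (r *\<^sub>R (B1 h - B2 h))"] by simp
    also have "\<dots> = (1 + r) * norm (B1 h - B2 h)" using r by (simp add: distrib_right)
    also have "\<dots> \<le> (1 + r) * (b * ((1 + r) * norm z))"
      using d[of h] hz b r by (intro mult_left_mono order_trans[OF d[of h]]) auto
    finally show ?thesis by (intro bexI[of _ "(B2 h, h - r *\<^sub>R B2 h)"])
      (auto simp: shifted_graph_def power2_eq_square mult_ac)
  qed
  show ?thesis
  proof (rule subspace_dist_le)
    show "subspace (shifted_graph r B)" "subspace (shifted_graph r B')"
      using shifted_graph_in_Zn[OF B(1)] shifted_graph_in_Zn[OF B(2)] by (auto simp: Zn_def)
    show "0 \<le> (1 + r)\<^sup>2 * b" using b by simp
    show "\<exists>y\<in>shifted_graph r B'. norm (z - y) \<le> (1 + r)\<^sup>2 * b * norm z" if "z \<in> shifted_graph r B" for z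
      by (rule approx[OF that diff])
    show "\<exists>y\<in>shifted_graph r B. norm (z - y) \<le> (1 + r)\<^sup>2 * b * norm z" if "z \<in> shifted_graph r B'" for z
      by (rule approx[OF that]) (use diff in \<open>simp add: norm_minus_commute\<close>)
  qed
qed

text \<open>The graph of \<open>F\<close> is parametrised only inside a ball, while \<open>P\<close>
  is Lipschitz on the whole space so that Rademacher's theorem and the mean value inequalities apply
  as they stand. Instances are the proximal map, with positive \<open>r\<close>, and the argmin map,
  with \<open>r = 0\<close>.\<close>

locale lipschitz_local_param =
  fixes F :: "real^'n \<Rightarrow> (real^'n) set" and z :: "(real^'n) \<times> (real^'n)"
    and r \<eta> K :: real and P :: "real^'n \<Rightarrow> real^'n"
  assumes eta: "0 < \<eta>" and r: "0 \<le> r" and lip: "K-lipschitz_on UNIV P"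
    and iff: "\<And>x y. (x, y) \<in> ball z \<eta> \<Longrightarrow> y \<in> F x \<longleftrightarrow> P (y + r *\<^sub>R x) = x"
    and base: "z \<in> gph F"
begin

definition pt :: "real^'n \<Rightarrow> (real^'n) \<times> (real^'n)" where
  "pt u = (P u, u - r *\<^sub>R P u)"

definition par :: "(real^'n) \<times> (real^'n) \<Rightarrow> real^'n" where
  "par w = snd w + r *\<^sub>R fst w"

lemma continuous_P: "continuous_on S P"
  using lipschitz_on_continuous_on[OF lip] continuous_on_subset by blast

lemma continuous_pt: "continuous_on S pt"
  unfolding pt_def[abs_def] by (intro continuous_intros continuous_P)

lemma pt_in_gph: "pt u \<in> ball z \<eta> \<Longrightarrow> pt u \<in> gph F"
  unfolding pt_def gph_def by (simp add: iff)

lemma gph_eq_pt: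
  assumes "w \<in> gph F" "w \<in> ball z \<eta>"
  shows "pt (par w) = w"
proof -
  obtain x y where w: "w = (x, y)" by (cases w)
  then have "P (y + r *\<^sub>R x) = x" using iff[of x y] assms by (simp add: gph_def)
  then show ?thesis by (simp add: w pt_def par_def)
qed

lemma pt_par_base: "pt (par z) = z"
  by (rule gph_eq_pt[OF base]) (use eta in simp)

lemma tendsto_pt: "us \<longlonglongrightarrow> u \<Longrightarrow> (\<lambda>k. pt (us k)) \<longlonglongrightarrow> pt u"
  using continuous_on_tendsto_compose[OF continuous_pt[of UNIV]] by auto

text \<open>Near \<open>pt u\<close> graph points are recovered from their parameter, and
  \<open>par\<close> is linear, so the graph point \<open>pt u + t k *\<^sub>R W k\<close> has
  parameter \<open>u + t k *\<^sub>R par (W k)\<close>.\<close>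

lemma tangent_sequence:
  assumes t: "\<And>k. t k > 0" "t \<longlonglongrightarrow> 0" and W: "W \<longlonglongrightarrow> w"
    and mem: "\<And>k::nat. pt u + t k *\<^sub>R W k \<in> gph F" and u: "pt u \<in> ball z \<eta>"
  shows "\<forall>\<^sub>F k in sequentially. P (u + t k *\<^sub>R par (W k)) = P u + t k *\<^sub>R fst (W k)"
proof -
  have "(\<lambda>k. pt u + t k *\<^sub>R W k) \<longlonglongrightarrow> pt u + 0 *\<^sub>R w" by (intro tendsto_intros t W)
  then have "\<forall>\<^sub>F k in sequentially. pt u + t k *\<^sub>R W k \<in> ball z \<eta>"
    using u by (intro topological_tendstoD) auto
  then show ?thesis
  proof eventually_elim
    case (elim k)
    have "par (pt u + t k *\<^sub>R W k) = u + t k *\<^sub>R par (W k)"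
      by (simp add: par_def pt_def algebra_simps)
    with gph_eq_pt[OF mem elim] have "pt (u + t k *\<^sub>R par (W k)) = pt u + t k *\<^sub>R W k" by simp
    then have "fst (pt (u + t k *\<^sub>R par (W k))) = fst (pt u + t k *\<^sub>R W k)" by simp
    then show ?case by (simp add: pt_def)
  qed
qed

lemma tangent_cone_eq:
  assumes der: "(P has_derivative B) (at u)" and u: "pt u \<in> ball z \<eta>"
  shows "tangent_cone (gph F) (pt u) = shifted_graph r B"
proof (intro equalityI subsetI)
  fix w assume "w \<in> tangent_cone (gph F) (pt u)"
  then obtain t W where t: "\<And>k. t k > 0" "t \<longlonglongrightarrow> 0" and W: "W \<longlonglongrightarrow> w"
    and mem: "\<And>k::nat. pt u + t k *\<^sub>R W k \<in> gph F"
    by (auto simp: tangent_cone_def)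
  have "(\<lambda>k. par (W k)) \<longlonglongrightarrow> par w" unfolding par_def by (intro tendsto_intros W)
  from derivative_quotient_tendsto[OF der t this]
  have "(\<lambda>k. (1 / t k) *\<^sub>R (P (u + t k *\<^sub>R par (W k)) - P u)) \<longlonglongrightarrow> B (par w)" .
  moreover have "\<forall>\<^sub>F k in sequentially. (1 / t k) *\<^sub>R (P (u + t k *\<^sub>R par (W k)) - P u) = fst (W k)"
    using tangent_sequence[OF t W mem u]
  proof eventually_elim
    case (elim k)
    then show ?case using t(1)[of k] by simp
  qed
  ultimately have "(\<lambda>k. fst (W k)) \<longlonglongrightarrow> B (par w)" by (rule Lim_transform_eventually)
  moreover have "(\<lambda>k. fst (W k)) \<longlonglongrightarrow> fst w" by (intro tendsto_intros W)
  ultimately have "fst w = B (par w)" using LIMSEQ_unique by blast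
  then have "w = (B (par w), par w - r *\<^sub>R B (par w))" by (simp add: par_def prod_eq_iff) 
  then show "w \<in> shifted_graph r B" unfolding shifted_graph_def by blast
next
  fix w assume "w \<in> shifted_graph r B"
  then obtain h where w: "w = (B h, h - r *\<^sub>R B h)" by (auto simp: shifted_graph_def)
  have "((\<lambda>s. pt (u + s *\<^sub>R h)) \<longlongrightarrow> pt (u + 0 *\<^sub>R h)) (at 0)"
    by (rule continuous_on_tendsto_compose[OF continuous_pt[of UNIV]]) (auto intro!: tendsto_eq_intros)
  then have "\<forall>\<^sub>F s in at 0. pt (u + s *\<^sub>R h) \<in> ball z \<eta>"
    using u by (intro topological_tendstoD) auto
  then obtain s0 where s0: "s0 > 0" "\<And>s. s \<noteq> 0 \<Longrightarrow> \<bar>s\<bar> < s0 \<Longrightarrow> pt (u + s *\<^sub>R h) \<in> ball z \<eta>"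
    by (auto simp: eventually_at dist_real_def)
  \<comment> \<open>Starting below \<open>s0\<close> puts every point of the sequence in the
    parametrised region, as \<open>tangent_cone\<close> asks for all \<open>k\<close> and not only
    for large ones.\<close>
  define t where "t k = s0 / 2 * inverse (real (Suc k))" for k
  have t: "t k > 0" "t k < s0" for k
  proof -
    show "t k > 0" using s0 by (simp add: t_def)
    have "s0 / 2 * inverse (real (Suc k)) \<le> s0 / 2 * 1"
      using s0 by (intro mult_left_mono) (auto simp: field_simps)
    then show "t k < s0" using s0 by (simp add: t_def)
  qed
  have t0: "t \<longlonglongrightarrow> 0"
    using tendsto_mult[OF tendsto_const[of "s0 / 2"] LIMSEQ_inverse_real_of_nat] by (simp add: t_def[abs_def])
  define W where "W k = (1 / t k) *\<^sub>R (pt (u + t k *\<^sub>R h) - pt u)" for k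
  have "(\<lambda>k. (1 / t k) *\<^sub>R (P (u + t k *\<^sub>R h) - P u)) \<longlonglongrightarrow> B h"
    by (rule derivative_quotient_tendsto[OF der t(1) t0 tendsto_const])
  then have "(\<lambda>k. ((1 / t k) *\<^sub>R (P (u + t k *\<^sub>R h) - P u),
      h - r *\<^sub>R ((1 / t k) *\<^sub>R (P (u + t k *\<^sub>R h) - P u)))) \<longlonglongrightarrow> w"
    unfolding w by (intro tendsto_intros)
  moreover have "W k = ((1 / t k) *\<^sub>R (P (u + t k *\<^sub>R h) - P u),
      h - r *\<^sub>R ((1 / t k) *\<^sub>R (P (u + t k *\<^sub>R h) - P u)))" for k
    using t(1)[of k] by (simp add: W_def pt_def algebra_simps)
  ultimately have "W \<longlonglongrightarrow> w" by presburger
  moreover have "pt u + t k *\<^sub>R W k \<in> gph F" for k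
  proof -
    have "pt u + t k *\<^sub>R W k = pt (u + t k *\<^sub>R h)" using t(1)[of k] by (simp add: W_def)
    then show ?thesis using pt_in_gph s0(2)[of "t k"] t[of k] by simp
  qed
  ultimately show "w \<in> tangent_cone (gph F) (pt u)"
    unfolding tangent_cone_def using t(1) t0 by blast
qed

text \<open>Convergence of the derivatives in operator norm forces convergence of the tangent spaces
  in the subspace metric; the adjoints follow because passing to the adjoint does not increase
  distances.\<close>

lemma SCD_limit:
  fixes B :: "(real^'n) \<Rightarrow>\<^sub>L (real^'n)"
  assumes us: "us \<longlonglongrightarrow> u" and der: "\<And>k. (P has_derivative blinfun_apply (Bs k)) (at (us k))"
    and B: "Bs \<longlonglongrightarrow> B" and u: "pt u \<in> ball z \<eta>"
  shows "shifted_graph r B \<in> SCD F (pt u)" "adj_subspace (shifted_graph r B) \<in> SCD_adj F (pt u)"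
proof -
  have "\<forall>\<^sub>F k in sequentially. pt (us k) \<in> ball z \<eta>"
    using tendsto_pt[OF us] u by (intro topological_tendstoD) auto
  then obtain N where N: "\<And>k. k \<ge> N \<Longrightarrow> pt (us k) \<in> ball z \<eta>" by (auto simp: eventually_sequentially)
  \<comment> \<open>Shifted by \<open>N\<close> because \<open>SCD\<close> requires each member of
    the sequence to lie in \<open>O_set F\<close>.\<close>
  define Z where "Z k = pt (us (k + N))" for k
  have T: "tangent_cone (gph F) (Z k) = shifted_graph r (Bs (k + N))" for k
    unfolding Z_def by (rule tangent_cone_eq[OF der N]) simp
  have lin: "linear (blinfun_apply A)" for A :: "(real^'n) \<Rightarrow>\<^sub>L (real^'n)"
    by (rule bounded_linear.linear[OF blinfun.bounded_linear_right])
  have GZ: "shifted_graph r (blinfun_apply A) \<in> Zn" for A :: "(real^'n) \<Rightarrow>\<^sub>L (real^'n)"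
    by (rule shifted_graph_in_Zn[OF lin])
  have ZO: "Z k \<in> O_set F" for k
    using pt_in_gph[OF N[of "k + N"]] T[of k] GZ by (simp add: O_set_def Z_def)
  have Zlim: "Z \<longlonglongrightarrow> pt u"
    using LIMSEQ_ignore_initial_segment[OF tendsto_pt[OF us], of N] by (simp add: Z_def[abs_def])
  have sub: "subspace (shifted_graph r (blinfun_apply A))" for A :: "(real^'n) \<Rightarrow>\<^sub>L (real^'n)"
    using GZ by (simp add: Zn_def)
  let ?G = "shifted_graph r B" and ?T = "\<lambda>k. tangent_cone (gph F) (Z k)"
  have dist0: "(\<lambda>k. subspace_dist ?G (?T k)) \<longlonglongrightarrow> 0"
  proof (rule tendsto_sandwich[OF _ _ tendsto_const])
    show "\<forall>\<^sub>F k in sequentially. 0 \<le> subspace_dist ?G (?T k)"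
      using subspace_dist_nonneg[OF sub sub] by (simp add: T)
    show "\<forall>\<^sub>F k in sequentially. subspace_dist ?G (?T k) \<le> 2 * ((1 + r)\<^sup>2 * norm (B - Bs (k + N)))"
      unfolding T by (intro always_eventually allI subspace_dist_shifted_graph_le[OF lin lin r])
        (metis blinfun.diff_left norm_blinfun)
    have "(\<lambda>k. 2 * ((1 + r)\<^sup>2 * norm (B - Bs (k + N)))) \<longlonglongrightarrow> 2 * ((1 + r)\<^sup>2 * norm (B - B))"
      by (intro tendsto_intros LIMSEQ_ignore_initial_segment[OF B])
    then show "(\<lambda>k. 2 * ((1 + r)\<^sup>2 * norm (B - Bs (k + N)))) \<longlonglongrightarrow> 0" by simp
  qed
  show "shifted_graph r B \<in> SCD F (pt u)"
    unfolding SCD_def using GZ ZO Zlim dist0 by blast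
  have "(\<lambda>k. subspace_dist (adj_subspace ?G) (adj_subspace (?T k))) \<longlonglongrightarrow> 0"
  proof (rule tendsto_sandwich[OF _ _ tendsto_const dist0])
    show "\<forall>\<^sub>F k in sequentially. 0 \<le> subspace_dist (adj_subspace ?G) (adj_subspace (?T k))"
      by (intro always_eventually allI subspace_dist_nonneg subspace_adj_subspace)
    show "\<forall>\<^sub>F k in sequentially. subspace_dist (adj_subspace ?G) (adj_subspace (?T k)) \<le> subspace_dist ?G (?T k)"
      using subspace_dist_adj_subspace_le[OF sub sub] by (simp add: T)
  qed
  then show "adj_subspace (shifted_graph r B) \<in> SCD_adj F (pt u)"
    unfolding SCD_adj_def using adj_subspace_Zn[OF GZ] ZO Zlim by blast
qed

lemma norm_blinfun_derivative_le:
  assumes "(P has_derivative blinfun_apply B) (at u)"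
  shows "norm B \<le> K"
  using lipschitz_norm_derivative_le[OF lip assms] lip
  by (intro norm_blinfun_bound) (auto simp: lipschitz_on_def)

lemma derivative_subsequence:
  assumes "\<And>k. (P has_derivative blinfun_apply (Bs k)) (at (us k))"
  obtains s B where "strict_mono (s :: nat \<Rightarrow> nat)" "(Bs \<circ> s) \<longlonglongrightarrow> B"
proof -
  have "compact (cball (0 :: (real^'n) \<Rightarrow>\<^sub>L (real^'n)) K)" by (rule compact_cball)
  moreover have "\<forall>k. Bs k \<in> cball 0 K" using norm_blinfun_derivative_le[OF assms] by simp
  ultimately show ?thesis using that unfolding compact_def by blast
qed

lemma has_blinfun_derivative:
  assumes "P differentiable (at u)"
  obtains B where "(P has_derivative blinfun_apply B) (at u)"
  using assms unfolding differentiable_def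
  by (metis bounded_linear_Blinfun_apply has_derivative_bounded_linear)

text \<open>Points of differentiability of \<open>P\<close> are dense and the derivatives there are
  bounded by \<open>K\<close>, so near the parameter of any nearby graph point they have a cluster
  point.\<close>

lemma SCD_property: "SCD_property_around F z"
  unfolding SCD_property_around_def
proof -
  have "SCD_adj F w \<noteq> {}" if w: "w \<in> ball z \<eta>" "w \<in> gph F" for w
  proof -
    define u where "u = par w"
    have pu: "pt u = w" unfolding u_def by (rule gph_eq_pt[OF w(2,1)])
    have "\<exists>v B. dist u v < inverse (real (Suc k)) \<and> (P has_derivative blinfun_apply B) (at v)" for k
    proof -
      obtain v where "v \<in> ball u (inverse (real (Suc k)))" "P differentiable (at v)"
        using AE_lborel_imp_ex_in_ball[OF lipschitz_AE_differentiable[OF lip], of "inverse (real (Suc k))" u] by auto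
      then show ?thesis using has_blinfun_derivative by (metis mem_ball)
    qed
    then obtain us Bs where us: "\<And>k. dist u (us k) < inverse (real (Suc k))"
      and Bs: "\<And>k. (P has_derivative blinfun_apply (Bs k)) (at (us k))" by metis
    obtain s B where s: "strict_mono (s :: nat \<Rightarrow> nat)" "(Bs \<circ> s) \<longlonglongrightarrow> B"
      by (rule derivative_subsequence[OF Bs])
    have "us \<longlonglongrightarrow> u" by (rule LIMSEQ_of_dist_less_inverse[OF us])
    then have "(us \<circ> s) \<longlonglongrightarrow> u" by (rule LIMSEQ_subseq_LIMSEQ[OF _ s(1)])
    then have "adj_subspace (shifted_graph r B) \<in> SCD_adj F (pt u)"
      by (rule SCD_limit(2)[where Bs = "Bs \<circ> s"]) (use Bs s w pu in auto)
    then show ?thesis using pu by auto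
  qed
  then show "\<forall>\<^sub>F z' in nhds z. z' \<in> gph F \<longrightarrow> SCD_adj F z' \<noteq> {}"
    using eventually_nhds_in_open[of "ball z \<eta>" z] eta by (auto elim!: eventually_mono)
qed

text \<open>Homogeneity of \<open>g\<close> allows passing to unit vectors \<open>h\<close>, which have convergent subsequences.\<close>

lemma derivative_cluster:
  fixes g :: "(real^'n \<Rightarrow> real^'n) \<Rightarrow> real^'n \<Rightarrow> real"
  assumes ex: "\<And>\<delta>. 0 < \<delta> \<Longrightarrow> \<exists>u\<in>ball (par z) \<delta>. \<exists>B h. (P has_derivative B) (at u) \<and> g B h < \<delta> * norm h ^ m"
    and hom: "\<And>B t h. linear B \<Longrightarrow> 0 \<le> t \<Longrightarrow> g B (t *\<^sub>R h) = t ^ m * g B h" and m: "m \<noteq> 0"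
    and g: "\<And>Bs (B :: (real^'n) \<Rightarrow>\<^sub>L (real^'n)) hs h. Bs \<longlonglongrightarrow> B \<Longrightarrow> hs \<longlonglongrightarrow> h \<Longrightarrow>
      (\<lambda>k. g (blinfun_apply (Bs k)) (hs k)) \<longlonglongrightarrow> g (blinfun_apply B) h"
  obtains B :: "(real^'n) \<Rightarrow>\<^sub>L (real^'n)" and h where "norm h = 1" "g (blinfun_apply B) h \<le> 0"
    "shifted_graph r B \<in> SCD F z" "adj_subspace (shifted_graph r B) \<in> SCD_adj F z"
proof -
  have "\<exists>u B h. dist (par z) u < inverse (real (Suc k)) \<and> (P has_derivative blinfun_apply B) (at u) \<and>
      norm h = 1 \<and> g (blinfun_apply B) h < inverse (real (Suc k))" for k
  proof -
    have "inverse (real (Suc k)) > 0" by simp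
    from ex[OF this] obtain u B h where u: "u \<in> ball (par z) (inverse (real (Suc k)))"
      and B: "(P has_derivative B) (at u)" and h: "g B h < inverse (real (Suc k)) * norm h ^ m" by blast
    have lin: "linear B" "bounded_linear B" using B has_derivative_linear has_derivative_bounded_linear by auto
    \<comment> \<open>Homogeneity of positive degree gives \<open>g B 0 = 0\<close>, which the
      strict inequality excludes.\<close>
    have "h \<noteq> 0" using h hom[OF lin(1), of 0 0] m by (auto simp: power_0_left)
    define w where "w = (1 / norm h) *\<^sub>R h"
    have "norm w = 1" using \<open>h \<noteq> 0\<close> by (simp add: w_def)
    moreover have "g B w < inverse (real (Suc k))"
    proof -
      have "norm h *\<^sub>R w = h" using \<open>h \<noteq> 0\<close> by (simp add: w_def)
      then have "norm h ^ m * g B w < norm h ^ m * inverse (real (Suc k))"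
        using hom[OF lin(1), of "norm h" w] h by (simp add: mult.commute del: of_nat_Suc)
      then show ?thesis by (rule mult_left_less_imp_less) simp
    qed
    ultimately show ?thesis using u B lin(2)
      by (intro exI[of _ u] exI[of _ "Blinfun B"] exI[of _ w]) (auto simp: bounded_linear_Blinfun_apply)
  qed
  then obtain us Bs hs where us: "\<And>k. dist (par z) (us k) < inverse (real (Suc k))"
    and Bs: "\<And>k. (P has_derivative blinfun_apply (Bs k)) (at (us k))"
    and hs: "\<And>k. norm (hs k) = 1" "\<And>k. g (Bs k) (hs k) < inverse (real (Suc k))"
    by metis
  obtain s B where s: "strict_mono (s :: nat \<Rightarrow> nat)" "(Bs \<circ> s) \<longlonglongrightarrow> B"
    by (rule derivative_subsequence[OF Bs])
  have sph: "\<forall>k. (hs \<circ> s) k \<in> sphere 0 1" using hs(1) by simp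
  obtain h t where ht: "h \<in> sphere 0 1" "strict_mono (t :: nat \<Rightarrow> nat)" "(hs \<circ> s \<circ> t) \<longlonglongrightarrow> h"
    by (rule seq_compactE[OF compact_imp_seq_compact[OF compact_sphere] sph])
  define q where "q = s \<circ> t"
  have q: "strict_mono q" unfolding q_def using s(1) ht(2) by (rule strict_mono_o)
  have hq: "(\<lambda>k. hs (q k)) \<longlonglongrightarrow> h" using ht(3) by (simp add: q_def comp_def)
  have Bq: "(\<lambda>k. Bs (q k)) \<longlonglongrightarrow> B" using LIMSEQ_subseq_LIMSEQ[OF s(2) ht(2)] by (simp add: q_def comp_def)
  have inv0: "(\<lambda>k. inverse (real (Suc (q k)))) \<longlonglongrightarrow> 0"
    using LIMSEQ_subseq_LIMSEQ[OF LIMSEQ_inverse_real_of_nat q] by (simp add: comp_def)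
  have uq: "(\<lambda>k. us (q k)) \<longlonglongrightarrow> par z"
    using LIMSEQ_subseq_LIMSEQ[OF LIMSEQ_of_dist_less_inverse[OF us] q] by (simp add: comp_def)
  have "g (blinfun_apply B) h \<le> 0"
    by (rule tendsto_le[OF _ inv0 g[OF Bq hq]]) (use hs(2) in \<open>auto simp: less_imp_le\<close>)
  moreover have zin: "pt (par z) \<in> ball z \<eta>" using pt_par_base eta by simp
  have "shifted_graph r B \<in> SCD F z" "adj_subspace (shifted_graph r B) \<in> SCD_adj F z"
    using SCD_limit[OF uq Bs[of "q _"] Bq zin] pt_par_base by auto
  ultimately show ?thesis using that ht(1) by simp
qed

text \<open>If the bound failed, a limit derivative \<open>B\<close> and a unit vector
  \<open>h\<close> would satisfy \<open>p \<bullet> h \<le> 0\<close> for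
  \<open>p = h - r *\<^sub>R B h\<close>. But \<open>p \<bullet> h\<close> is
  \<open>p \<bullet> p\<close> plus \<open>r\<close> times \<open>B h \<bullet> p\<close>, and the
  latter is nonnegative by semidefiniteness. So \<open>p = 0\<close>; regularity gives
  \<open>B h = 0\<close>, hence \<open>h = 0\<close>.\<close>

lemma derivative_strongly_monotone:
  assumes reg: "SCD_adj F z \<subseteq> Zn_reg" and psd: "\<forall>L\<in>SCD F z. \<forall>p. (C_mat L *v p) \<bullet> p \<ge> 0"
  shows "\<exists>c>0. \<exists>\<delta>>0. \<forall>u\<in>ball (par z) \<delta>. \<forall>B h. (P has_derivative B) (at u) \<longrightarrow>
    (h - r *\<^sub>R B h) \<bullet> h \<ge> c * (norm h)\<^sup>2"
proof (rule ccontr)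
  assume neg: "\<not> ?thesis"
  \<comment> \<open>One number \<open>\<delta>\<close> serves as radius and as constant, so that a
    single sequence of counterexamples arises.\<close>
  have ex: "\<exists>u\<in>ball (par z) \<delta>. \<exists>B h. (P has_derivative B) (at u) \<and> (h - r *\<^sub>R B h) \<bullet> h < \<delta> * norm h ^ 2"
    if "\<delta> > 0" for \<delta>
    using neg that by (force simp: not_le)
  obtain B :: "(real^'n) \<Rightarrow>\<^sub>L (real^'n)" and h where h1: "norm h = 1" and le0: "(h - r *\<^sub>R B h) \<bullet> h \<le> 0"
    and L: "shifted_graph r B \<in> SCD F z" "adj_subspace (shifted_graph r B) \<in> SCD_adj F z"
    by (rule derivative_cluster[OF ex])
       (auto intro!: tendsto_intros simp: linear_cmul power2_eq_square algebra_simps)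
  let ?L = "shifted_graph r B"
  have Lreg: "?L \<in> Zn_reg"
    by (rule Zn_reg_if_adj_Zn_reg) (use L reg in \<open>auto simp: SCD_def\<close>)
  define p where "p = h - r *\<^sub>R B h"
  have mem: "(B h, p) \<in> ?L" by (auto simp: shifted_graph_def p_def)
  then have "(B h, p) \<in> range (\<lambda>p. (C_mat ?L *v p, p))" using Zn_reg_C_mat[OF Lreg] by simp
  then have "C_mat ?L *v p = B h" by auto
  then have pos: "B h \<bullet> p \<ge> 0" using psd L(1) by metis
  have "p \<bullet> h = p \<bullet> p + r * (B h \<bullet> p)"
  proof -
    have "h = p + r *\<^sub>R B h" by (simp add: p_def)
    then have "p \<bullet> h = p \<bullet> (p + r *\<^sub>R B h)" by simp
    then show ?thesis by (simp add: inner_add_right inner_commute)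
  qed
  moreover have "p \<bullet> h \<le> 0" using le0 by (simp add: p_def)
  ultimately have "p \<bullet> p = 0" using mult_nonneg_nonneg[OF r pos] inner_ge_zero[of p] by linarith
  then have p0: "p = 0" by simp
  then have "B h = 0" using mem Lreg by (auto simp: Zn_reg_def)
  then have "h = 0" using p0 by (simp add: p_def)
  then show False using h1 by simp
qed

section \<open>Estimates on SCD elements in the case r = 0\<close>

lemma tangent_sequence_snd:
  assumes r0: "r = 0" and w: "w \<in> gph F" "w \<in> ball z \<eta>" "snd w \<in> ball (snd z) \<delta>"
    and d: "d \<in> tangent_cone (gph F) w"
  obtains t W where "\<And>k::nat. (t k :: real) > 0" "W \<longlonglongrightarrow> d"
    "\<forall>\<^sub>F k in sequentially. snd w + t k *\<^sub>R snd (W k) \<in> ball (snd z) \<delta> \<and>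
      P (snd w + t k *\<^sub>R snd (W k)) - P (snd w) = t k *\<^sub>R fst (W k)"
proof -
  from d obtain t W where t: "\<And>k. t k > 0" "t \<longlonglongrightarrow> 0" and W: "W \<longlonglongrightarrow> d"
    and mem: "\<And>k::nat. w + t k *\<^sub>R W k \<in> gph F"
    by (auto simp: tangent_cone_def)
  have par: "par v = snd v" for v unfolding par_def unfolding r0 by simp
  have pw: "pt (snd w) = w" using gph_eq_pt[OF w(1,2)] unfolding par .
  have "\<forall>\<^sub>F k in sequentially. P (snd w + t k *\<^sub>R par (W k)) = P (snd w) + t k *\<^sub>R fst (W k)"
    by (rule tangent_sequence[OF t W]) (use mem pw w in auto)
  moreover have "(\<lambda>k. snd w + t k *\<^sub>R snd (W k)) \<longlonglongrightarrow> snd w + 0 *\<^sub>R snd d"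
    by (intro tendsto_intros t W)
  then have "\<forall>\<^sub>F k in sequentially. snd w + t k *\<^sub>R snd (W k) \<in> ball (snd z) \<delta>"
    using w(3) by (intro topological_tendstoD) auto
  ultimately have "\<forall>\<^sub>F k in sequentially. snd w + t k *\<^sub>R snd (W k) \<in> ball (snd z) \<delta> \<and>
      P (snd w + t k *\<^sub>R snd (W k)) - P (snd w) = t k *\<^sub>R fst (W k)"
    unfolding par by eventually_elim auto
  with t(1) W show ?thesis by (rule that)
qed

lemma norm_fst_tangent_le:
  assumes r0: "r = 0" and w: "w \<in> gph F" "w \<in> ball z \<eta>" "snd w \<in> ball (snd z) \<delta>"
    and d: "d \<in> tangent_cone (gph F) w" and c: "c-lipschitz_on (ball (snd z) \<delta>) P"
  shows "norm (fst d) \<le> c * norm (snd d)"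
proof -
  obtain t W where t: "\<And>k::nat. (t k :: real) > 0" and W: "W \<longlonglongrightarrow> d"
    and ev: "\<forall>\<^sub>F k in sequentially. snd w + t k *\<^sub>R snd (W k) \<in> ball (snd z) \<delta> \<and>
      P (snd w + t k *\<^sub>R snd (W k)) - P (snd w) = t k *\<^sub>R fst (W k)"
    by (rule tangent_sequence_snd[OF r0 w d]) blast
  have "\<forall>\<^sub>F k in sequentially. norm (fst (W k)) \<le> c * norm (snd (W k))"
    using ev
  proof eventually_elim
    case (elim k)
    then have "norm (t k *\<^sub>R fst (W k)) \<le> c * norm (t k *\<^sub>R snd (W k))"
      using lipschitz_onD[OF c, of "snd w + t k *\<^sub>R snd (W k)" "snd w"] w(3) by (simp add: dist_norm)
    then have "t k * norm (fst (W k)) \<le> t k * (c * norm (snd (W k)))" using t[of k] by (simp add: mult_ac)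
    then show ?case using t[of k] by simp
  qed
  moreover have "(\<lambda>k. c * norm (snd (W k))) \<longlonglongrightarrow> c * norm (snd d)" "(\<lambda>k. norm (fst (W k))) \<longlonglongrightarrow> norm (fst d)"
    by (intro tendsto_intros W)+
  ultimately show ?thesis by (intro tendsto_le[OF trivial_limit_sequentially])
qed

lemma inner_tangent_nonneg:
  assumes r0: "r = 0" and w: "w \<in> gph F" "w \<in> ball z \<eta>" "snd w \<in> ball (snd z) \<delta>"
    and d: "d \<in> tangent_cone (gph F) w"
    and mono: "\<And>u v. u \<in> ball (snd z) \<delta> \<Longrightarrow> v \<in> ball (snd z) \<delta> \<Longrightarrow> (P u - P v) \<bullet> (u - v) \<ge> 0"
  shows "fst d \<bullet> snd d \<ge> 0"
proof -
  obtain t W where t: "\<And>k::nat. (t k :: real) > 0" and W: "W \<longlonglongrightarrow> d"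
    and ev: "\<forall>\<^sub>F k in sequentially. snd w + t k *\<^sub>R snd (W k) \<in> ball (snd z) \<delta> \<and>
      P (snd w + t k *\<^sub>R snd (W k)) - P (snd w) = t k *\<^sub>R fst (W k)"
    by (rule tangent_sequence_snd[OF r0 w d]) blast
  have "\<forall>\<^sub>F k in sequentially. 0 \<le> fst (W k) \<bullet> snd (W k)"
    using ev
  proof eventually_elim
    case (elim k)
    then have "0 \<le> (t k *\<^sub>R fst (W k)) \<bullet> (t k *\<^sub>R snd (W k))"
      using mono[of "snd w + t k *\<^sub>R snd (W k)" "snd w"] w(3) by simp
    then show ?case using t[of k] by (simp add: zero_le_mult_iff)
  qed
  moreover have "(\<lambda>k. fst (W k) \<bullet> snd (W k)) \<longlonglongrightarrow> fst d \<bullet> snd d" by (intro tendsto_intros W)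
  ultimately show ?thesis by (intro tendsto_lowerbound[OF _ _ trivial_limit_sequentially])
qed

text \<open>A matrix and its transpose have the same norm: with \<open>u\<close> the transpose
  applied to \<open>p\<close>, \<open>norm u * norm u = (C *v u) \<bullet> p\<close>. The bound
  itself makes \<open>T\<close> regular, so that \<open>C\<close> exists.\<close>

lemma norm_adj_le:
  fixes T :: "((real^'n) \<times> (real^'n)) set"
  assumes T: "T \<in> Zn" and le: "\<And>d. d \<in> T \<Longrightarrow> norm (fst d) \<le> c * norm (snd d)" and w: "w \<in> adj_subspace T"
  shows "norm (fst w) \<le> c * norm (snd w)"
proof -
  have "T \<in> Zn_reg" using T le[of "(_, 0)"] by (auto simp: Zn_reg_def)
  then obtain C where C: "T = range (\<lambda>p. (C *v p, p))" using Zn_reg_C_mat by blast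
  then obtain p where p: "w = (transpose C *v p, p)" using w adj_subspace_range_matrix[of C] by auto
  let ?u = "transpose C *v p"
  have "(C *v ?u, ?u) \<in> T" using C by simp
  then have Cu: "norm (C *v ?u) \<le> c * norm ?u" using le by fastforce
  have "norm ?u * norm ?u = (C *v ?u) \<bullet> p"
    by (simp add: inner_matrix_vector_mult_transpose dot_square_norm power2_eq_square)
  also have "\<dots> \<le> norm (C *v ?u) * norm p" by (rule norm_cauchy_schwarz)
  also have "\<dots> \<le> (c * norm ?u) * norm p" by (rule mult_right_mono[OF Cu norm_ge_zero])
  finally have *: "norm ?u * norm ?u \<le> norm ?u * (c * norm p)" by (simp add: mult_ac)
  show ?thesis
  proof (cases "?u = 0")
    \<comment> \<open>The sign of \<open>c\<close> is not assumed; \<open>c * norm p\<close> is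
      nonnegative because it bounds \<open>norm (C *v p)\<close>.\<close>
    case True
    have "(C *v p, p) \<in> T" using C by simp
    then have "norm (C *v p) \<le> c * norm p" using le by fastforce
    then show ?thesis using True p norm_ge_zero[of "C *v p"] by (simp del: norm_ge_zero)
  next
    case False
    then show ?thesis using * p by simp
  qed
qed

lemma eventually_near_base:
  assumes "Z \<longlonglongrightarrow> z" "0 < \<delta>"
  shows "\<forall>\<^sub>F k in sequentially. Z k \<in> ball z \<eta> \<and> snd (Z k) \<in> ball (snd z) \<delta>"
proof (rule eventually_conj)
  show "\<forall>\<^sub>F k in sequentially. Z k \<in> ball z \<eta>" using assms eta by (intro topological_tendstoD) auto
  show "\<forall>\<^sub>F k in sequentially. snd (Z k) \<in> ball (snd z) \<delta>"
    using tendsto_snd[OF assms(1)] assms(2) by (intro topological_tendstoD) auto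
qed

lemma norm_fst_SCD_adj_le:
  assumes r0: "r = 0" and c: "c-lipschitz_on (ball (snd z) \<delta>) P" and \<delta>: "0 < \<delta>"
    and L: "L \<in> SCD_adj F z" and w: "w \<in> L"
  shows "norm (fst w) \<le> c * norm (snd w)"
proof -
  from L obtain Z where Z: "\<And>k::nat. Z k \<in> O_set F" "Z \<longlonglongrightarrow> z"
    "(\<lambda>k. subspace_dist L (adj_subspace (tangent_cone (gph F) (Z k)))) \<longlonglongrightarrow> 0" and "L \<in> Zn"
    by (auto simp: SCD_adj_def)
  let ?w = "\<lambda>k. orth_proj (adj_subspace (tangent_cone (gph F) (Z k))) w"
  have lim: "?w \<longlonglongrightarrow> w"
    by (rule tendsto_orth_proj_of_subspace_dist[OF _ _ w Z(3)])
       (use \<open>L \<in> Zn\<close> in \<open>auto simp: Zn_def subspace_adj_subspace\<close>)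
  have "\<forall>\<^sub>F k in sequentially. norm (fst (?w k)) \<le> c * norm (snd (?w k))"
    using eventually_near_base[OF Z(2) \<delta>]
  proof eventually_elim
    case (elim k)
    show ?case
    proof (rule norm_adj_le)
      show "tangent_cone (gph F) (Z k) \<in> Zn" using Z(1) by (simp add: O_set_def)
      show "norm (fst d) \<le> c * norm (snd d)" if "d \<in> tangent_cone (gph F) (Z k)" for d
        by (rule norm_fst_tangent_le[OF r0 _ _ _ that c]) (use elim Z(1) in \<open>auto simp: O_set_def\<close>)
      show "?w k \<in> adj_subspace (tangent_cone (gph F) (Z k))" by (rule orth_proj(1)[OF subspace_adj_subspace])
    qed
  qed
  moreover have "(\<lambda>k. c * norm (snd (?w k))) \<longlonglongrightarrow> c * norm (snd w)" "(\<lambda>k. norm (fst (?w k))) \<longlonglongrightarrow> norm (fst w)"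
    by (intro tendsto_intros lim)+
  ultimately show ?thesis by (intro tendsto_le[OF trivial_limit_sequentially])
qed

text \<open>Both inequalities pass from tangent cones to \<open>L\<close> through projections. The
  Lipschitz bound puts \<open>L\<close> into \<open>Zn_reg\<close>, which gives
  \<open>C_mat L\<close> its meaning.\<close>

lemma SCD_nonneg:
  assumes r0: "r = 0" and c: "c-lipschitz_on (ball (snd z) \<delta>) P" and \<delta>: "0 < \<delta>"
    and mono: "\<And>u v. u \<in> ball (snd z) \<delta> \<Longrightarrow> v \<in> ball (snd z) \<delta> \<Longrightarrow> (P u - P v) \<bullet> (u - v) \<ge> 0"
    and L: "L \<in> SCD F z"
  shows "(C_mat L *v p) \<bullet> p \<ge> 0"
proof -
  from L obtain Z where Z: "\<And>k::nat. Z k \<in> O_set F" "Z \<longlonglongrightarrow> z"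
    "(\<lambda>k. subspace_dist L (tangent_cone (gph F) (Z k))) \<longlonglongrightarrow> 0" and LZ: "L \<in> Zn"
    by (auto simp: SCD_def)
  have T: "tangent_cone (gph F) (Z k) \<in> Zn" for k using Z(1) by (simp add: O_set_def)
  let ?w = "\<lambda>w k. orth_proj (tangent_cone (gph F) (Z k)) w"
  have lim: "?w w \<longlonglongrightarrow> w" if "w \<in> L" for w
    by (rule tendsto_orth_proj_of_subspace_dist[OF _ _ that Z(3)]) (use LZ T in \<open>auto simp: Zn_def\<close>)
  have in_T: "?w w k \<in> tangent_cone (gph F) (Z k)" for w k
    by (rule orth_proj(1)) (use T in \<open>auto simp: Zn_def\<close>)
  have *: "norm (fst w) \<le> c * norm (snd w) \<and> 0 \<le> fst w \<bullet> snd w" if w: "w \<in> L" for w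
  proof -
    have ev: "\<forall>\<^sub>F k in sequentially. norm (fst (?w w k)) \<le> c * norm (snd (?w w k)) \<and> 0 \<le> fst (?w w k) \<bullet> snd (?w w k)"
      using eventually_near_base[OF Z(2) \<delta>]
    proof eventually_elim
      case (elim k)
      have Zg: "Z k \<in> gph F" using Z(1) by (simp add: O_set_def)
      show ?case
        using norm_fst_tangent_le[OF r0 Zg _ _ in_T c] inner_tangent_nonneg[OF r0 Zg _ _ in_T mono] elim by blast
    qed
    have ev1: "\<forall>\<^sub>F k in sequentially. norm (fst (?w w k)) \<le> c * norm (snd (?w w k))"
      and ev2: "\<forall>\<^sub>F k in sequentially. 0 \<le> fst (?w w k) \<bullet> snd (?w w k)"
      using ev by (auto elim: eventually_mono)
    have "(\<lambda>k. c * norm (snd (?w w k))) \<longlonglongrightarrow> c * norm (snd w)" "(\<lambda>k. norm (fst (?w w k))) \<longlonglongrightarrow> norm (fst w)"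
      by (intro tendsto_intros lim w)+
    from tendsto_le[OF trivial_limit_sequentially this ev1] have "norm (fst w) \<le> c * norm (snd w)" .
    moreover have "(\<lambda>k. fst (?w w k) \<bullet> snd (?w w k)) \<longlonglongrightarrow> fst w \<bullet> snd w"
      by (intro tendsto_intros lim w)
    from tendsto_lowerbound[OF this ev2] have "0 \<le> fst w \<bullet> snd w" by simp
    ultimately show ?thesis by simp
  qed
  have "L \<in> Zn_reg" using LZ *[of "(_, 0)"] by (auto simp: Zn_reg_def)
  from Zn_reg_C_mat[OF this] have "(C_mat L *v p, p) \<in> L" by auto
  from *[OF this] show ?thesis by simp
qed

text \<open>Derivatives exceeding \<open>c\<close> arbitrarily close to the base point would produce
  a limit \<open>B\<close> whose norm is at least \<open>c\<close>. The adjoint of its graph is the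
  graph of the transpose, which has the same norm, against
  \<open>scd_reg F z < ereal c\<close>.\<close>

lemma lipschitz_on_of_scd_reg_less:
  assumes r0: "r = 0" and less: "scd_reg F z < ereal c"
  shows "\<exists>\<delta>>0. c-lipschitz_on (ball (snd z) \<delta>) P"
proof -
  have par: "par z = snd z" unfolding par_def unfolding r0 by simp
  have reg: "norm ys < c" if "L \<in> SCD_adj F z" "(ys, xs) \<in> L" "norm xs \<le> 1" for L ys xs
  proof -
    have "ereal (norm ys) \<le> scd_reg F z" unfolding scd_reg_def using that by (intro Sup_upper) blast
    from le_less_trans[OF this less] show ?thesis by simp
  qed
  \<comment> \<open>\<open>scd_reg\<close> would be \<open>- \<infinity>\<close> over an empty
    family. The SCD property supplies some \<open>L\<close>, and its element \<open>(0, 0)\<close>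
    makes the supremum nonnegative.\<close>
  have c0: "c > 0"
  proof -
    have "z \<in> gph F \<longrightarrow> SCD_adj F z \<noteq> {}"
      using SCD_property unfolding SCD_property_around_def by (rule eventually_nhds_x_imp_x)
    then have "SCD_adj F z \<noteq> {}" using base by simp
    then obtain L where L: "L \<in> SCD_adj F z" by blast
    then have "(0, 0) \<in> L" by (auto simp: SCD_adj_def Zn_def zero_prod_def[symmetric] subspace_0)
    from reg[OF L this] show ?thesis by simp
  qed
  have "\<exists>\<delta>>0. \<forall>u\<in>ball (par z) \<delta>. \<forall>B h. (P has_derivative B) (at u) \<longrightarrow> norm (B h) \<le> c * norm h"
  proof (rule ccontr)
    assume neg: "\<not> ?thesis"
    have ex: "\<exists>u\<in>ball (par z) \<delta>. \<exists>B h. (P has_derivative B) (at u) \<and> c * norm h - norm (B h) < \<delta> * norm h ^ 1"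
      if \<delta>: "\<delta> > 0" for \<delta>
    proof -
      obtain u B h where u: "u \<in> ball (par z) \<delta>" "(P has_derivative B) (at u)" "c * norm h < norm (B h)"
        using neg \<delta> by (auto simp: not_le)
      have "0 \<le> \<delta> * norm h" using \<delta> by simp
      with u(3) have "c * norm h - norm (B h) < \<delta> * norm h ^ 1" by simp
      then show ?thesis using u by blast
    qed
    obtain B :: "(real^'n) \<Rightarrow>\<^sub>L (real^'n)" and h where h1: "norm h = 1" and le0: "c * norm h - norm (B h) \<le> 0"
      and L: "adj_subspace (shifted_graph r B) \<in> SCD_adj F z"
      by (rule derivative_cluster[OF ex]) (auto intro!: tendsto_intros simp: linear_cmul algebra_simps)
    define C where "C = matrix (blinfun_apply B)"
    have CB: "C *v p = B p" for p
      unfolding C_def by (simp add: matrix_works bounded_linear.linear[OF blinfun.bounded_linear_right])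
    have "shifted_graph r B = range (\<lambda>p. (C *v p, p))" by (simp add: shifted_graph_def r0 CB)
    then have adj: "adj_subspace (shifted_graph r B) = range (\<lambda>p. (transpose C *v p, p))"
      by (simp add: adj_subspace_range_matrix)
    \<comment> \<open>The unit vector on which the transpose attains at least
      \<open>norm (B h)\<close>, as testing against \<open>h\<close> shows.\<close>
    define p where "p = (1 / norm (B h)) *\<^sub>R B h"
    have Bh1: "norm (B h) \<ge> c" using le0 h1 by simp
    with c0 have Bh: "norm (B h) \<ge> c" "norm (B h) > 0" by linarith+
    have p1: "norm p = 1" using Bh by (simp add: p_def)
    have "(transpose C *v p, p) \<in> adj_subspace (shifted_graph r B)" using adj by simp
    from reg[OF L this] p1 have less_c: "norm (transpose C *v p) < c" by simp
    have "norm (B h) = (C *v h) \<bullet> p"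
      using Bh by (simp add: CB p_def dot_square_norm power2_eq_square)
    also have "\<dots> = h \<bullet> (transpose C *v p)" by (rule inner_matrix_vector_mult_transpose)
    also have "\<dots> \<le> norm h * norm (transpose C *v p)" by (rule norm_cauchy_schwarz)
    finally show False using less_c Bh h1 by simp
  qed
  then obtain \<delta> where \<delta>: "\<delta> > 0"
    "\<And>u B h. u \<in> ball (snd z) \<delta> \<Longrightarrow> (P has_derivative B) (at u) \<Longrightarrow> norm (B h) \<le> c * norm h"
    unfolding par by blast
  have "c-lipschitz_on (ball (snd z) \<delta>) P"
  proof (rule lipschitz_onI)
    show "dist (P x) (P y) \<le> c * dist x y" if "x \<in> ball (snd z) \<delta>" "y \<in> ball (snd z) \<delta>" for x y
      unfolding dist_norm
    proof (rule lipschitz_norm_diff_le_of_derivative[OF lip _ _ that(2,1)])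
      show "norm (f' h) \<le> c * norm h" if "u \<in> ball (snd z) \<delta>" "(P has_derivative f') (at u)" for u f' h
        using \<delta>(2) that by blast
    qed (use c0 in simp)
  qed (use c0 in simp)
  then show ?thesis using \<delta>(1) by blast
qed

end

section \<open>Variational tools\<close>

text \<open>Along \<open>x + t k *\<^sub>R fst (W k)\<close> the quadratic term is of order
  \<open>(t k)\<^sup>2\<close>, so it disappears after division by \<open>t k\<close> and
  \<open>(s, - 1)\<close> is a regular normal. A constant sequence makes it a limiting one.\<close>

lemma proximal_subgradient_in_subdiff:
  fixes q :: "'a::real_inner \<Rightarrow> ereal"
  assumes fin: "\<bar>q x\<bar> \<noteq> \<infinity>" and e: "e > 0"
    and sub: "\<And>y. y \<in> ball x e \<Longrightarrow> q y \<ge> q x + ereal (s \<bullet> (y - x) - c * (norm (y - x))\<^sup>2)"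
  shows "s \<in> subdiff q x"
proof -
  obtain \<alpha> where \<alpha>: "q x = ereal \<alpha>" using fin by (cases "q x") auto
  have "(s, - 1) \<in> regular_normal_cone (epi q) (x, \<alpha>)"
    unfolding regular_normal_cone_def
  proof (intro CollectI ballI)
    fix w assume "w \<in> tangent_cone (epi q) (x, \<alpha>)"
    then obtain t W where t: "\<And>k. t k > (0::real)" "t \<longlonglongrightarrow> 0" and W: "W \<longlonglongrightarrow> w"
      and mem: "\<And>k::nat. (x, \<alpha>) + t k *\<^sub>R W k \<in> epi q"
      by (auto simp: tangent_cone_def)
    have lim: "(\<lambda>k. x + t k *\<^sub>R fst (W k)) \<longlonglongrightarrow> x + 0 *\<^sub>R fst w" by (intro tendsto_intros t W)
    have ev: "\<forall>\<^sub>F k in sequentially. x + t k *\<^sub>R fst (W k) \<in> ball x e"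
      using lim e by (intro topological_tendstoD[OF lim]) auto
    have "\<forall>\<^sub>F k in sequentially. s \<bullet> fst (W k) - c * (t k * (norm (fst (W k)))\<^sup>2) \<le> snd (W k)"
      using ev
    proof eventually_elim
      case (elim k)
      have "q (x + t k *\<^sub>R fst (W k)) \<le> ereal (\<alpha> + t k * snd (W k))"
        using mem[of k] by (cases "W k") (simp add: epi_def)
      from order_trans[OF sub[OF elim] this] have "s \<bullet> (t k *\<^sub>R fst (W k)) - c * (norm (t k *\<^sub>R fst (W k)))\<^sup>2 \<le> t k * snd (W k)"
        by (simp add: \<alpha>)
      then have "t k * (s \<bullet> fst (W k) - c * (t k * (norm (fst (W k)))\<^sup>2)) \<le> t k * snd (W k)"
        using t(1)[of k] by (simp add: power2_eq_square algebra_simps)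
      then show ?case using t(1)[of k] by simp
    qed
    moreover have "(\<lambda>k. s \<bullet> fst (W k) - c * (t k * (norm (fst (W k)))\<^sup>2)) \<longlonglongrightarrow> s \<bullet> fst w - c * (0 * (norm (fst w))\<^sup>2)"
      by (intro tendsto_intros t W)
    moreover have "(\<lambda>k. snd (W k)) \<longlonglongrightarrow> snd w" by (intro tendsto_intros W)
    ultimately have "s \<bullet> fst w - c * (0 * (norm (fst w))\<^sup>2) \<le> snd w"
      by (intro tendsto_le[OF trivial_limit_sequentially])
    then show "(s, - 1) \<bullet> w \<le> 0" by (cases w) simp
  qed
  moreover have "(x, \<alpha>) \<in> epi q" by (simp add: epi_def \<alpha>)
  ultimately have "(s, - 1) \<in> limiting_normal_cone (epi q) (x, \<alpha>)"
    unfolding limiting_normal_cone_def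
    by (intro CollectI exI[of _ "\<lambda>_. (x, \<alpha>)"] exI[of _ "\<lambda>_. (s, - 1)"]) auto
  then show ?thesis by (simp add: subdiff_def \<alpha>)
qed

lemma lsc_at_add_continuous:
  fixes q :: "'a::topological_space \<Rightarrow> ereal" and f :: "'a \<Rightarrow> real"
  assumes q: "lsc_at q x" and f: "(f \<longlongrightarrow> f x) (nhds x)" and c: "c < q x + ereal (f x)"
  shows "\<forall>\<^sub>F y in nhds x. c < q y + ereal (f y)"
proof -
  obtain c' where c': "c < ereal c'" "ereal c' < q x + ereal (f x)" using ereal_dense2[OF c] by blast
  then have "ereal (c' - f x) < q x" by (cases "q x") auto
  then obtain d where d: "c' - f x < d" "ereal d < q x" using ereal_dense2 by fastforce
  have "\<forall>\<^sub>F y in nhds x. ereal d < q y"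
    using q d(2) unfolding lsc_at_def le_Liminf_iff by blast
  moreover have "\<forall>\<^sub>F y in nhds x. c' - d < f y" using f d(1) by (intro order_tendstoD(1)[OF f]) simp
  ultimately show ?thesis
  proof eventually_elim
    case (elim y)
    then have "ereal c' < q y + ereal (f y)" by (cases "q y") auto
    then show ?case using c'(1) less_trans by blast
  qed
qed

text \<open>If no point were minimal, each would have a neighbourhood on which the function exceeds
  some value taken in \<open>S\<close>. The least of the finitely many values from a subcover would
  then be exceeded by another of them.\<close>

lemma lsc_attains_inf:
  fixes q :: "'a::topological_space \<Rightarrow> ereal" and f :: "'a \<Rightarrow> real"
  assumes S: "compact S" "S \<noteq> {}" and q: "\<And>x. x \<in> S \<Longrightarrow> lsc_at q x"
    and f: "\<And>x. (f \<longlongrightarrow> f x) (nhds x)"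
  shows "\<exists>x\<in>S. \<forall>y\<in>S. q x + ereal (f x) \<le> q y + ereal (f y)"
proof (rule ccontr)
  assume neg: "\<not> ?thesis"
  let ?g = "\<lambda>x. q x + ereal (f x)"
  have "\<exists>U y. open U \<and> x \<in> U \<and> y \<in> S \<and> (\<forall>x'\<in>U. ?g y < ?g x')" if x: "x \<in> S" for x
  proof -
    obtain y where y: "y \<in> S" "?g y < ?g x" using neg x by (auto simp: not_le)
    have "\<forall>\<^sub>F x' in nhds x. ?g y < ?g x'" by (rule lsc_at_add_continuous[OF q[OF x] f y(2)])
    then show ?thesis using y unfolding eventually_nhds by blast
  qed
  then obtain U y where U: "\<And>x. x \<in> S \<Longrightarrow> open (U x)" "\<And>x. x \<in> S \<Longrightarrow> x \<in> U x"
    and y: "\<And>x. x \<in> S \<Longrightarrow> y x \<in> S" "\<And>x x'. x \<in> S \<Longrightarrow> x' \<in> U x \<Longrightarrow> ?g (y x) < ?g x'"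
    by metis
  obtain S' where S': "S' \<subseteq> S" "finite S'" "S \<subseteq> (\<Union>x\<in>S'. U x)"
    by (rule compactE_image[OF S(1), of S U]) (use U in auto)
  have "S' \<noteq> {}" using S' S(2) by auto
  let ?V = "(\<lambda>x. ?g (y x)) ` S'"
  have "Min ?V \<in> ?V" using S' \<open>S' \<noteq> {}\<close> by (intro Min_in) auto
  then obtain x where x: "x \<in> S'" "Min ?V = ?g (y x)" by auto
  have "y x \<in> S" using x S' y by auto
  then obtain x2 where x2: "x2 \<in> S'" "y x \<in> U x2" using S' by blast
  have "?g (y x2) < ?g (y x)" using y(2) x2 S' by blast
  moreover have "Min ?V \<le> ?g (y x2)" using x2 S' by (intro Min_le) auto
  ultimately show False using x by simp
qed

text \<open>A Brouwer fixed point of the projection of \<open>u - (f u - v)\<close> solves a variational inequality;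
  testing it at the centre shows that the point is interior, hence \<open>f u = v\<close>.\<close>

lemma strongly_monotone_attains:
  fixes f :: "'a::euclidean_space \<Rightarrow> 'a"
  assumes cont: "continuous_on (cball a R) f" and R: "R > 0" and c: "c > 0"
    and mono: "\<And>u. u \<in> cball a R \<Longrightarrow> (f u - f a) \<bullet> (u - a) \<ge> c * (norm (u - a))\<^sup>2"
    and v: "norm (v - f a) < c * R"
  obtains u where "f u = v" "norm (u - a) \<le> norm (v - f a) / c"
proof -
  let ?S = "cball a R"
  define g where "g u = closest_point ?S (u - (f u - v))" for u
  have S: "closed ?S" "convex ?S" "?S \<noteq> {}" using R by auto
  have "continuous_on ?S g"
    unfolding g_def
    by (intro continuous_on_compose2[OF continuous_on_closest_point[OF S(2,1,3), of UNIV]] continuous_intros cont) auto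
  moreover have "g \<in> ?S \<rightarrow> ?S" unfolding g_def using closest_point_in_set[OF S(1,3)] by auto
  ultimately obtain u where u: "u \<in> ?S" "g u = u"
    using brouwer[of ?S g] S by (metis compact_cball)
  have vi: "(f u - v) \<bullet> (w - u) \<ge> 0" if "w \<in> ?S" for w
    using closest_point_dot[OF S(2,1) that, of "u - (f u - v)"] u(2)
    by (simp add: g_def inner_diff_left)
  have "c * (norm (u - a))\<^sup>2 \<le> (f u - f a) \<bullet> (u - a)" by (rule mono[OF u(1)])
  also have "\<dots> \<le> (v - f a) \<bullet> (u - a)"
    using vi[of a] R by (simp add: inner_diff_left inner_diff_right)
  also have "\<dots> \<le> norm (v - f a) * norm (u - a)" by (rule norm_cauchy_schwarz)
  finally have "norm (u - a) * (c * norm (u - a)) \<le> norm (u - a) * norm (v - f a)"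
    by (simp add: power2_eq_square mult_ac)
  then have le: "c * norm (u - a) \<le> norm (v - f a)"
    by (cases "u = a") auto
  then have "c * norm (u - a) < c * R" using v by linarith
  then have lt: "norm (u - a) < R" using c by simp
  have "f u = v"
  proof (rule ccontr)
    assume ne: "f u \<noteq> v"
    \<comment> \<open>The longest step that the triangle inequality still keeps inside the
      ball.\<close>
    define s where "s = (R - norm (u - a)) / norm (f u - v)"
    have s: "s > 0" using lt ne by (simp add: s_def)
    have "norm (u - s *\<^sub>R (f u - v) - a) \<le> norm (u - a) + norm (s *\<^sub>R (f u - v))"
      using norm_triangle_ineq4[of "u - a" "s *\<^sub>R (f u - v)"] by (simp add: algebra_simps)
    also have "norm (s *\<^sub>R (f u - v)) = R - norm (u - a)" using s ne lt by (simp add: s_def)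
    finally have "u - s *\<^sub>R (f u - v) \<in> ?S" by (simp add: dist_norm norm_minus_commute)
    from vi[OF this] have "s * ((f u - v) \<bullet> (f u - v)) \<le> 0" by simp
    then have "(f u - v) \<bullet> (f u - v) \<le> 0" using s by (simp add: mult_le_0_iff)
    moreover have "(f u - v) \<bullet> (f u - v) > 0" using ne by (simp add: inner_gt_zero_iff)
    ultimately show False by linarith
  qed
  moreover have "norm (u - a) \<le> norm (v - f a) / c" using le c by (simp add: pos_le_divide_eq mult.commute)
  ultimately show ?thesis by (rule that)
qed

text \<open>Subdivide the segment into \<open>N\<close> pieces: the quadratic errors add up to \<open>O(1/N)\<close>.\<close>

lemma gradient_inequality_of_monotone:
  fixes \<phi> :: "'a::real_inner \<Rightarrow> real" and Q :: "'a \<Rightarrow> 'a"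
  assumes S: "convex S" and u: "u \<in> S" "u' \<in> S"
    and upper: "\<And>a b. a \<in> S \<Longrightarrow> b \<in> S \<Longrightarrow> \<phi> a - \<phi> b \<ge> Q a \<bullet> (a - b) - (norm (a - b))\<^sup>2 / 2"
    and mono: "\<And>a b. a \<in> S \<Longrightarrow> b \<in> S \<Longrightarrow> (Q a - Q b) \<bullet> (a - b) \<ge> 0"
  shows "\<phi> u - \<phi> u' \<ge> Q u' \<bullet> (u - u')"
proof -
  have bound: "\<phi> u - \<phi> u' \<ge> Q u' \<bullet> (u - u') - (norm (u - u'))\<^sup>2 / 2 * inverse (real (Suc m))" for m
  proof -
    let ?N = "Suc m"
    define x where "x k = u' + (real k / ?N) *\<^sub>R (u - u')" for k
    have xS: "x k \<in> S" if "k \<le> ?N" for k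
    proof -
      have "(1 - real k / ?N) *\<^sub>R u' + (real k / ?N) *\<^sub>R u \<in> S"
        by (rule convexD[OF S u(2,1)]) (use that in auto)
      then show ?thesis by (simp add: x_def algebra_simps)
    qed
    have diff: "x (Suc k) - x k = (1 / ?N) *\<^sub>R (u - u')" for k
      by (simp add: x_def scaleR_diff_left[symmetric] diff_divide_distrib[symmetric])
    have step: "\<phi> (x (Suc k)) - \<phi> (x k) \<ge> (Q u' \<bullet> (u - u') - (norm (u - u'))\<^sup>2 / 2 / ?N) / ?N" if "k < ?N" for k
    proof -
      have x0: "x 0 = u'" by (simp add: x_def)
      \<comment> \<open>Each node is compared with the starting point \<open>u'\<close>, not with
        its predecessor: this bounds the slope on every piece by that at \<open>u'\<close>.\<close>
      have "0 \<le> (Q (x (Suc k)) - Q u') \<bullet> (x (Suc k) - u')"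
        using mono[OF xS[of "Suc k"] xS[of 0]] that x0 by simp
      also have "x (Suc k) - u' = (real (Suc k) / ?N) *\<^sub>R (u - u')" by (simp add: x_def)
      finally have "0 \<le> (real (Suc k) / ?N) * ((Q (x (Suc k)) - Q u') \<bullet> (u - u'))" by simp
      then have "0 \<le> (Q (x (Suc k)) - Q u') \<bullet> (u - u')"
        by (simp add: zero_le_mult_iff zero_le_divide_iff del: of_nat_Suc)
      then have "Q u' \<bullet> (u - u') / ?N \<le> Q (x (Suc k)) \<bullet> (x (Suc k) - x k)"
        unfolding diff by (simp add: inner_diff_left divide_right_mono del: of_nat_Suc)
      moreover have "(norm (x (Suc k) - x k))\<^sup>2 / 2 = (norm (u - u'))\<^sup>2 / 2 / ?N / ?N"
        unfolding diff by (simp add: power2_eq_square del: of_nat_Suc)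
      moreover have "\<phi> (x (Suc k)) - \<phi> (x k) \<ge> Q (x (Suc k)) \<bullet> (x (Suc k) - x k) - (norm (x (Suc k) - x k))\<^sup>2 / 2"
        by (rule upper) (use xS that in auto)
      ultimately show ?thesis unfolding diff_divide_distrib by linarith
    qed
    have "(\<Sum>k<?N. (Q u' \<bullet> (u - u') - (norm (u - u'))\<^sup>2 / 2 / ?N) / ?N) \<le> (\<Sum>k<?N. \<phi> (x (Suc k)) - \<phi> (x k))"
      using step by (intro sum_mono) auto
    also have "\<dots> = \<phi> (x ?N) - \<phi> (x 0)" by (rule sum_lessThan_telescope)
    also have "\<dots> = \<phi> u - \<phi> u'" by (simp add: x_def del: of_nat_Suc)
    also have "(\<Sum>k<?N. (Q u' \<bullet> (u - u') - (norm (u - u'))\<^sup>2 / 2 / ?N) / ?N)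
        = Q u' \<bullet> (u - u') - (norm (u - u'))\<^sup>2 / 2 / ?N"
      unfolding sum_constant by (simp del: of_nat_Suc)
    finally show ?thesis unfolding divide_inverse[of _ "real ?N"] .
  qed
  have "(\<lambda>m. Q u' \<bullet> (u - u') - (norm (u - u'))\<^sup>2 / 2 * inverse (real (Suc m)))
      \<longlonglongrightarrow> Q u' \<bullet> (u - u') - (norm (u - u'))\<^sup>2 / 2 * 0"
    by (intro tendsto_intros LIMSEQ_inverse_real_of_nat)
  then have "Q u' \<bullet> (u - u') - (norm (u - u'))\<^sup>2 / 2 * 0 \<le> \<phi> u - \<phi> u'"
    by (rule LIMSEQ_le_const2) (use bound in auto)
  then show ?thesis by simp
qed

section \<open>Prox-regular functions and tilted minimizers\<close>

lemma mem_tilt_argmin: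
  "x \<in> tilt_argmin q xbar \<gamma> v \<longleftrightarrow>
    x \<in> cball xbar \<gamma> \<and> (\<forall>y\<in>cball xbar \<gamma>. q x - ereal (v \<bullet> x) \<le> q y - ereal (v \<bullet> y))"
  by (auto simp: tilt_argmin_def is_arg_min_def not_less)

lemma tilt_argmin_interior_in_subdiff:
  assumes x: "x \<in> tilt_argmin q xbar \<gamma> v" "dist xbar x < \<gamma>" and fin: "\<bar>q x\<bar> \<noteq> \<infinity>"
  shows "v \<in> subdiff q x"
proof (rule proximal_subgradient_in_subdiff[where c = 0])
  show "0 < \<gamma> - dist xbar x" using x by simp
  fix y assume "y \<in> ball x (\<gamma> - dist xbar x)"
  then have "y \<in> cball xbar \<gamma>" using dist_triangle[of xbar y x] by simp
  then have "q x - ereal (v \<bullet> x) \<le> q y - ereal (v \<bullet> y)" using x(1) by (simp add: mem_tilt_argmin)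
  then show "q x + ereal (v \<bullet> (y - x) - 0 * (norm (y - x))\<^sup>2) \<le> q y"
    using fin by (cases "q x"; cases "q y") (auto simp: inner_diff_right)
qed (rule fin)

lemma norm_less_of_mem_ball_Pair:
  assumes "(x, y) \<in> ball (a, 0) e"
  shows "norm (x - a) < e" "norm y < e"
proof -
  have "norm (x - a, y) < e" using assms norm_minus_cancel[of "(x - a, y)"] by (simp add: dist_norm)
  then show "norm (x - a) < e" "norm y < e"
    using norm_fst_le[of "x - a" y] norm_snd_le[of y "x - a"] by linarith+
qed

text \<open>Prox-regularity restricted to one radius and without its condition on function values,
  which subdifferential continuity makes automatic near \<open>(xbar, 0)\<close>.\<close>

locale prox_setting =
  fixes q :: "real^'n \<Rightarrow> ereal" and xbar :: "real^'n" and \<epsilon> \<rho> :: real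
  assumes eps: "0 < \<epsilon>" and rho: "0 \<le> \<rho>" and base: "0 \<in> subdiff q xbar"
    and lsc: "\<And>x. x \<in> cball xbar \<epsilon> \<Longrightarrow> lsc_at q x"
    and prox: "\<And>x s y. s \<in> subdiff q x \<Longrightarrow> x \<in> cball xbar \<epsilon> \<Longrightarrow> norm s \<le> \<epsilon> \<Longrightarrow> y \<in> cball xbar \<epsilon> \<Longrightarrow>
      q x + ereal (s \<bullet> (y - x) - \<rho> / 2 * (norm (y - x))\<^sup>2) \<le> q y"
begin

text \<open>The margin 1 over \<open>\<rho>\<close> is what makes the proximal map nonexpansive and
  gives the factor 2 in \<open>px_near\<close>.\<close>

definition r :: real where "r = \<rho> + 1"

definition qr :: "real^'n \<Rightarrow> real" where "qr x = real_of_ereal (q x)"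

lemma r_ge: "r \<ge> 1" "r > 0" "r \<ge> 0" using rho by (auto simp: r_def)

lemma norm_par_less:
  assumes x: "norm (x - xbar) < e" and y: "norm y < e" and e: "e \<le> R / (1 + r)"
  shows "norm (y + r *\<^sub>R x - r *\<^sub>R xbar) < R"
proof -
  have "norm (y + r *\<^sub>R (x - xbar)) \<le> norm y + r * norm (x - xbar)"
    using norm_triangle_ineq[of y "r *\<^sub>R (x - xbar)"] r_ge by simp
  also have "\<dots> < e + r * e" using x y r_ge by (intro add_less_le_mono mult_left_mono) auto
  also have "\<dots> = e * (1 + r)" by (simp add: algebra_simps)
  also have "\<dots> \<le> R"
  proof -
    have "0 < 1 + r" using r_ge by linarith
    then show ?thesis using e by (simp only: pos_le_divide_eq)
  qed
  finally show ?thesis by (simp add: algebra_simps)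
qed

lemma qr: "\<bar>q x\<bar> \<noteq> \<infinity> \<Longrightarrow> q x = ereal (qr x)"
  by (cases "q x") (auto simp: qr_def)

lemma subdiff_finite: "s \<in> subdiff q x \<Longrightarrow> \<bar>q x\<bar> \<noteq> \<infinity>"
  by (auto simp: subdiff_def split: if_splits)

lemma xbar_finite: "\<bar>q xbar\<bar> \<noteq> \<infinity>"
  by (rule subdiff_finite[OF base])

lemma q_not_minf: "x \<in> cball xbar \<epsilon> \<Longrightarrow> q x \<noteq> - \<infinity>"
  using prox[OF base, of x] eps qr[OF xbar_finite] by auto

lemma q_finite: "x \<in> cball xbar \<epsilon> \<Longrightarrow> q x < \<infinity> \<Longrightarrow> \<bar>q x\<bar> \<noteq> \<infinity>"
  using q_not_minf[of x] by (cases "q x") auto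

lemma prox_real:
  assumes "s \<in> subdiff q x" "x \<in> cball xbar \<epsilon>" "norm s \<le> \<epsilon>" "y \<in> cball xbar \<epsilon>" "\<bar>q y\<bar> \<noteq> \<infinity>"
  shows "qr x + (s \<bullet> (y - x) - \<rho> / 2 * (norm (y - x))\<^sup>2) \<le> qr y"
  using prox[OF assms(1-4)] qr[OF assms(5)] qr[OF subdiff_finite[OF assms(1)]] by simp

text \<open>Sum of the two prox inequalities, from \<open>x\<close> to \<open>y\<close> and
  back.\<close>

lemma hypomonotone:
  assumes 1: "s \<in> subdiff q x" "x \<in> cball xbar \<epsilon>" "norm s \<le> \<epsilon>"
    and 2: "t \<in> subdiff q y" "y \<in> cball xbar \<epsilon>" "norm t \<le> \<epsilon>"
  shows "(s - t) \<bullet> (x - y) \<ge> - \<rho> * (norm (x - y))\<^sup>2"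
  using prox_real[OF 1 2(2) subdiff_finite[OF 2(1)]] prox_real[OF 2 1(2) subdiff_finite[OF 1(1)]]
  by (simp add: inner_diff_left inner_diff_right norm_minus_commute algebra_simps)

section \<open>The localised proximal map\<close>

definition obj :: "real^'n \<Rightarrow> real^'n \<Rightarrow> real" where
  "obj u x = r / 2 * (norm x)\<^sup>2 - u \<bullet> x"

text \<open>Compactness of the ball gives a minimizer for every \<open>u\<close>; near
  \<open>r *\<^sub>R xbar\<close> the choice is pinned down by \<open>px_unique\<close>.\<close>

definition px :: "real^'n \<Rightarrow> real^'n" where
  "px u = (SOME x. x \<in> cball xbar \<epsilon> \<and> (\<forall>y\<in>cball xbar \<epsilon>. q x + ereal (obj u x) \<le> q y + ereal (obj u y)))"

lemma px: "px u \<in> cball xbar \<epsilon>" "y \<in> cball xbar \<epsilon> \<Longrightarrow> q (px u) + ereal (obj u (px u)) \<le> q y + ereal (obj u y)"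
proof -
  have cont: "(obj u \<longlongrightarrow> obj u x) (nhds x)" for x
    using continuous_on_tendsto_compose[of UNIV "obj u" "\<lambda>x. x" x "nhds x"]
    unfolding obj_def[abs_def] by (auto intro!: tendsto_intros filterlim_ident)
  have "\<exists>x\<in>cball xbar \<epsilon>. \<forall>y\<in>cball xbar \<epsilon>. q x + ereal (obj u x) \<le> q y + ereal (obj u y)"
    by (rule lsc_attains_inf[OF compact_cball _ lsc cont]) (use eps in auto)
  then have "\<exists>x. x \<in> cball xbar \<epsilon> \<and> (\<forall>y\<in>cball xbar \<epsilon>. q x + ereal (obj u x) \<le> q y + ereal (obj u y))"
    by (simp only: Bex_def)
  from someI_ex[OF this, folded px_def] show "px u \<in> cball xbar \<epsilon>" "y \<in> cball xbar \<epsilon> \<Longrightarrow> q (px u) + ereal (obj u (px u)) \<le> q y + ereal (obj u y)"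
    by auto
qed

lemma px_finite: "\<bar>q (px u)\<bar> \<noteq> \<infinity>"
proof (rule q_finite[OF px(1)])
  show "q (px u) < \<infinity>" using px(2)[of xbar u] eps qr[OF xbar_finite] by (cases "q (px u)") auto
qed

lemma px_min: "y \<in> cball xbar \<epsilon> \<Longrightarrow> ereal (qr (px u) + obj u (px u) - obj u y) \<le> q y"
  using px(2)[of y u] qr[OF px_finite[of u]] q_not_minf[of y] by (cases "q y") auto

lemma px_min_real: "y \<in> cball xbar \<epsilon> \<Longrightarrow> \<bar>q y\<bar> \<noteq> \<infinity> \<Longrightarrow> qr (px u) + obj u (px u) \<le> qr y + obj u y"
  using px_min[of y u] qr[of y] by simp

lemma obj_diff: "obj u y - obj u x = (r *\<^sub>R x - u) \<bullet> (y - x) + r / 2 * (norm (y - x))\<^sup>2"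
  unfolding obj_def power2_norm_eq_inner
  by (simp add: inner_diff_left inner_diff_right inner_commute algebra_simps)

text \<open>Since 0 is a subgradient at \<open>xbar\<close>, the function \<open>q\<close> falls by
  at most \<open>\<rho> / 2\<close> times the squared distance from \<open>xbar\<close>. Against the
  term with \<open>r / 2\<close> a growth of half the squared distance remains.\<close>

lemma px_near: "norm (px u - xbar) \<le> 2 * norm (u - r *\<^sub>R xbar)"
proof -
  let ?d = "px u - xbar"
  have "qr (px u) + obj u (px u) \<le> qr xbar + obj u xbar"
    by (rule px_min_real) (use eps xbar_finite in auto)
  moreover have "qr xbar - \<rho> / 2 * (norm ?d)\<^sup>2 \<le> qr (px u)"
    using prox_real[OF base, of "px u"] px(1) px_finite eps by simp
  moreover have "obj u (px u) - obj u xbar = (r *\<^sub>R xbar - u) \<bullet> ?d + r / 2 * (norm ?d)\<^sup>2" by (rule obj_diff)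
  moreover have "- ((r *\<^sub>R xbar - u) \<bullet> ?d) \<le> norm (u - r *\<^sub>R xbar) * norm ?d"
    using norm_cauchy_schwarz[of "u - r *\<^sub>R xbar" ?d] by (simp add: inner_diff_left)
  ultimately have "r / 2 * (norm ?d)\<^sup>2 - \<rho> / 2 * (norm ?d)\<^sup>2 \<le> norm (u - r *\<^sub>R xbar) * norm ?d" by linarith
  then have "norm ?d * norm ?d \<le> norm ?d * (2 * norm (u - r *\<^sub>R xbar))"
    by (simp add: r_def power2_eq_square algebra_simps)
  then show ?thesis by (cases "?d = 0") auto
qed

text \<open>If \<open>u\<close> is closer than this to \<open>r *\<^sub>R xbar\<close>, then 2 and
  \<open>1 + 2 * r\<close> times that distance are below \<open>\<epsilon>\<close>: by
  \<open>px_near\<close>, \<open>px u\<close> is interior and \<open>u - r *\<^sub>R px u\<close> is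
  a subgradient of admissible size.\<close>

definition \<delta>0 :: real where "\<delta>0 = \<epsilon> / (2 + 2 * r)"

lemma delta0: "0 < \<delta>0" using eps r_ge by (simp add: \<delta>0_def)

lemma px_subdiff:
  assumes u: "u \<in> ball (r *\<^sub>R xbar) \<delta>0"
  shows "norm (px u - xbar) < \<epsilon>" "norm (u - r *\<^sub>R px u) \<le> \<epsilon>" "u - r *\<^sub>R px u \<in> subdiff q (px u)"
proof -
  let ?w = "u - r *\<^sub>R xbar"
  have w: "norm ?w * (2 + 2 * r) < \<epsilon>"
    using u r_ge by (simp add: \<delta>0_def dist_norm norm_minus_commute pos_less_divide_eq)
  have w0: "0 \<le> norm ?w * r" using r_ge by simp
  show 1: "norm (px u - xbar) < \<epsilon>" using px_near[of u] w w0 by (simp add: algebra_simps)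
  have "norm (u - r *\<^sub>R px u) = norm (?w - r *\<^sub>R (px u - xbar))" by (simp add: algebra_simps)
  also have "\<dots> \<le> norm ?w + r * norm (px u - xbar)"
    using norm_triangle_ineq4[of ?w "r *\<^sub>R (px u - xbar)"] r_ge by simp
  also have "\<dots> \<le> norm ?w + r * (2 * norm ?w)" using px_near[of u] r_ge by (intro add_left_mono mult_left_mono) auto
  also have "\<dots> \<le> \<epsilon>" using w norm_ge_zero[of ?w] by (simp add: algebra_simps del: norm_ge_zero)
  finally show "norm (u - r *\<^sub>R px u) \<le> \<epsilon>" .
  show "u - r *\<^sub>R px u \<in> subdiff q (px u)"
  proof (rule proximal_subgradient_in_subdiff)
    show "\<bar>q (px u)\<bar> \<noteq> \<infinity>" by (rule px_finite)
    show "0 < \<epsilon> - norm (px u - xbar)" using 1 by simp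
    fix y assume "y \<in> ball (px u) (\<epsilon> - norm (px u - xbar))"
    then have "y \<in> cball xbar \<epsilon>"
      using dist_triangle[of xbar y "px u"] by (simp add: dist_norm norm_minus_commute)
    from px_min[OF this, of u] have "ereal (qr (px u) - (obj u y - obj u (px u))) \<le> q y"
      by (simp add: algebra_simps)
    then show "q (px u) + ereal ((u - r *\<^sub>R px u) \<bullet> (y - px u) - r / 2 * (norm (y - px u))\<^sup>2) \<le> q y"
      unfolding obj_diff by (simp add: qr[OF px_finite] inner_diff_left algebra_simps)
  qed
qed

text \<open>Subgradients with the same parameter \<open>s + r *\<^sub>R x\<close> differ by
  \<open>- r\<close> times the difference of their base points. Hypomonotonicity with
  \<open>\<rho> < r\<close> allows this only when the base points agree.\<close>

lemma px_unique:
  assumes s: "s \<in> subdiff q x" "x \<in> cball xbar \<epsilon>" "norm s \<le> \<epsilon>" and u: "s + r *\<^sub>R x \<in> ball (r *\<^sub>R xbar) \<delta>0"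
  shows "px (s + r *\<^sub>R x) = x"
proof -
  let ?p = "px (s + r *\<^sub>R x)"
  have "(s - (s + r *\<^sub>R x - r *\<^sub>R ?p)) \<bullet> (x - ?p) \<ge> - \<rho> * (norm (x - ?p))\<^sup>2"
    by (rule hypomonotone[OF s px_subdiff(3)[OF u] px(1) px_subdiff(2)[OF u]])
  moreover have "s - (s + r *\<^sub>R x - r *\<^sub>R ?p) = - r *\<^sub>R (x - ?p)" by (simp add: algebra_simps)
  ultimately have "- r * (norm (x - ?p))\<^sup>2 \<ge> - \<rho> * (norm (x - ?p))\<^sup>2" by (simp add: power2_norm_eq_inner)
  then have "(norm (x - ?p))\<^sup>2 \<le> 0" by (simp add: r_def algebra_simps)
  then show ?thesis by simp
qed

lemma px_lipschitz:
  assumes u: "u \<in> ball (r *\<^sub>R xbar) \<delta>0" "v \<in> ball (r *\<^sub>R xbar) \<delta>0"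
  shows "norm (px u - px v) \<le> norm (u - v)"
proof -
  let ?d = "px u - px v"
  have "((u - r *\<^sub>R px u) - (v - r *\<^sub>R px v)) \<bullet> ?d \<ge> - \<rho> * (norm ?d)\<^sup>2"
    by (rule hypomonotone[OF px_subdiff(3)[OF u(1)] px(1) px_subdiff(2)[OF u(1)]
        px_subdiff(3)[OF u(2)] px(1) px_subdiff(2)[OF u(2)]])
  moreover have "(u - r *\<^sub>R px u) - (v - r *\<^sub>R px v) = (u - v) - r *\<^sub>R ?d" by (simp add: algebra_simps)
  ultimately have "(u - v) \<bullet> ?d - r * (norm ?d)\<^sup>2 \<ge> - \<rho> * (norm ?d)\<^sup>2"
    by (simp add: power2_norm_eq_inner inner_diff_left[of "u - v"])
  then have "(norm ?d)\<^sup>2 \<le> (u - v) \<bullet> ?d" by (simp add: r_def algebra_simps)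
  also have "\<dots> \<le> norm (u - v) * norm ?d" by (rule norm_cauchy_schwarz)
  finally show ?thesis by (cases "?d = 0") (auto simp: power2_eq_square)
qed

text \<open>Retracting onto a ball first extends \<open>px\<close> from a neighbourhood to a
  nonexpansive map on the whole space. Half the radius keeps the closed ball inside the open ball of
  radius \<open>\<delta>0\<close>.\<close>

definition P :: "real^'n \<Rightarrow> real^'n" where
  "P u = px (closest_point (cball (r *\<^sub>R xbar) (\<delta>0 / 2)) u)"

lemma P_eq: "u \<in> cball (r *\<^sub>R xbar) (\<delta>0 / 2) \<Longrightarrow> P u = px u"
  by (simp add: P_def closest_point_self)

lemma P_lipschitz: "1-lipschitz_on UNIV P"
proof (rule lipschitz_onI)
  fix u v
  let ?S = "cball (r *\<^sub>R xbar) (\<delta>0 / 2)" 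
  have S: "convex ?S" "closed ?S" "?S \<noteq> {}" using delta0 by auto
  have sub: "?S \<subseteq> ball (r *\<^sub>R xbar) \<delta>0" using delta0 by auto
  have "norm (P u - P v) \<le> norm (closest_point ?S u - closest_point ?S v)"
    unfolding P_def using subsetD[OF sub closest_point_in_set[OF S(2,3)]] by (intro px_lipschitz)
  also have "\<dots> \<le> norm (u - v)" using closest_point_lipschitz[OF S, of u v] by (simp add: dist_norm)
  finally show "dist (P u) (P v) \<le> 1 * dist u v" by (simp add: dist_norm)
qed simp

definition \<eta> :: real where "\<eta> = min \<epsilon> (\<delta>0 / 2 / (1 + r))"

lemma near_base:
  assumes "(x, y) \<in> ball (xbar, 0) \<eta>"
  shows "x \<in> cball xbar \<epsilon>" "norm y \<le> \<epsilon>" "y + r *\<^sub>R x \<in> cball (r *\<^sub>R xbar) (\<delta>0 / 2)"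
proof -
  have x: "norm (x - xbar) < \<eta>" and y: "norm y < \<eta>"
    using norm_less_of_mem_ball_Pair[OF assms] by auto
  then show "x \<in> cball xbar \<epsilon>" "norm y \<le> \<epsilon>" by (auto simp: \<eta>_def dist_norm norm_minus_commute)
  have "norm (y + r *\<^sub>R x - r *\<^sub>R xbar) < \<delta>0 / 2" by (rule norm_par_less[OF x y]) (simp add: \<eta>_def)
  then show "y + r *\<^sub>R x \<in> cball (r *\<^sub>R xbar) (\<delta>0 / 2)"
    by (simp add: dist_norm norm_minus_commute)
qed

lemma base_gph: "(xbar, 0) \<in> gph (subdiff q)"
  using base by (simp add: gph_def)

sublocale lp: lipschitz_local_param "subdiff q" "(xbar, 0)" r \<eta> 1 P
proof
  show "0 < \<eta>" using eps delta0 r_ge by (simp add: \<eta>_def)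
  show "y \<in> subdiff q x \<longleftrightarrow> P (y + r *\<^sub>R x) = x" if xy: "(x, y) \<in> ball (xbar, 0) \<eta>" for x y
  proof -
    note n = near_base[OF xy]
    have u: "y + r *\<^sub>R x \<in> ball (r *\<^sub>R xbar) \<delta>0" using n(3) delta0 by auto
    have "y \<in> subdiff q x" if "px (y + r *\<^sub>R x) = x"
      using px_subdiff(3)[OF u] unfolding that by simp
    then show ?thesis using px_unique[OF _ n(1,2) u] P_eq[OF n(3)] by auto
  qed
qed (use r_ge P_lipschitz base_gph in auto)

text \<open>The Fenchel conjugate of \<open>q + r/2 |.|^2\<close> restricted to the ball.\<close>

definition env :: "real^'n \<Rightarrow> real" where
  "env u = - (qr (px u) + obj u (px u))"

lemma env_ge:
  assumes "y \<in> cball xbar \<epsilon>"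
  shows "ereal (- env u - obj u y) \<le> q y"
  using px_min[OF assms, of u] by (simp only: env_def minus_minus)

lemma env_subgradient: "env v \<ge> env u + (v - u) \<bullet> px u"
  using px_min_real[OF px(1) px_finite, of v u] by (simp add: env_def obj_def inner_diff_left)

lemma px_base: "px (r *\<^sub>R xbar) = xbar"
  using px_near[of "r *\<^sub>R xbar"] by simp

lemma tilt_radius_of_strongly_monotone:
  assumes c: "0 < c" and \<delta>: "0 < \<delta>"
    and mono: "\<And>u v. u \<in> ball (r *\<^sub>R xbar) \<delta> \<Longrightarrow> v \<in> ball (r *\<^sub>R xbar) \<delta> \<Longrightarrow>
      ((u - r *\<^sub>R px u) - (v - r *\<^sub>R px v)) \<bullet> (u - v) \<ge> c * (norm (u - v))\<^sup>2"
  shows "\<exists>\<gamma>. tilt_radius q xbar \<gamma>"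
proof -
  define ub where "ub = r *\<^sub>R xbar"
  define Q where "Q u = u - r *\<^sub>R px u" for u
  define R where "R = min \<delta> \<delta>0 / 2"
  have R: "0 < R" "R < \<delta>" "R < \<delta>0" using \<delta> delta0 by (auto simp: R_def)
  have RD: "u \<in> cball ub R \<Longrightarrow> u \<in> ball ub \<delta> \<and> u \<in> ball ub \<delta>0" for u using R by auto
  have Qb: "Q ub = 0" by (simp add: Q_def ub_def px_base)
  have Qm: "(Q u - Q v) \<bullet> (u - v) \<ge> c * (norm (u - v))\<^sup>2" if "u \<in> cball ub R" "v \<in> cball ub R" for u v
    unfolding Q_def using mono RD that unfolding ub_def by blast
  have Qlip: "norm (u - v) \<le> norm (Q u - Q v) / c" if "u \<in> cball ub R" "v \<in> cball ub R" for u v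
  proof -
    have "c * (norm (u - v))\<^sup>2 \<le> norm (Q u - Q v) * norm (u - v)"
      using Qm[OF that] norm_cauchy_schwarz order_trans by blast
    then have "norm (u - v) * (c * norm (u - v)) \<le> norm (u - v) * norm (Q u - Q v)"
      by (simp add: power2_eq_square mult_ac)
    then have "c * norm (u - v) \<le> norm (Q u - Q v)" by (cases "u = v") auto
    then show ?thesis using c by (simp add: pos_le_divide_eq mult.commute)
  qed
  have contQ: "continuous_on (cball ub R) Q"
  proof -
    have "1-lipschitz_on (cball ub R) px"
      by (rule lipschitz_onI) (use px_lipschitz RD in \<open>auto simp: dist_norm ub_def\<close>)
    then show ?thesis unfolding Q_def by (intro continuous_intros lipschitz_on_continuous_on)
  qed
  have "\<exists>u. Q u = v \<and> norm (u - ub) \<le> norm v / c \<and> u \<in> cball ub R" if v: "norm v < c * R" for v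
  proof -
    obtain u where u: "Q u = v" "norm (u - ub) \<le> norm (v - Q ub) / c"
      by (rule strongly_monotone_attains[OF contQ R(1) c, of v]) (use Qm[of _ ub] R v Qb in auto)
    have "norm (v - Q ub) / c < R" using v c by (simp add: Qb pos_divide_less_eq mult.commute)
    then show ?thesis using u Qb by (intro exI[of _ u]) (auto simp: dist_norm norm_minus_commute)
  qed
  then obtain U where U: "\<And>v. norm v < c * R \<Longrightarrow> Q (U v) = v"
    "\<And>v. norm v < c * R \<Longrightarrow> norm (U v - ub) \<le> norm v / c" "\<And>v. norm v < c * R \<Longrightarrow> U v \<in> cball ub R"
    by metis
  define M where "M v = px (U v)" for v
  have UM: "U v = r *\<^sub>R M v + v" if "norm v < c * R" for v
    using U(1)[OF that] by (simp add: Q_def M_def algebra_simps)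
  \<comment> \<open>Two radii: \<open>\<gamma>2\<close> keeps the parameter
    \<open>r *\<^sub>R x + v\<close> in the ball where \<open>Q\<close> is controlled, and
    minimizers over the half radius \<open>\<gamma>1\<close> are interior to the larger ball, where
    the first-order condition is available.\<close>
  define \<gamma>2 where "\<gamma>2 = min \<epsilon> (R / (2 * r))"
  define \<gamma>1 where "\<gamma>1 = \<gamma>2 / 2"
  \<comment> \<open>In order: \<open>c * R\<close> for the existence of \<open>U v\<close>,
    \<open>R / 2\<close> for \<open>uR\<close>, \<open>\<epsilon>\<close> for
    \<open>px_unique\<close>, and \<open>c * \<gamma>1\<close> so that \<open>M v\<close> falls
    within \<open>\<gamma>1\<close> of \<open>xbar\<close>.\<close>
  define \<delta>3 where "\<delta>3 = min (min (c * R) (R / 2)) (min \<epsilon> (c * \<gamma>1))"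
  have g2: "0 < \<gamma>2" using eps R r_ge by (simp add: \<gamma>2_def)
  then have g: "0 < \<gamma>1" "\<gamma>1 < \<gamma>2" "\<gamma>2 \<le> \<epsilon>" by (auto simp: \<gamma>1_def \<gamma>2_def)
  have d3: "0 < \<delta>3" using c R eps g by (auto simp: \<delta>3_def)
  have d3D: "norm v < c * R" "norm v < R / 2" "norm v < \<epsilon>" "norm v < c * \<gamma>1" if "norm v < \<delta>3" for v :: "real^'n"
    using that by (auto simp: \<delta>3_def)
  have uR: "r *\<^sub>R x + v \<in> cball ub R" if x: "x \<in> cball xbar \<gamma>2" and v: "norm v < \<delta>3" for x v
  proof -
    have "norm (r *\<^sub>R (x - xbar) + v) \<le> r * norm (x - xbar) + norm v"
      using norm_triangle_ineq[of "r *\<^sub>R (x - xbar)" v] r_ge by simp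
    also have "r * norm (x - xbar) \<le> r * (R / (2 * r))"
      using x r_ge by (intro mult_left_mono) (auto simp: \<gamma>2_def dist_norm norm_minus_commute)
    also have "r * (R / (2 * r)) = R / 2" using r_ge by simp
    finally have "norm (r *\<^sub>R (x - xbar) + v) \<le> R" using d3D(2)[OF v] by linarith
    then show ?thesis by (simp add: ub_def dist_norm norm_minus_commute algebra_simps)
  qed
  have Mnear: "norm (M v - xbar) < \<gamma>1" if v: "norm v < \<delta>3" for v
  proof -
    have "norm (px (U v) - px ub) \<le> norm (U v - ub)"
      using RD[OF U(3)[OF d3D(1)[OF v]]] delta0 unfolding ub_def by (intro px_lipschitz) auto
    also have "\<dots> \<le> norm v / c" by (rule U(2)[OF d3D(1)[OF v]])
    also have "\<dots> < \<gamma>1" using d3D(4)[OF v] c by (simp add: pos_divide_less_eq mult.commute)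
    finally show ?thesis by (simp add: M_def ub_def px_base)
  qed
  \<comment> \<open>This is \<open>r\<close> times the Moreau envelope of \<open>q\<close> on the
    ball, with weight \<open>r / 2\<close>, evaluated at \<open>u / r\<close>.\<close>
  define \<phi> where "\<phi> u = (norm u)\<^sup>2 / 2 - r * env u" for u
  have grad: "\<phi> u - \<phi> u' \<ge> Q u' \<bullet> (u - u')" if u: "u \<in> cball ub R" "u' \<in> cball ub R" for u u'
  proof (rule gradient_inequality_of_monotone[OF convex_cball u])
    fix a b assume ab: "a \<in> cball ub R" "b \<in> cball ub R"
    have "r * (env a + (b - a) \<bullet> px a) \<le> r * env b"
      using env_subgradient[of a b] r_ge by (intro mult_left_mono) auto
    then show "Q a \<bullet> (a - b) - (norm (a - b))\<^sup>2 / 2 \<le> \<phi> a - \<phi> b"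
      unfolding \<phi>_def Q_def power2_norm_eq_inner
      by (simp add: inner_diff_left inner_diff_right inner_commute algebra_simps add_divide_distrib diff_divide_distrib)
    have "0 \<le> c * (norm (a - b))\<^sup>2" using c by simp
    then show "0 \<le> (Q a - Q b) \<bullet> (a - b)" using Qm[OF ab] by linarith
  qed
  have min: "q (M v) - ereal (v \<bullet> M v) \<le> q x - ereal (v \<bullet> x)"
    if x: "x \<in> cball xbar \<gamma>2" and v: "norm v < \<delta>3" for x v
  proof -
    define u where "u = r *\<^sub>R x + v"
    define u0 where "u0 = U v"
    define x0 where "x0 = M v"
    have u0: "u0 = r *\<^sub>R x0 + v" unfolding u0_def x0_def by (rule UM[OF d3D(1)[OF v]])
    have "\<phi> u - \<phi> u0 \<ge> Q u0 \<bullet> (u - u0)"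
      unfolding u_def u0_def by (rule grad[OF uR[OF x v] U(3)[OF d3D(1)[OF v]]])
    also have "Q u0 = v" unfolding u0_def by (rule U(1)[OF d3D(1)[OF v]])
    finally have "r * env u \<le> (norm u)\<^sup>2 / 2 - (norm u0)\<^sup>2 / 2 + r * env u0 - v \<bullet> (u - u0)"
      by (simp add: \<phi>_def)
    also have "\<dots> = r * (r / 2 * (x \<bullet> x) - r / 2 * (x0 \<bullet> x0) + env u0)"
      unfolding u0 u_def power2_norm_eq_inner
      by (simp add: inner_add_left inner_add_right inner_diff_left inner_diff_right inner_commute algebra_simps
          add_divide_distrib diff_divide_distrib)
    finally have envu: "env u \<le> r / 2 * (x \<bullet> x) - r / 2 * (x0 \<bullet> x0) + env u0"
      using r_ge by (simp add: mult_le_cancel_left)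
    have "qr x0 = - env u0 - obj u0 x0" by (simp add: env_def x0_def M_def u0_def)
    then have q0: "qr x0 - v \<bullet> x0 = r / 2 * (x0 \<bullet> x0) - env u0"
      unfolding obj_def u0 power2_norm_eq_inner by (simp add: inner_add_left algebra_simps)
    have "obj u x = - (r / 2 * (x \<bullet> x)) - v \<bullet> x"
      unfolding obj_def u_def power2_norm_eq_inner by (simp add: inner_add_left algebra_simps)
    then have le: "qr x0 - v \<bullet> x0 \<le> - env u - obj u x - v \<bullet> x" using envu q0 by linarith
    have "ereal (- env u - obj u x) \<le> q x" by (rule env_ge) (use x g in auto)
    then have "ereal (- env u - obj u x) - ereal (v \<bullet> x) \<le> q x - ereal (v \<bullet> x)" by (rule ereal_minus_mono) simp
    moreover have "ereal (qr x0 - v \<bullet> x0) \<le> ereal (- env u - obj u x) - ereal (v \<bullet> x)" using le by simp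
    ultimately have "ereal (qr x0 - v \<bullet> x0) \<le> q x - ereal (v \<bullet> x)" by (rule order_trans[rotated])
    moreover have "q x0 - ereal (v \<bullet> x0) = ereal (qr x0 - v \<bullet> x0)"
      using qr[OF px_finite[of u0]] by (simp add: x0_def M_def u0_def)
    ultimately show ?thesis by (simp add: x0_def)
  qed
  have argmin: "tilt_argmin q xbar \<gamma>1 v = {M v}" if v: "norm v < \<delta>3" for v
  proof (intro equalityI subsetI)
    fix x assume "x \<in> {M v}"
    moreover have "M v \<in> cball xbar \<gamma>1" using Mnear[OF v] by (simp add: dist_norm norm_minus_commute)
    ultimately show "x \<in> tilt_argmin q xbar \<gamma>1 v" using min[OF _ v] g by (auto simp: mem_tilt_argmin)
  next
    fix x assume x: "x \<in> tilt_argmin q xbar \<gamma>1 v"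
    have Mv: "M v \<in> cball xbar \<gamma>1" using Mnear[OF v] by (simp add: dist_norm norm_minus_commute)
    have xM: "q x - ereal (v \<bullet> x) \<le> q (M v) - ereal (v \<bullet> M v)" using x Mv by (simp add: mem_tilt_argmin)
    have xg: "x \<in> cball xbar \<gamma>1" using x by (simp add: mem_tilt_argmin)
    have xe: "x \<in> cball xbar \<epsilon>" using xg g by auto
    have fin: "\<bar>q x\<bar> \<noteq> \<infinity>"
    proof (rule q_finite[OF xe])
      show "q x < \<infinity>" using xM qr[OF px_finite[of "U v"]] by (cases "q x") (auto simp: M_def)
    qed
    \<comment> \<open>\<open>M v\<close> is minimal over the larger ball, and \<open>x\<close> does
      at least as well as \<open>M v\<close>. This excludes trouble from minimizers on the boundary
      of the smaller ball.\<close>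
    have "x \<in> tilt_argmin q xbar \<gamma>2 v"
      using xM min[OF _ v] xg g by (force simp: mem_tilt_argmin intro: order_trans)
    then have sub: "v \<in> subdiff q x"
    proof (rule tilt_argmin_interior_in_subdiff)
      show "\<bar>q x\<bar> \<noteq> \<infinity>" by (rule fin)
    qed (use xg g in auto)
    have u: "v + r *\<^sub>R x \<in> cball ub R" using uR[OF _ v, of x] xg g by (simp add: add.commute)
    have "px (v + r *\<^sub>R x) = x"
      by (rule px_unique[OF sub xe]) (use d3D(3)[OF v] RD[OF u] in \<open>auto simp: ub_def\<close>)
    moreover from this have "Q (v + r *\<^sub>R x) = v" by (simp add: Q_def)
    then have "v + r *\<^sub>R x = U v"
      using Qlip[OF u U(3)[OF d3D(1)[OF v]]] U(1)[OF d3D(1)[OF v]] by simp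
    ultimately show "x \<in> {M v}" by (simp add: M_def)
  qed
  have M0: "M 0 = xbar"
  proof -
    have "norm (U 0 - ub) \<le> norm (0::real^'n) / c" by (rule U(2)) (use c R in simp)
    then show ?thesis by (simp add: M_def ub_def px_base)
  qed
  have "(1 / c)-lipschitz_on (ball 0 \<delta>3) (\<lambda>v. the_elem (tilt_argmin q xbar \<gamma>1 v))"
  proof (rule lipschitz_onI)
    fix v w :: "real^'n" assume "v \<in> ball 0 \<delta>3" "w \<in> ball 0 \<delta>3"
    then have vw: "norm v < \<delta>3" "norm w < \<delta>3" by auto
    note Uv = U(3)[OF d3D(1)[OF vw(1)]] and Uw = U(3)[OF d3D(1)[OF vw(2)]]
    have "norm (M v - M w) \<le> norm (U v - U w)"
      unfolding M_def using RD[OF Uv] RD[OF Uw] unfolding ub_def by (intro px_lipschitz) auto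
    also have "\<dots> \<le> norm (v - w) / c"
      using Qlip[OF Uv Uw] U(1)[OF d3D(1)[OF vw(1)]] U(1)[OF d3D(1)[OF vw(2)]] by simp
    finally show "dist (the_elem (tilt_argmin q xbar \<gamma>1 v)) (the_elem (tilt_argmin q xbar \<gamma>1 w)) \<le> 1 / c * dist v w"
      using vw by (simp add: argmin dist_norm)
  qed (use c in simp)
  moreover have "\<forall>v\<in>ball 0 \<delta>3. is_singleton (tilt_argmin q xbar \<gamma>1 v)" by (simp add: argmin)
  moreover have "tilt_argmin q xbar \<gamma>1 0 = {xbar}" using argmin[of 0] d3 M0 by simp
  ultimately have "tilt_radius q xbar \<gamma>1" unfolding tilt_radius_def using g d3 by blast
  then show ?thesis ..
qed

text \<open>A subgradient pair near \<open>(xbar, 0)\<close> is not known to come from a minimizer.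
  It is therefore matched with a pair \<open>(M v, v)\<close> having the same parameter, and
  hypomonotonicity identifies the two.\<close>

lemma local_param_of_tilt_radius:
  assumes tr: "tilt_radius q xbar \<gamma>"
  defines "M \<equiv> \<lambda>v. the_elem (tilt_argmin q xbar \<gamma> v)"
  obtains \<delta> \<eta>' K P' where "0 < \<delta>" "lipschitz_local_param (subdiff q) (xbar, 0) 0 \<eta>' K P'"
    "\<And>v. v \<in> ball 0 \<delta> \<Longrightarrow> P' v = M v"
    "\<And>v w. v \<in> ball 0 \<delta> \<Longrightarrow> w \<in> ball 0 \<delta> \<Longrightarrow> (M v - M w) \<bullet> (v - w) \<ge> 0"
proof -
  from tr obtain \<delta>1 K where g: "\<gamma> > 0" and d1: "\<delta>1 > 0" and sing: "\<And>v. v \<in> ball 0 \<delta>1 \<Longrightarrow> is_singleton (tilt_argmin q xbar \<gamma> v)"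
    and K: "K-lipschitz_on (ball 0 \<delta>1) M" and t0: "tilt_argmin q xbar \<gamma> 0 = {xbar}"
    unfolding tilt_radius_def M_def by blast
  have Mv: "tilt_argmin q xbar \<gamma> v = {M v}" if "v \<in> ball 0 \<delta>1" for v
    using sing[OF that] unfolding M_def by (metis is_singletonE the_elem_eq)
  have M0: "M 0 = xbar" using t0 by (simp add: M_def)
  have K0: "K \<ge> 0" using K by (simp add: lipschitz_on_def)
  \<comment> \<open>\<open>M v\<close> has to be interior to the ball of radius
    \<open>\<gamma>\<close>, to be stationary, and inside the ball where the prox inequality
    holds.\<close>
  define m where "m = min \<gamma> \<epsilon>"
  have m: "m > 0" using g eps by (simp add: m_def)
  \<comment> \<open>\<open>K + 1\<close> rather than \<open>K\<close>, which may be 0.\<close>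
  define \<delta>2 where "\<delta>2 = min (min \<delta>1 \<epsilon>) (m / (K + 1))"
  have d2: "\<delta>2 > 0" using d1 eps m K0 by (simp add: \<delta>2_def)
  have d2D: "v \<in> ball 0 \<delta>1" "norm v \<le> \<epsilon>" "norm (M v - xbar) < m" if v: "v \<in> ball 0 \<delta>2" for v
  proof -
    show v1: "v \<in> ball 0 \<delta>1" and "norm v \<le> \<epsilon>" using v by (auto simp: \<delta>2_def)
    have "norm (M v - M 0) \<le> K * norm v" using lipschitz_onD[OF K v1, of 0] d1 by (simp add: dist_norm)
    also have "\<dots> \<le> (K + 1) * norm v" by (intro mult_right_mono) auto
    also have "\<dots> < m" using v K0 by (simp add: \<delta>2_def pos_less_divide_eq mult.commute)
    finally show "norm (M v - xbar) < m" by (simp add: M0)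
  qed
  have Mcb: "M v \<in> cball xbar \<epsilon>" "M v \<in> cball xbar \<gamma>" "dist xbar (M v) < \<gamma>" if "v \<in> ball 0 \<delta>2" for v
    using d2D(3)[OF that] by (auto simp: m_def dist_norm norm_minus_commute)
  have Mmin: "q (M v) - ereal (v \<bullet> M v) \<le> q y - ereal (v \<bullet> y)" if "v \<in> ball 0 \<delta>2" "y \<in> cball xbar \<gamma>" for v y
  proof -
    have "M v \<in> tilt_argmin q xbar \<gamma> v" using Mv[OF d2D(1)[OF that(1)]] by simp
    then show ?thesis using that by (simp add: mem_tilt_argmin)
  qed
  have Mfin: "\<bar>q (M v)\<bar> \<noteq> \<infinity>" if v: "v \<in> ball 0 \<delta>2" for v
  proof (rule q_finite[OF Mcb(1)[OF v]])
    show "q (M v) < \<infinity>" using Mmin[OF v, of xbar] g qr[OF xbar_finite] by (cases "q (M v)") auto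
  qed
  have Msub: "v \<in> subdiff q (M v)" if v: "v \<in> ball 0 \<delta>2" for v
  proof (rule tilt_argmin_interior_in_subdiff)
    show "M v \<in> tilt_argmin q xbar \<gamma> v" using Mv[OF d2D(1)[OF v]] by simp
  qed (use Mcb(3)[OF v] Mfin[OF v] in auto)
  have mono: "(M v - M w) \<bullet> (v - w) \<ge> 0" if "v \<in> ball 0 \<delta>2" "w \<in> ball 0 \<delta>2" for v w
    using Mmin[OF that(1) Mcb(2)[OF that(2)]] Mmin[OF that(2) Mcb(2)[OF that(1)]]
      qr[OF Mfin[OF that(1)]] qr[OF Mfin[OF that(2)]]
    by (simp add: inner_diff_left inner_diff_right inner_commute)
  define R where "R = \<delta>2 / 2"
  have R: "R > 0" "\<And>v. v \<in> cball 0 R \<Longrightarrow> v \<in> ball (0::real^'n) \<delta>2" using d2 by (auto simp: R_def)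
  have unique: "M s = x" if s: "s \<in> subdiff q x" "x \<in> cball xbar \<epsilon>" "norm s \<le> \<epsilon>"
    and near: "norm (s + r *\<^sub>R x - r *\<^sub>R xbar) < R" for s x
  proof -
    have cont: "continuous_on (cball 0 R) (\<lambda>v. v + r *\<^sub>R M v)"
      by (intro continuous_intros continuous_on_subset[OF lipschitz_on_continuous_on[OF K]]) (use R d2D in auto)
    \<comment> \<open>Monotonicity of \<open>M\<close> gives the perturbed identity modulus 1, so
      the Brouwer argument applies with constant 1.\<close>
    obtain v where v: "v + r *\<^sub>R M v = s + r *\<^sub>R x" "norm (v - 0) \<le> norm (s + r *\<^sub>R x - (0 + r *\<^sub>R M 0)) / 1"
    proof (rule strongly_monotone_attains[OF cont R(1), of 1 "s + r *\<^sub>R x"])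
      fix u :: "real^'n" assume u: "u \<in> cball 0 R"
      have "0 \<le> r * ((M u - M 0) \<bullet> (u - 0))"
        using mono[of u 0] R(2)[OF u] d2 r_ge by (intro mult_nonneg_nonneg) auto
      then show "1 * (norm (u - 0))\<^sup>2 \<le> (u + r *\<^sub>R M u - (0 + r *\<^sub>R M 0)) \<bullet> (u - 0)"
        by (simp add: inner_add_left inner_diff_left power2_norm_eq_inner algebra_simps)
    qed (use near M0 in auto)
    have vR: "v \<in> cball 0 R" using v(2) near by (simp add: M0)
    note vd = R(2)[OF vR]
    have "(s - v) \<bullet> (x - M v) \<ge> - \<rho> * (norm (x - M v))\<^sup>2"
      by (rule hypomonotone[OF s Msub[OF vd] Mcb(1)[OF vd] d2D(2)[OF vd]])
    moreover have sv: "s - v = - r *\<^sub>R (x - M v)" using v(1) by (simp add: algebra_simps)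
    ultimately have "- r * (norm (x - M v))\<^sup>2 \<ge> - \<rho> * (norm (x - M v))\<^sup>2" by (simp add: power2_norm_eq_inner)
    then have "(norm (x - M v))\<^sup>2 \<le> 0" by (simp add: r_def algebra_simps)
    then have "x = M v" by simp
    then show ?thesis using sv by simp
  qed
  define P' where "P' v = M (closest_point (cball 0 R) v)" for v
  have S: "convex (cball (0::real^'n) R)" "closed (cball (0::real^'n) R)" "cball (0::real^'n) R \<noteq> {}"
    using R(1) by auto
  have P'M: "P' v = M v" if "v \<in> cball 0 R" for v using that by (simp add: P'_def closest_point_self)
  define \<eta>' where "\<eta>' = min \<epsilon> (R / (1 + r))"
  have "lipschitz_local_param (subdiff q) (xbar, 0) 0 \<eta>' K P'"
  proof
    show "0 < \<eta>'" using eps R(1) r_ge by (simp add: \<eta>'_def)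
    show "K-lipschitz_on UNIV P'"
    proof (rule lipschitz_onI[OF _ K0])
      fix u v
      have "dist (P' u) (P' v) \<le> K * dist (closest_point (cball 0 R) u) (closest_point (cball 0 R) v)"
        unfolding P'_def using closest_point_in_set[OF S(2,3)] R(2) d2D(1) by (intro lipschitz_onD[OF K]) blast+
      also have "\<dots> \<le> K * dist u v"
        by (intro mult_left_mono closest_point_lipschitz[OF S] K0)
      finally show "dist (P' u) (P' v) \<le> K * dist u v" .
    qed
    show "y \<in> subdiff q x \<longleftrightarrow> P' (y + 0 *\<^sub>R x) = x" if xy: "(x, y) \<in> ball (xbar, 0) \<eta>'" for x y
    proof -
      have x: "norm (x - xbar) < \<eta>'" and y: "norm y < \<eta>'"
        using norm_less_of_mem_ball_Pair[OF xy] by auto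
      have xe: "x \<in> cball xbar \<epsilon>" "norm y \<le> \<epsilon>" using x y by (auto simp: \<eta>'_def dist_norm norm_minus_commute)
      have near: "norm (y + r *\<^sub>R x - r *\<^sub>R xbar) < R" by (rule norm_par_less[OF x y]) (simp add: \<eta>'_def)
      have "R / (1 + r) \<le> R / 1" using r_ge R(1) by (intro divide_left_mono) auto
      then have yR: "y \<in> cball 0 R" using y by (simp add: \<eta>'_def)
      show ?thesis using unique[OF _ xe near] P'M[OF yR] Msub[OF R(2)[OF yR]] by auto
    qed
  qed (use base_gph in auto)
  then show ?thesis
  proof (rule that[OF R(1)])
    show "P' v = M v" if "v \<in> ball 0 R" for v using P'M that by auto
    show "(M v - M w) \<bullet> (v - w) \<ge> 0" if "v \<in> ball 0 R" "w \<in> ball 0 R" for v w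
      using that R(2) by (intro mono) auto
  qed
qed

end

section \<open>Tilt stability\<close>

lemma abs_diff_le_of_tendsto:
  fixes X :: "nat \<Rightarrow> ereal"
  assumes X: "X \<longlonglongrightarrow> ereal a" and e: "0 < e"
  shows "\<forall>\<^sub>F k in sequentially. \<bar>X k - ereal a\<bar> \<le> ereal e"
proof -
  have "\<forall>\<^sub>F k in sequentially. ereal (a - e) < X k" "\<forall>\<^sub>F k in sequentially. X k < ereal (a + e)"
    using e by (auto intro!: order_tendstoD[OF X])
  then show ?thesis
  proof eventually_elim
    case (elim k)
    then show ?case by (cases "X k") auto
  qed
qed

text \<open>The sequential definition in epsilon-delta form, ready to discharge the condition on
  function values in prox-regularity.\<close>

lemma subdiff_continuous_uniform:
  assumes sc: "subdiff_continuous q xbar 0" and fin: "\<bar>q xbar\<bar> \<noteq> \<infinity>" and e: "0 < e"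
  shows "\<exists>d>0. \<forall>x s. s \<in> subdiff q x \<and> dist xbar x < d \<and> dist 0 s < d \<longrightarrow> \<bar>q x - q xbar\<bar> \<le> ereal e"
proof (rule ccontr)
  assume neg: "\<not> ?thesis"
  have "\<exists>x s. s \<in> subdiff q x \<and> dist xbar x < inverse (real (Suc k)) \<and> dist 0 s < inverse (real (Suc k)) \<and>
      \<not> \<bar>q x - q xbar\<bar> \<le> ereal e" for k
  proof -
    have "inverse (real (Suc k)) > 0" by simp
    with neg show ?thesis by blast
  qed
  then obtain X S where XS: "\<And>k. S k \<in> subdiff q (X k)" "\<And>k. dist xbar (X k) < inverse (real (Suc k))"
    "\<And>k. dist 0 (S k) < inverse (real (Suc k))" "\<And>k. \<not> \<bar>q (X k) - q xbar\<bar> \<le> ereal e"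
    by metis
  have "X \<longlonglongrightarrow> xbar" "S \<longlonglongrightarrow> 0" using XS(2,3) by (auto intro: LIMSEQ_of_dist_less_inverse)
  moreover have "\<forall>k. (X k, S k) \<in> gph (subdiff q)" using XS(1) by (simp add: gph_def)
  ultimately have "(\<lambda>k. q (X k)) \<longlonglongrightarrow> q xbar" using sc unfolding subdiff_continuous_def by blast
  moreover obtain a where a: "q xbar = ereal a" using fin by (cases "q xbar") auto
  ultimately have "\<forall>\<^sub>F k in sequentially. \<bar>q (X k) - q xbar\<bar> \<le> ereal e"
    using abs_diff_le_of_tendsto[of "\<lambda>k. q (X k)" a e] e by simp
  then show False using XS(4) by simp
qed

lemma prox_setting_exists:
  fixes q :: "real^'n \<Rightarrow> ereal"
  assumes base: "0 \<in> subdiff q xbar" and pr: "prox_regular q xbar 0" and sc: "subdiff_continuous q xbar 0"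
  obtains \<epsilon> \<rho> where "prox_setting q xbar \<epsilon> \<rho>"
proof -
  have fin: "\<bar>q xbar\<bar> \<noteq> \<infinity>" using base by (auto simp: subdiff_def split: if_splits)
  from pr obtain e1 \<rho> where e1: "e1 > 0" and \<rho>: "\<rho> \<ge> 0"
    and prox: "\<And>x' x xs. x' \<in> cball xbar e1 \<Longrightarrow> x \<in> cball xbar e1 \<Longrightarrow> \<bar>q x - q xbar\<bar> \<le> ereal e1 \<Longrightarrow>
      xs \<in> subdiff q x \<inter> cball 0 e1 \<Longrightarrow> q x' \<ge> q x + ereal (xs \<bullet> (x' - x) - \<rho> / 2 * (norm (x' - x))\<^sup>2)"
    unfolding prox_regular_def by blast
  obtain d where d: "d > 0" "\<And>x s. s \<in> subdiff q x \<Longrightarrow> dist xbar x < d \<Longrightarrow> dist 0 s < d \<Longrightarrow> \<bar>q x - q xbar\<bar> \<le> ereal e1"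
    using subdiff_continuous_uniform[OF sc fin e1] by blast
  have "\<forall>\<^sub>F y in nhds xbar. lsc_at q y" using pr by (simp add: prox_regular_def locally_lsc_around_def)
  then obtain e2 where e2: "e2 > 0" "\<And>y. dist y xbar < e2 \<Longrightarrow> lsc_at q y"
    unfolding eventually_nhds_metric by blast
  define \<epsilon> where "\<epsilon> = min e1 (min (d / 2) (e2 / 2))"
  have \<epsilon>: "0 < \<epsilon>" "\<epsilon> \<le> e1" "\<epsilon> < d" "\<epsilon> < e2" using e1 d(1) e2(1) by (auto simp: \<epsilon>_def)
  have "prox_setting q xbar \<epsilon> \<rho>"
  proof
    show "lsc_at q x" if "x \<in> cball xbar \<epsilon>" for x using that \<epsilon> by (intro e2(2)) (auto simp: dist_commute)
    fix x s y
    assume s: "s \<in> subdiff q x" and x: "x \<in> cball xbar \<epsilon>" and ns: "norm s \<le> \<epsilon>" and y: "y \<in> cball xbar \<epsilon>"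
    have "\<bar>q x - q xbar\<bar> \<le> ereal e1"
      by (rule d(2)[OF s]) (use x ns \<epsilon> in auto)
    then show "q x + ereal (s \<bullet> (y - x) - \<rho> / 2 * (norm (y - x))\<^sup>2) \<le> q y"
      using s x y ns \<epsilon> by (intro prox) auto
  qed (use \<epsilon> \<rho> base in auto)
  then show ?thesis by (rule that)
qed

text \<open>Each inequality for the modulus is tested with a real \<open>c\<close> above the other
  side. Such a \<open>c\<close> is a Lipschitz constant of the argmin map near 0: above
  \<open>scd_reg\<close> by the mean value inequality, above the tilt modulus by definition of the
  upper limit, and then it bounds all adjoint SCD elements.\<close>

lemma (in prox_setting) tilt_radius_imp_SCD:
  assumes tr: "tilt_radius q xbar \<gamma>"
  shows "SCD_regular_around (subdiff q) (xbar, 0)"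
    and "\<forall>L\<in>SCD (subdiff q) (xbar, 0). \<forall>p. (C_mat L *v p) \<bullet> p \<ge> 0"
    and "tilt_modulus q xbar \<gamma> = scd_reg (subdiff q) (xbar, 0)"
proof -
  define M where "M = (\<lambda>v. the_elem (tilt_argmin q xbar \<gamma> v))"
  obtain \<delta> \<eta>' K P' where \<delta>: "0 < \<delta>" and lp: "lipschitz_local_param (subdiff q) (xbar, 0) 0 \<eta>' K P'"
    and P'M: "\<And>v. v \<in> ball 0 \<delta> \<Longrightarrow> P' v = M v"
    and mono: "\<And>v w. v \<in> ball 0 \<delta> \<Longrightarrow> w \<in> ball 0 \<delta> \<Longrightarrow> (M v - M w) \<bullet> (v - w) \<ge> 0"
    unfolding M_def by (rule local_param_of_tilt_radius[OF tr]) blast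
  interpret tp: lipschitz_local_param "subdiff q" "(xbar, 0)" 0 \<eta>' K P' by (rule lp)
  let ?z = "(xbar, 0 :: real^'n)"
  have lipK: "K-lipschitz_on (ball (snd ?z) \<delta>) P'"
    by (rule lipschitz_on_subset[OF tp.lip]) simp
  have "SCD_adj (subdiff q) (xbar, 0) \<subseteq> Zn_reg"
  proof
    fix L assume L: "L \<in> SCD_adj (subdiff q) (xbar, 0)"
    have "ys = 0" if "(ys, 0) \<in> L" for ys
      using tp.norm_fst_SCD_adj_le[OF refl lipK \<delta> L that] by simp
    then show "L \<in> Zn_reg" using L by (auto simp: Zn_reg_def SCD_adj_def)
  qed
  then show "SCD_regular_around (subdiff q) (xbar, 0)"
    using tp.SCD_property by (simp add: SCD_regular_around_def)
  show "\<forall>L\<in>SCD (subdiff q) (xbar, 0). \<forall>p. (C_mat L *v p) \<bullet> p \<ge> 0"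
    using tp.SCD_nonneg[OF refl lipK \<delta>] mono P'M by simp
  let ?F = "at (0, 0) within {(v :: real^'n, w :: real^'n). v \<noteq> w}"
  let ?quot = "\<lambda>(v, w). ereal (norm (M v - M w) / norm (v - w))"
  have tm: "tilt_modulus q xbar \<gamma> = Limsup ?F ?quot"
    by (simp add: tilt_modulus_def M_def)
  show "tilt_modulus q xbar \<gamma> = scd_reg (subdiff q) (xbar, 0)"
  proof (rule antisym)
    show "tilt_modulus q xbar \<gamma> \<le> scd_reg (subdiff q) (xbar, 0)"
    proof (rule dense_ge)
      fix b assume b: "scd_reg (subdiff q) (xbar, 0) < b"
      show "tilt_modulus q xbar \<gamma> \<le> b"
      proof (cases b)
        case (real c)
        then obtain \<delta>' where \<delta>': "\<delta>' > 0" "c-lipschitz_on (ball 0 \<delta>') P'"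
          using tp.lipschitz_on_of_scd_reg_less[OF refl, of c] b by auto
        have "\<forall>\<^sub>F vw in ?F. ?quot vw \<le> b"
          unfolding eventually_at
        proof (intro exI[of _ "min \<delta> \<delta>'"] conjI ballI impI)
          fix vw :: "(real^'n) \<times> (real^'n)"
          assume vw: "vw \<in> {(v, w). v \<noteq> w}" "vw \<noteq> (0, 0) \<and> dist vw (0, 0) < min \<delta> \<delta>'"
          obtain v w where e: "vw = (v, w)" by (cases vw)
          have ne: "v \<noteq> w" using vw e by simp
          have "norm (v, w) < min \<delta> \<delta>'" using vw(2) by (simp add: e dist_norm)
          then have n: "norm v < min \<delta> \<delta>'" "norm w < min \<delta> \<delta>'"
            using norm_fst_le[of v w] norm_snd_le[of w v] by linarith+
          have "norm (M v - M w) \<le> c * norm (v - w)"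
            using lipschitz_onD[OF \<delta>'(2), of v w] n P'M[of v] P'M[of w] by (simp add: dist_norm)
          then show "?quot vw \<le> b" using ne by (simp add: e real pos_divide_le_eq)
        qed (use \<delta> \<delta>' in auto)
        then show ?thesis unfolding tm by (rule Limsup_bounded)
      qed (use b in auto)
    qed
    show "scd_reg (subdiff q) (xbar, 0) \<le> tilt_modulus q xbar \<gamma>"
    proof (rule dense_ge)
      fix b assume b: "tilt_modulus q xbar \<gamma> < b"
      show "scd_reg (subdiff q) (xbar, 0) \<le> b"
      proof (cases b)
        case (real c)
        have "\<forall>\<^sub>F vw in ?F. ?quot vw < b" using b unfolding tm by (rule Limsup_lessD)
        then obtain d where d: "d > 0"
          "\<And>v w. v \<noteq> w \<Longrightarrow> dist (v, w) (0, 0) < d \<Longrightarrow> ?quot (v, w) < b"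
          unfolding eventually_at by fastforce
        \<comment> \<open>Halved because the pair \<open>(v, w)\<close> must be within
          \<open>d\<close> of the origin and its norm is at most the sum of the two norms.\<close>
        define d' where "d' = min \<delta> (d / 2)"
        have d': "d' > 0" using d \<delta> by (simp add: d'_def)
        have less: "norm (M v - M w) / norm (v - w) < c" if "v \<noteq> w" "v \<in> ball 0 d'" "w \<in> ball 0 d'" for v w
        proof -
          have "norm (v, w) \<le> norm v + norm w" by (rule norm_Pair_le)
          also have "\<dots> < d" using that by (simp add: d'_def)
          finally have "dist (v, w) (0, 0) < d" by (simp add: dist_norm)
          from d(2)[OF that(1) this] show ?thesis by (simp add: real)
        qed
        \<comment> \<open>Some nonnegative difference quotient lies below \<open>c\<close>; a vector
          \<open>h\<close> of norm \<open>d' / 2\<close> provides one.\<close>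
        have c0: "c \<ge> 0"
        proof -
          obtain h :: "real^'n" where h: "norm h = d' / 2" using vector_choose_size[of "d' / 2"] d' by auto
          then have "norm (M h - M 0) / norm (h - 0) < c" using d' by (intro less) auto
          then show ?thesis
            by (rule order_trans[OF divide_nonneg_nonneg[OF norm_ge_zero norm_ge_zero] less_imp_le])
        qed
        have lipc: "c-lipschitz_on (ball (snd ?z) d') P'"
        proof (rule lipschitz_onI)
          fix v w assume vw: "v \<in> ball (snd ?z) d'" "w \<in> ball (snd ?z) d'"
          show "dist (P' v) (P' w) \<le> c * dist v w"
          proof (cases "v = w")
            case False
            then have "norm (M v - M w) / norm (v - w) < c" using vw by (intro less) auto
            then have "norm (M v - M w) \<le> c * norm (v - w)" using False by (simp add: pos_divide_less_eq less_imp_le)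
            moreover have "P' v = M v" "P' w = M w" using vw by (auto intro!: P'M simp: d'_def)
            ultimately show ?thesis by (simp add: dist_norm)
          qed simp
        qed (rule c0)
        show ?thesis unfolding scd_reg_def
        proof (rule Sup_least, clarify)
          fix ys xs L
          assume L: "L \<in> SCD_adj (subdiff q) (xbar, 0)" "(ys, xs) \<in> L" "norm xs \<le> 1"
          have "norm ys \<le> c * norm xs"
            using tp.norm_fst_SCD_adj_le[OF refl lipc d' L(1,2)] by simp
          also have "\<dots> \<le> c * 1" using L(3) c0 by (intro mult_left_mono)
          finally show "ereal (norm ys) \<le> b" by (simp add: real)
        qed
      qed (use b in auto)
    qed
  qed
qed

lemma (in prox_setting) tilt_radius_of_SCD:
  assumes reg: "SCD_regular_around (subdiff q) (xbar, 0)"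
    and psd: "\<forall>L\<in>SCD (subdiff q) (xbar, 0). \<forall>p. (C_mat L *v p) \<bullet> p \<ge> 0"
  shows "\<exists>\<gamma>. tilt_radius q xbar \<gamma>"
proof -
  have par: "lp.par (xbar, 0) = r *\<^sub>R xbar" by (simp add: lp.par_def)
  obtain c \<delta> where c: "c > 0" and \<delta>: "\<delta> > 0"
    and der: "\<And>u B h. u \<in> ball (r *\<^sub>R xbar) \<delta> \<Longrightarrow> (P has_derivative B) (at u) \<Longrightarrow>
      (h - r *\<^sub>R B h) \<bullet> h \<ge> c * (norm h)\<^sup>2"
    using lp.derivative_strongly_monotone[OF _ psd] reg unfolding par SCD_regular_around_def by blast
  define \<delta>' where "\<delta>' = min \<delta> (\<delta>0 / 2)"
  let ?Q = "\<lambda>u. u - r *\<^sub>R P u"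
  have "(1 + r)-lipschitz_on UNIV ?Q"
  proof (rule lipschitz_onI)
    fix u v
    have "norm (?Q u - ?Q v) \<le> norm (u - v) + r * norm (P u - P v)"
    proof -
      have "?Q u - ?Q v = (u - v) - r *\<^sub>R (P u - P v)" by (simp add: algebra_simps)
      then show ?thesis using norm_triangle_ineq4[of "u - v" "r *\<^sub>R (P u - P v)"] r_ge by (simp only:) simp
    qed
    also have "\<dots> \<le> norm (u - v) + r * norm (u - v)"
      using lipschitz_onD[OF P_lipschitz, of u v] r_ge by (intro add_left_mono mult_left_mono) (auto simp: dist_norm)
    finally show "dist (?Q u) (?Q v) \<le> (1 + r) * dist u v" by (simp add: dist_norm algebra_simps)
  qed (use r_ge in simp)
  moreover have "Q' h \<bullet> h \<ge> c * (norm h)\<^sup>2" if u: "u \<in> ball (r *\<^sub>R xbar) \<delta>'" and Q': "(?Q has_derivative Q') (at u)" for u Q' h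
  proof -
    \<comment> \<open>The mean value inequality asks about every derivative of \<open>?Q\<close>. As
      \<open>r\<close> is positive, \<open>P\<close> is recovered from \<open>?Q\<close>, so such a
      derivative comes from one of \<open>P\<close>, where the bound is known.\<close>
    have "((\<lambda>u. (1 / r) *\<^sub>R (u - ?Q u)) has_derivative (\<lambda>h. (1 / r) *\<^sub>R (h - Q' h))) (at u)"
      by (intro derivative_intros Q')
    moreover have "(\<lambda>u. (1 / r) *\<^sub>R (u - ?Q u)) = P" using r_ge by (simp add: fun_eq_iff)
    ultimately have "(P has_derivative (\<lambda>h. (1 / r) *\<^sub>R (h - Q' h))) (at u)" by simp
    from der[OF _ this, of h] u show ?thesis using r_ge by (simp add: \<delta>'_def)
  qed
  ultimately have Q: "(?Q u - ?Q v) \<bullet> (u - v) \<ge> c * (norm (u - v))\<^sup>2"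
    if "u \<in> ball (r *\<^sub>R xbar) \<delta>'" "v \<in> ball (r *\<^sub>R xbar) \<delta>'" for u v
    using lipschitz_strongly_monotone_of_derivative[of "1 + r" ?Q "r *\<^sub>R xbar" \<delta>' c v u] that by blast
  show ?thesis
  proof (rule tilt_radius_of_strongly_monotone[OF c])
    show "0 < \<delta>'" using \<delta> delta0 by (simp add: \<delta>'_def)
    fix u v assume uv: "u \<in> ball (r *\<^sub>R xbar) \<delta>'" "v \<in> ball (r *\<^sub>R xbar) \<delta>'"
    then have "P u = px u" "P v = px v" by (auto intro!: P_eq simp: \<delta>'_def)
    then show "c * (norm (u - v))\<^sup>2 \<le> (u - r *\<^sub>R px u - (v - r *\<^sub>R px v)) \<bullet> (u - v)" using Q[OF uv] by simp
  qed
qed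

theorem theorem7p9:
  fixes q :: "real^'n \<Rightarrow> ereal" and xbar :: "real^'n"
  assumes "0 \<in> subdiff q xbar"
    and "prox_regular q xbar 0"
    and "subdiff_continuous q xbar 0"
  shows "(tilt_stable_local_min q xbar \<longleftrightarrow>
            SCD_regular_around (subdiff q) (xbar, 0) \<and>
            (\<forall>L \<in> SCD (subdiff q) (xbar, 0). \<forall>p. (C_mat L *v p) \<bullet> p \<ge> 0)) \<and>
         (tilt_stable_local_min q xbar \<longrightarrow>
            (\<forall>\<gamma>. tilt_radius q xbar \<gamma> \<longrightarrow>
               tilt_modulus q xbar \<gamma> = scd_reg (subdiff q) (xbar, 0)))"
proof -
  obtain \<epsilon> \<rho> where "prox_setting q xbar \<epsilon> \<rho>" by (rule prox_setting_exists[OF assms])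
  then interpret prox_setting q xbar \<epsilon> \<rho> .
  have "tilt_stable_local_min q xbar \<longleftrightarrow> (\<exists>\<gamma>. tilt_radius q xbar \<gamma>)"
    using qr[OF xbar_finite] by (simp add: tilt_stable_local_min_def)
  then show ?thesis using tilt_radius_imp_SCD tilt_radius_of_SCD by blast
qed

end
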